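(* Assume $\frac{2N}{N+2s}\le p<2$ and let $u_0\in L^2(\Omega)$ be nonnegative. Let $u$ be the unique nonnegative energy solution of $$u_t+(-\Delta)^s_pu=0\ \text{in }\Omega_T,\quad u\ge0,\quad u=0\ \text{in }(\mathbb{R}^N\setminus\Omega)\times(0,T),\quad u(x,0)=u_0(x)\ \text{in }\Omega$$ (for every $T>0$). Then there is a finite time $T^*$ with $$T^*\le\frac{2}{(2-p)S}\,\|u_0\|_{L^2(\Omega)}^{2-p}\,|\Omega|^{\frac p2-\frac{p}{p^*_s}}$$ such that $u(\cdot,t)\equiv0$ for all $t\ge T^*$.
   Context: $\Omega\subset\mathbb{R}^N$ is a bounded domain with regular boundary, $0<s<1$, $1<p<N$, $\Omega_T=\Omega\times(0,T)$, $(-\Delta)^s_p w(x)=\mathrm{P.V.}\int_{\mathbb{R}^N}\frac{|w(x)-w(y)|^{p-2}(w(x)-w(y))}{|x-y|^{N+ps}}dy$, $p^*_s=\frac{pN}{N-ps}$. $S=S(N,s,p)>0$ is the constant in the fractional Sobolev inequality $\int_{\mathbb{R}^N}\int_{\mathbb{R}^N}\frac{|v(x)-v(y)|^p}{|x-y|^{N+ps}}dxdy\ge S(\int_{\mathbb{R}^N}|v|^{p^*_s}dx)^{p/p^*_s}$ for $v\in C_c^\infty(\mathbb{R}^N)$. Energy solution: $u\in L^p(0,T;W^{s,p}_0(\Omega))\cap C([0,T];L^2(\Omega))$, $u_t\in L^{p'}(0,T;W^{-s,p'}(\Omega))$, $u(t)\to u_0$ in $L^2$, and $\int_0^T\langle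 u_t,v\rangle dt+\frac12\int_0^T\iint_{D_\Omega}|u(x,t)-u(y,t)|^{p-2}(u(x,t)-u(y,t))(v(x,t)-v(y,t))\frac{dxdy}{|x-y|^{N+ps}}dt=0$ for all $v\in L^p(0,T;W^{s,p}_0(\Omega))$, where $D_\Omega=\mathbb{R}^{2N}\setminus((\mathbb{R}^N\setminus\Omega)^2)$ and $W^{s,p}_0(\Omega)$ is the completion of $C_c^\infty(\Omega)$ for the $W^{s,p}$ norm. *)

theory Defs
  imports "HOL-Analysis.Analysis"
begin

primrec Ck :: "nat \<Rightarrow> ('a::euclidean_space \<Rightarrow> real) \<Rightarrow> bool" where
  "Ck 0 f = continuous_on UNIV f"
| "Ck (Suc n) f = (f differentiable_on UNIV \<and>
      (\<forall>v. Ck n (\<lambda>x. frechet_derivative f (at x) v)))"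

definition smooth_fun :: "('a::euclidean_space \<Rightarrow> real) \<Rightarrow> bool" where
  "smooth_fun f \<longleftrightarrow> (\<forall>n. Ck n f)"

definition test_fun :: "'a::euclidean_space set \<Rightarrow> ('a \<Rightarrow> real) \<Rightarrow> bool" where
  "test_fun U f \<longleftrightarrow> smooth_fun f \<and> compact (closure {x. f x \<noteq> 0})
      \<and> closure {x. f x \<noteq> 0} \<subseteq> U"

definition lpn :: "real \<Rightarrow> ('a::euclidean_space \<Rightarrow> real) \<Rightarrow> ennreal" where
  "lpn q v = (\<integral>\<^sup>+ x. ennreal (\<bar>v x\<bar> powr q) \<partial>lborel)"

definition gag :: "real \<Rightarrow> real \<Rightarrow> ('a::euclidean_space \<Rightarrow> real) \<Rightarrow> ennreal" where
  "gag s p v = (\<integral>\<^sup>+ x. \<integral>\<^sup>+ y. ennreal (\<bar>v x - v y\<bar> powr p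
       / norm (x - y) powr (real DIM('a) + p * s)) \<partial>lborel \<partial>lborel)"

definition wnorm :: "real \<Rightarrow> real \<Rightarrow> ('a::euclidean_space \<Rightarrow> real) \<Rightarrow> real" where
  "wnorm s p v = enn2real (lpn p v) powr (1 / p) + enn2real (gag s p v) powr (1 / p)"

definition W0 :: "real \<Rightarrow> real \<Rightarrow> 'a::euclidean_space set \<Rightarrow> ('a \<Rightarrow> real) set" where
  "W0 s p \<Omega> = {v. v \<in> borel_measurable lborel \<and> lpn p v < \<infinity> \<and> gag s p v < \<infinity> \<and>
      (\<exists>\<phi>. (\<forall>k. test_fun \<Omega> (\<phi> k)) \<and>
         (\<lambda>k. lpn p (\<lambda>x. \<phi> k x - v x) + gag s p (\<lambda>x. \<phi> k x - v x)) \<longlonglongrightarrow> 0)}"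

definition LpW :: "real \<Rightarrow> real \<Rightarrow> 'a::euclidean_space set \<Rightarrow> real \<Rightarrow> ('a \<Rightarrow> real \<Rightarrow> real) \<Rightarrow> bool" where
  "LpW s p \<Omega> T v \<longleftrightarrow>
     (\<lambda>(x, t). v x t) \<in> borel_measurable (lborel \<Otimes>\<^sub>M lborel) \<and>
     (AE t in lborel. t \<in> {0<..<T} \<longrightarrow> (\<lambda>x. v x t) \<in> W0 s p \<Omega>) \<and>
     (\<integral>\<^sup>+ t\<in>{0<..<T}. ennreal (wnorm s p (\<lambda>x. v x t) powr p) \<partial>lborel) < \<infinity>"

definition D_set :: "'a set \<Rightarrow> ('a \<times> 'a) set" where
  "D_set \<Omega> = UNIV - ((UNIV - \<Omega>) \<times> (UNIV - \<Omega>))"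

definition frac_kernel :: "real \<Rightarrow> real \<Rightarrow> ('a::euclidean_space \<Rightarrow> real) \<Rightarrow> ('a \<Rightarrow> real) \<Rightarrow> 'a \<times> 'a \<Rightarrow> real" where
  "frac_kernel s p w v z = (let x = fst z; y = snd z in
     \<bar>w x - w y\<bar> powr (p - 2) * (w x - w y) * (v x - v y)
       / norm (x - y) powr (real DIM('a) + p * s))"

(* Energy solution on \<Omega>_T of u_t + (-\<Delta>)^s_p u = 0, u = 0 outside \<Omega>, u(0) = u0.
   The time derivative u_t \<in> L^{p'}(0,T;W^{-s,p'}(\<Omega>)) is given by a family w t of
   bounded linear functionals on W^{s,p}_0(\<Omega>) whose dual norms are dominated by
   g \<in> L^{p'}(0,T), and which is the distributional time derivative of u. *)
definition energy_solution ::
  "real \<Rightarrow> real \<Rightarrow> 'a::euclidean_space set \<Rightarrow> ('a \<Rightarrow> real) \<Rightarrow> real \<Rightarrow> ('a \<Rightarrow> real \<Rightarrow> real) \<Rightarrow> bool" where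
  "energy_solution s p \<Omega> u0 T u \<longleftrightarrow>
     LpW s p \<Omega> T u \<and>
     (\<forall>t\<in>{0..T}. (\<lambda>x. u x t) \<in> borel_measurable lborel \<and>
         (\<integral>\<^sup>+ x\<in>\<Omega>. ennreal ((u x t)\<^sup>2) \<partial>lborel) < \<infinity>) \<and>
     (\<forall>t0\<in>{0..T}. ((\<lambda>t. \<integral>\<^sup>+ x\<in>\<Omega>. ennreal ((u x t - u x t0)\<^sup>2) \<partial>lborel)
                     \<longlongrightarrow> 0) (at t0 within {0..T})) \<and>
     ((\<lambda>t. \<integral>\<^sup>+ x\<in>\<Omega>. ennreal ((u x t - u0 x)\<^sup>2) \<partial>lborel) \<longlongrightarrow> 0) (at_right 0) \<and>
     (\<exists>(w :: real \<Rightarrow> ('a \<Rightarrow> real) \<Rightarrow> real) (g :: real \<Rightarrow> real).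
        g \<in> borel_measurable lborel \<and>
        (\<integral>\<^sup>+ t\<in>{0<..<T}. ennreal (\<bar>g t\<bar> powr (p / (p - 1))) \<partial>lborel) < \<infinity> \<and>
        (\<forall>t\<in>{0<..<T}.
           (\<forall>v1\<in>W0 s p \<Omega>. \<forall>v2\<in>W0 s p \<Omega>. \<forall>a b.
               w t (\<lambda>x. a * v1 x + b * v2 x) = a * w t v1 + b * w t v2) \<and>
           (\<forall>v\<in>W0 s p \<Omega>. \<bar>w t v\<bar> \<le> g t * wnorm s p v)) \<and>
        (\<forall>v \<phi>. test_fun \<Omega> v \<longrightarrow> test_fun {0<..<T} \<phi> \<longrightarrow>
           (\<integral>t\<in>{0<..<T}. deriv \<phi> t * (\<integral>x\<in>\<Omega>. u x t * v x \<partial>lborel) \<partial>lborel)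
             = - (\<integral>t\<in>{0<..<T}. \<phi> t * w t v \<partial>lborel)) \<and>
        (\<forall>v. LpW s p \<Omega> T v \<longrightarrow>
           set_integrable lborel {0<..<T} (\<lambda>t. w t (\<lambda>x. v x t)) \<and>
           (\<integral>t\<in>{0<..<T}. w t (\<lambda>x. v x t) \<partial>lborel)
           + 1 / 2 * (\<integral>t\<in>{0<..<T}.
                (\<integral>z\<in>D_set \<Omega>. frac_kernel s p (\<lambda>x. u x t) (\<lambda>x. v x t) z \<partial>(lborel \<Otimes>\<^sub>M lborel))
              \<partial>lborel) = 0))"

end

theory Submission
  imports Defs
begin

text \<open>Testing the equation with \<open>u\<close> itself would give \<open>y' + [u]\<^sup>p = 0\<close> for
  \<open>y t = \<integral>\<^bsub>\<Omega>\<^esub> u(t)\<^sup>2\<close>, where \<open>[u]\<^sup>p\<close> is the Gagliardo energy. Sobolev and Hoelder bound \<open>[u]\<^sup>p\<close> below by a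
  multiple of \<open>y\<close> to the power \<open>p / 2 < 1\<close>, so \<open>y\<close> to the power \<open>1 - p / 2\<close> decreases at least linearly and
  vanishes in finite time.

  Only the inequality \<open>y t2 + \<integral>\<^bsub>t1\<^esub>\<^bsup>t2\<^esup> [u]\<^sup>p \<le> y t1\<close> is needed, and it is obtained without the
  Lions-Magenes chain rule. Time cutoffs in the distributional equation give
  \<open>\<langle>u(t) - u(t - h), v\<rangle> = - 1/2 \<integral>\<^bsub>t-h\<^esub>\<^bsup>t\<^esup> E(u(\<tau>), v) d\<tau>\<close> for fixed \<open>v\<close> in \<open>W\<^sub>0\<^bsup>s,p\<^esup>\<close>, where
  \<open>E\<close> is the form of the fractional p-Laplacian. Taking \<open>v = u(t)\<close> yields
  \<open>y t - y (t - h) \<le> - \<integral>\<^bsub>t-h\<^esub>\<^bsup>t\<^esup> E(u(\<tau>), u(t)) d\<tau>\<close>. After averaging over \<open>t\<close>, one lets \<open>h\<close> tend to 0: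
  adding the two Young terms makes the integrand of \<open>E(u(t - \<sigma>), u(t))\<close> nonnegative, and Fatou's lemma
  applies because \<open>u(t - \<sigma>)\<close> converges to \<open>u(t)\<close> in \<open>L\<^sup>2\<close>, hence almost everywhere along subsequences.\<close>

section \<open>Smooth cutoffs in time\<close>

text \<open>The equation describes the time derivative twice: distributionally, and through the
  functionals \<open>w t\<close>. Testing with a time cutoff times a spatial test function
  eliminates \<open>w\<close>, and everything later works with \<open>gag_form\<close> alone. The
  backward difference is forced: in |a|^2 - |b|^2 = 2 (a - b) a - |a - b|^2 the discarded square has
  the right sign when \<open>a\<close>, the later state, is the test function. The Young terms cost
  nothing in the limit. They have weights 1 - 1/p and 1/p, so the lagged form is bounded below by
  twice the Gagliardo energy, while the same terms on the other side add up to one copy of it; the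
  difference is exactly one copy. The lower bound on p says that the Sobolev exponent is at least 2,
  so Hoelder on the bounded domain leads from L^q to L^2. The factor 2 / (2 - p) is 1 / (1 - p/2)
  and stems from differentiating the power 1 - p/2 of \<open>y\<close>. Time 0 is reached last, by
  continuity of \<open>y\<close>, because the energy inequality is proved between positive
  times.\<close>

lemma smooth_fun_real:
  fixes F :: "nat \<Rightarrow> real \<Rightarrow> real"
  assumes F: "\<And>n x. (F n has_real_derivative F (Suc n) x) (at x)"
  shows "smooth_fun (F 0)"
proof -
  \<comment> \<open>The factor \<open>c\<close> carries the directions of differentiation: a
    derivative in direction \<open>v\<close> replaces \<open>c\<close> by \<open>c * v\<close>, so
    the induction has to cover all multiples of all members of the chain.\<close>
  have "Ck n (\<lambda>x. F m x * c)" for n m c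
  proof (induction n arbitrary: m c)
    case 0
    have "isCont (F m) x" for x
      using F by (rule DERIV_isCont)
    then show ?case
      by (auto intro!: continuous_at_imp_continuous_on continuous_intros)
  next
    case (Suc n)
    have D: "((\<lambda>x. F m x * c) has_derivative (\<lambda>v. F (Suc m) x * (c * v))) (at x)" for x
      using DERIV_cmult_right[OF F, of m c x]
      by (rule has_derivative_eq_rhs[OF has_field_derivative_imp_has_derivative]) (auto simp: fun_eq_iff)
    have eq: "frechet_derivative (\<lambda>x. F m x * c) (at x) v = F (Suc m) x * (c * v)" for x v
      using frechet_derivative_at[OF D] by metis
    have "(\<lambda>x. F m x * c) differentiable_on UNIV"
      using D by (auto simp: differentiable_on_def differentiable_def)
    then show ?case
      using Suc by (simp add: eq)
  qed
  from this[of _ 0 1] show ?thesis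
    by (simp add: smooth_fun_def)
qed

section \<open>The standard bump function and its primitive\<close>

lemma power_le_fact_exp:
  fixes z :: real
  assumes "0 \<le> z"
  shows "z ^ k \<le> fact k * exp z"
proof -
  have "(\<Sum>n\<in>{k}. inverse (fact n) * z ^ n) \<le> (\<Sum>n. inverse (fact n) * z ^ n)"
    using assms by (intro sum_le_suminf summable_exp) auto
  also have "\<dots> = exp z"
    by (simp add: exp_def)
  finally show ?thesis
    by (simp add: field_simps)
qed

lemma DERIV_zero_of_quadratic_bound:
  fixes f :: "real \<Rightarrow> real"
  assumes "f c = 0" and "0 < d" and bound: "\<And>y. \<bar>y - c\<bar> < d \<Longrightarrow> \<bar>f y\<bar> \<le> C * (y - c)\<^sup>2"
  shows "(f has_real_derivative 0) (at c)"
proof -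
  have "((\<lambda>y. (f y - f c) / (y - c)) \<longlongrightarrow> 0) (at c)"
  proof (rule Lim_null_comparison)
    show "\<forall>\<^sub>F y in at c. norm ((f y - f c) / (y - c)) \<le> C * \<bar>y - c\<bar>"
      unfolding eventually_at
    proof (intro exI[of _ d] conjI ballI impI)
      fix y assume "y \<noteq> c \<and> dist y c < d"
      then have *: "\<bar>f y\<bar> \<le> C * (y - c)\<^sup>2" "0 < \<bar>y - c\<bar>"
        using bound by (auto simp: dist_real_def)
      have "\<bar>f y\<bar> / \<bar>y - c\<bar> \<le> C * \<bar>y - c\<bar>"
        using * by (simp add: divide_le_eq power2_eq_square flip: abs_mult)
      then show "norm ((f y - f c) / (y - c)) \<le> C * \<bar>y - c\<bar>"
        using assms(1) by simp
    qed (fact)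
    have "((\<lambda>y. C * \<bar>y - c\<bar>) \<longlongrightarrow> C * \<bar>c - c\<bar>) (at c)"
      by (intro tendsto_intros)
    then show "((\<lambda>y. C * \<bar>y - c\<bar>) \<longlongrightarrow> 0) (at c)"
      by simp
  qed
  then show ?thesis
    by (simp add: has_field_derivative_iff)
qed

text \<open>Up to the exponential, the n-th derivative of \<open>exp (- 1 / w)\<close> with \<open>w = 1 - x\<^sup>2\<close> is
  a polynomial divided by \<open>w ^ (2 * n)\<close>.\<close>

primrec bump_poly :: "nat \<Rightarrow> real poly" where
  "bump_poly 0 = 1"
| "bump_poly (Suc n) = pderiv (bump_poly n) * [:1, 0, -1:]\<^sup>2
     + [:0, 4 * real n:] * bump_poly n * [:1, 0, -1:] - [:0, 2:] * bump_poly n"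

definition bump_deriv :: "nat \<Rightarrow> real \<Rightarrow> real" where
  "bump_deriv n x = (if \<bar>x\<bar> < 1
     then poly (bump_poly n) x * inverse (1 - x\<^sup>2) ^ (2 * n) * exp (- inverse (1 - x\<^sup>2)) else 0)"

lemma bump_deriv_inside:
  assumes "\<bar>x\<bar> < 1"
  shows "(bump_deriv n has_real_derivative bump_deriv (Suc n) x) (at x)"
proof -
  define w where "w = 1 - x\<^sup>2"
  have w: "w > 0"
    using assms by (simp add: w_def abs_square_less_1)
  define V where "V = inverse w"
  have Vw: "V * w = 1"
    using w by (simp add: V_def)
  define P where "P = poly (bump_poly n) x"
  define P' where "P' = poly (pderiv (bump_poly n)) x"
  have DV: "((\<lambda>x. inverse (1 - x\<^sup>2)) has_real_derivative 2 * x * V\<^sup>2) (at x)"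
    using w by (auto intro!: derivative_eq_intros simp: V_def w_def power2_eq_square)
  have DVn: "((\<lambda>x. inverse (1 - x\<^sup>2) ^ (2 * n)) has_real_derivative 4 * real n * x * V * V ^ (2 * n)) (at x)"
    by (rule DERIV_cong[OF DERIV_power[OF DV]])
       (cases n; simp add: V_def w_def power2_eq_square algebra_simps)
  have De: "((\<lambda>x. exp (- inverse (1 - x\<^sup>2))) has_real_derivative - (2 * x * V\<^sup>2) * exp (- V)) (at x)"
    by (rule DERIV_cong[OF DERIV_fun_exp[OF DERIV_minus[OF DV]]]) (simp add: V_def w_def)
  have DP: "(poly (bump_poly n) has_real_derivative P') (at x)"
    unfolding P'_def by (rule poly_DERIV)
  have D: "((\<lambda>x. poly (bump_poly n) x * inverse (1 - x\<^sup>2) ^ (2 * n) * exp (- inverse (1 - x\<^sup>2)))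
      has_real_derivative (P' + 4 * real n * x * V * P - 2 * x * V\<^sup>2 * P) * V ^ (2 * n) * exp (- V)) (at x)"
    by (rule DERIV_cong[OF DERIV_mult[OF DERIV_mult[OF DP DVn] De]])
       (simp add: P_def V_def w_def algebra_simps)
  \<comment> \<open>Inserting powers of \<open>V * w = 1\<close> gives all three terms the factor
    \<open>V\<^sup>2\<close>; what remains is the recursion of \<open>bump_poly\<close>.\<close>
  have "(P' + 4 * real n * x * V * P - 2 * x * V\<^sup>2 * P)
      = (P' * (V * w)\<^sup>2 + 4 * real n * x * V * P * (V * w) - 2 * x * V\<^sup>2 * P)"
    by (simp add: Vw)
  also have "\<dots> = (P' * w\<^sup>2 + 4 * real n * x * P * w - 2 * x * P) * V\<^sup>2"
    by (simp add: power2_eq_square algebra_simps)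
  also have "\<dots> = poly (bump_poly (Suc n)) x * V\<^sup>2"
    unfolding P_def P'_def w_def by (simp add: algebra_simps power2_eq_square)
  finally have "(P' + 4 * real n * x * V * P - 2 * x * V\<^sup>2 * P) * V ^ (2 * n) * exp (- V)
      = poly (bump_poly (Suc n)) x * V ^ (2 * Suc n) * exp (- V)"
    by (simp add: power2_eq_square)
  then have "(P' + 4 * real n * x * V * P - 2 * x * V\<^sup>2 * P) * V ^ (2 * n) * exp (- V) = bump_deriv (Suc n) x"
    using assms unfolding bump_deriv_def V_def w_def by (simp del: bump_poly.simps)
  with D have "((\<lambda>x. poly (bump_poly n) x * inverse (1 - x\<^sup>2) ^ (2 * n) * exp (- inverse (1 - x\<^sup>2)))
      has_real_derivative bump_deriv (Suc n) x) (at x)"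
    by (simp only:)
  then show ?thesis
    by (rule has_field_derivative_transform_within_open[of _ _ _ "{-1<..<1}"])
       (use assms in \<open>auto simp: bump_deriv_def abs_less_iff\<close>)
qed

text \<open>The exponential beats every power of \<open>1 / w\<close>, and the two spare powers in
  \<open>2 * n + 2\<close> make \<open>bump_deriv n\<close> of order \<open>w\<^sup>2\<close>. Since
  \<open>w\<close> has a simple zero at the endpoint, this is a quadratic bound. The factor 9 is a
  crude bound for \<open>(c + y)\<^sup>2\<close>.\<close>

lemma bump_deriv_boundary:
  assumes "\<bar>c\<bar> = 1"
  shows "(bump_deriv n has_real_derivative 0) (at c)"
proof -
  have "continuous_on {-1..1} (poly (bump_poly n))"
    by (intro continuous_intros)
  then have "bounded (poly (bump_poly n) ` {-1..1})"
    by (intro compact_imp_bounded compact_continuous_image) auto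
  then obtain M where M: "\<forall>x\<in>{-1..1}. \<bar>poly (bump_poly n) x\<bar> \<le> M"
    unfolding bounded_iff by auto
  have "0 \<le> M"
    using M[rule_format, of 0] by simp
  define K :: real where "K = fact (2 * n + 2)"
  show ?thesis
  proof (rule DERIV_zero_of_quadratic_bound[where d = 1 and C = "M * K * 9"])
    show "bump_deriv n c = 0"
      using assms by (simp add: bump_deriv_def)
    fix y assume y: "\<bar>y - c\<bar> < 1"
    show "\<bar>bump_deriv n y\<bar> \<le> M * K * 9 * (y - c)\<^sup>2"
    proof (cases "\<bar>y\<bar> < 1")
      case False
      then show ?thesis
        using \<open>0 \<le> M\<close> by (simp add: bump_deriv_def K_def)
    next
      case True
      define w where "w = 1 - y\<^sup>2"
      have w: "w > 0"
        using True by (simp add: w_def abs_square_less_1)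
      define V where "V = inverse w"
      have V: "V > 0" "V * w = 1"
        using w by (simp_all add: V_def)
      have "V ^ (2 * n + 2) \<le> K * exp V"
        unfolding K_def using V by (intro power_le_fact_exp) simp
      then have "V ^ (2 * n + 2) * exp (- V) \<le> K * exp V * exp (- V)"
        by (rule mult_right_mono) simp
      also have "\<dots> = K"
        by (simp add: mult.assoc flip: exp_add)
      finally have "V ^ (2 * n + 2) * exp (- V) * w\<^sup>2 \<le> K * w\<^sup>2"
        by (rule mult_right_mono) simp
      moreover have "V ^ (2 * n + 2) * exp (- V) * w\<^sup>2 = V ^ (2 * n) * exp (- V) * (V * w)\<^sup>2"
        by (simp add: power_add power2_eq_square)
      ultimately have e: "V ^ (2 * n) * exp (- V) \<le> K * w\<^sup>2"
        by (simp only: V power_one mult_1_right)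
      have "\<bar>bump_deriv n y\<bar> = \<bar>poly (bump_poly n) y\<bar> * (V ^ (2 * n) * exp (- V))"
        using True V by (simp add: bump_deriv_def V_def w_def abs_mult)
      also have "\<dots> \<le> M * (K * w\<^sup>2)"
        using M[rule_format, of y] True e V \<open>0 \<le> M\<close> by (intro mult_mono[OF _ e]) (auto simp: abs_less_iff)
      also have "w\<^sup>2 = (c + y)\<^sup>2 * (y - c)\<^sup>2"
      proof -
        have "w = (c + y) * (c - y)"
          using assms by (auto simp: w_def abs_if power2_eq_square algebra_simps split: if_splits)
        then show ?thesis
          by (simp add: power_mult_distrib power2_commute)
      qed
      also have "(c + y)\<^sup>2 \<le> 3\<^sup>2"
        using True assms by (intro power2_le_iff_abs_le[THEN iffD2]) auto
      finally show ?thesis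
        using \<open>0 \<le> M\<close> by (simp add: mult_left_mono mult_right_mono K_def mult.assoc)
    qed
  qed simp
qed

lemma bump_deriv_has_derivative:
  "(bump_deriv n has_real_derivative bump_deriv (Suc n) x) (at x)"
proof -
  consider "\<bar>x\<bar> < 1" | "\<bar>x\<bar> = 1" | "\<bar>x\<bar> > 1"
    by linarith
  then show ?thesis
  proof cases
    case 1
    then show ?thesis by (rule bump_deriv_inside)
  next
    case 2
    then show ?thesis
      using bump_deriv_boundary[OF 2, of n] by (simp add: bump_deriv_def)
  next
    case 3
    have "open {x::real. \<bar>x\<bar> > 1}"
      by (intro open_Collect_less continuous_intros)
    then have "(bump_deriv n has_real_derivative 0) (at x)"
      using 3 by (intro has_field_derivative_transform_within_open[where f = "\<lambda>_. 0", OF DERIV_const])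
                 (auto simp: bump_deriv_def)
    with 3 show ?thesis
      by (simp add: bump_deriv_def)
  qed
qed

text \<open>\<open>F 0\<close> is the normalised primitive of the bump. The whole chain of
  derivatives is returned because smoothness of rescaled copies needs all of them and
  \<open>F (Suc 0)\<close> becomes the mollifier of the time cutoffs.\<close>

lemma smooth_step:
  obtains F :: "nat \<Rightarrow> real \<Rightarrow> real"
  where "\<And>n x. (F n has_real_derivative F (Suc n) x) (at x)"
    and "\<And>x. x \<le> -1 \<Longrightarrow> F 0 x = 0" and "\<And>x. 1 \<le> x \<Longrightarrow> F 0 x = 1"
    and "\<And>x. 0 \<le> F (Suc 0) x" and "\<And>x. 1 < \<bar>x\<bar> \<Longrightarrow> F (Suc 0) x = 0"
proof -
  let ?b = "bump_deriv 0"
  have cont: "isCont ?b x" for x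
    using bump_deriv_has_derivative by (rule DERIV_isCont)
  obtain G where G: "\<And>x. (G has_real_derivative ?b x) (at x)"
  proof
    \<comment> \<open>The base point lies to the left of the support, so \<open>G\<close> vanishes
      below -1, also where the interval is empty, and its derivative is the bump on the whole
      line.\<close>
    define G where "G = (\<lambda>x. integral {-2..x} ?b)"
    show "(G has_real_derivative ?b x) (at x)" for x
    proof (cases "x > -2")
      case True
      have "(G has_vector_derivative ?b x) (at x within {-2..x + 1})"
        unfolding G_def using True cont
        by (intro integral_has_vector_derivative continuous_at_imp_continuous_on) auto
      then show ?thesis
        using True at_within_interior[of x "{-2..x+1}"]
        by (simp add: has_real_derivative_iff_has_vector_derivative)
    next
      case False
      have "(G has_real_derivative 0) (at x)"
      proof (rule has_field_derivative_transform_within_open[where f = "\<lambda>_. 0", OF DERIV_const])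
        show "open {..<-1::real}" "x \<in> {..<-1}"
          using False by auto
        fix y :: real assume "y \<in> {..<-1}"
        then have "integral {-2..y} ?b = integral {-2..y} (\<lambda>_. 0)"
          by (intro integral_cong) (auto simp: bump_deriv_def)
        then show "0 = G y"
          by (simp add: G_def)
      qed
      then show ?thesis
        using False by (simp add: bump_deriv_def)
    qed
  qed
  have b_nonneg: "0 \<le> ?b x" for x
    by (simp add: bump_deriv_def)
  have const: "G x = G y" if "\<And>z. x \<le> z \<Longrightarrow> z \<le> y \<Longrightarrow> 1 \<le> \<bar>z\<bar>" "x \<le> y" for x y
  proof (rule antisym)
    have "?b z = 0" if "x \<le> z" "z \<le> y" for z
      using \<open>\<And>z. x \<le> z \<Longrightarrow> z \<le> y \<Longrightarrow> 1 \<le> \<bar>z\<bar>\<close>[OF that] by (simp add: bump_deriv_def)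
    then have D: "DERIV G z :> 0" if "x \<le> z" "z \<le> y" for z
      using G[of z] that by simp
    show "G x \<le> G y"
      by (rule DERIV_nonneg_imp_nondecreasing[OF \<open>x \<le> y\<close>]) (use D in blast)
    show "G y \<le> G x"
      by (rule DERIV_nonpos_imp_nonincreasing[OF \<open>x \<le> y\<close>]) (use D in blast)
  qed
  have mono: "G x \<le> G y" if "x \<le> y" for x y
    by (rule DERIV_nonneg_imp_nondecreasing[OF that]) (use G b_nonneg in blast)
  have "G 0 < G (1 / 2)"
  proof (rule DERIV_pos_imp_increasing[where f = G])
    fix x :: real assume "0 \<le> x" "x \<le> 1 / 2"
    then have "?b x > 0"
      by (simp add: bump_deriv_def)
    then show "\<exists>y. DERIV G x :> y \<and> 0 < y"
      using G by blast
  qed simp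
  then have Z: "G 1 - G (-1) > 0"
    using mono[of "-1" 0] mono[of "1/2" 1] by simp
  define Z where "Z = G 1 - G (-1)"
  have "Z \<noteq> 0"
    using Z by (simp add: Z_def)
  define F where "F n = (case n of 0 \<Rightarrow> \<lambda>x. (G x - G (-1)) / Z | Suc m \<Rightarrow> \<lambda>x. bump_deriv m x / Z)" for n
  show ?thesis
  proof
    show "(F n has_real_derivative F (Suc n) x) (at x)" for n x
      unfolding F_def using G[of x] bump_deriv_has_derivative \<open>Z \<noteq> 0\<close>
      by (cases n) (auto intro!: derivative_eq_intros)
    show "F 0 x = 0" if "x \<le> -1" for x
      using const[of x "-1"] that by (simp add: F_def)
    show "F 0 x = 1" if "1 \<le> x" for x
      using const[of 1 x] that Z by (simp add: F_def Z_def)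
    show "0 \<le> F (Suc 0) x" for x
      using Z b_nonneg by (simp add: F_def Z_def)
    show "F (Suc 0) x = 0" if "1 < \<bar>x\<bar>" for x
      using that by (simp add: F_def bump_deriv_def)
  qed
qed


section \<open>Mollifiers and time cutoffs\<close>

lemma approximate_identity:
  fixes \<rho> f :: "real \<Rightarrow> real"
  assumes \<rho>: "continuous_on UNIV \<rho>" "\<And>x. 0 \<le> \<rho> x" "\<And>x. 1 < \<bar>x\<bar> \<Longrightarrow> \<rho> x = 0" "(\<integral>x. \<rho> x \<partial>lborel) = 1"
    and f: "continuous_on {0..T} f" and c: "0 < c" "c < T"
    and r: "\<And>n. 0 < r n" "filterlim r at_top sequentially"
  shows "(\<lambda>n. \<integral>t\<in>{0<..<T}. r n * \<rho> (r n * (t - c)) * f t \<partial>lborel) \<longlonglongrightarrow> f c"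
proof -
  define g where "g t = indicator {0<..<T} t * f t" for t
  have g_meas[measurable]: "g \<in> borel_measurable borel"
    unfolding g_def using borel_measurable_continuous_on_indicator[of "{0<..<T}" f]
    by (simp add: continuous_on_subset[OF f] subset_eq)
  have \<rho>_meas[measurable]: "\<rho> \<in> borel_measurable borel"
    using \<rho>(1) by (rule borel_measurable_continuous_onI)
  have "compact (f ` {0..T})"
    using f by (intro compact_continuous_image) auto
  then obtain B where B: "\<forall>t\<in>{0..T}. \<bar>f t\<bar> \<le> B"
    using compact_imp_bounded[of "f ` {0..T}"] unfolding bounded_iff by auto
  have "0 \<le> B"
    using B[rule_format, of c] c by simp
  have gB: "\<bar>g t\<bar> \<le> B" for t
    using B \<open>0 \<le> B\<close> by (auto simp: g_def indicator_def)
  \<comment> \<open>A non-integrable function has integral 0 by convention, so the value 1 already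
    yields integrability.\<close>
  have \<rho>_int: "integrable lborel \<rho>"
    using \<rho>(4) not_integrable_integral_eq by force
  have eq: "(\<integral>t\<in>{0<..<T}. r n * \<rho> (r n * (t - c)) * f t \<partial>lborel) = (\<integral>x. \<rho> x * g (c + x / r n) \<partial>lborel)" for n
  proof -
    have "(\<integral>t\<in>{0<..<T}. r n * \<rho> (r n * (t - c)) * f t \<partial>lborel) = (\<integral>t. r n * (\<rho> (r n * (t - c)) * g t) \<partial>lborel)"
      unfolding set_lebesgue_integral_def g_def by (intro Bochner_Integration.integral_cong) auto
    also have "\<dots> = r n * (\<integral>t. \<rho> (r n * (t - c)) * g t \<partial>lborel)"
      by simp
    also have "(\<integral>t. \<rho> (r n * (t - c)) * g t \<partial>lborel)
        = \<bar>1 / r n\<bar> *\<^sub>R (\<integral>x. \<rho> (r n * (c + (1 / r n) * x - c)) * g (c + (1 / r n) * x) \<partial>lborel)"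
      using r(1)[of n] by (intro lborel_integral_real_affine) simp
    finally show ?thesis
      using r(1)[of n] by simp
  qed
  have "(\<lambda>n. \<integral>x. \<rho> x * g (c + x / r n) \<partial>lborel) \<longlonglongrightarrow> (\<integral>x. \<rho> x * f c \<partial>lborel)"
  proof (rule integral_dominated_convergence[where w = "\<lambda>x. \<rho> x * B"])
    show "integrable lborel (\<lambda>x. \<rho> x * B)"
      using \<rho>_int by simp
    show "AE x in lborel. (\<lambda>n. \<rho> x * g (c + x / r n)) \<longlonglongrightarrow> \<rho> x * f c"
    proof (rule AE_I2)
      fix x
      have "(\<lambda>n. c + x / r n) \<longlonglongrightarrow> c + 0"
        by (intro tendsto_add[OF tendsto_const] real_tendsto_divide_at_top[OF tendsto_const] r)
      then have lim: "(\<lambda>n. c + x / r n) \<longlonglongrightarrow> c"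
        by simp
      have "isCont f c"
        using f c by (intro continuous_on_interior[of "{0..T}"]) auto
      then have "(\<lambda>n. f (c + x / r n)) \<longlonglongrightarrow> f c"
        using lim isCont_tendsto_compose by blast
      moreover have "\<forall>\<^sub>F n in sequentially. f (c + x / r n) = g (c + x / r n)"
      proof -
        have "\<forall>\<^sub>F n in sequentially. c + x / r n \<in> {0<..<T}"
          using lim c by (intro topological_tendstoD) auto
        then show ?thesis
          by eventually_elim (simp add: g_def)
      qed
      ultimately have "(\<lambda>n. g (c + x / r n)) \<longlonglongrightarrow> f c"
        by (rule Lim_transform_eventually)
      then show "(\<lambda>n. \<rho> x * g (c + x / r n)) \<longlonglongrightarrow> \<rho> x * f c"
        by (intro tendsto_intros)
    qed
    show "AE x in lborel. norm (\<rho> x * g (c + x / r n)) \<le> \<rho> x * B" for n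
      using \<rho>(2) gB by (intro AE_I2) (auto simp: abs_mult intro!: mult_left_mono)
  qed measurable
  also have "(\<integral>x. \<rho> x * f c \<partial>lborel) = f c"
    using \<rho>(4) by simp
  finally show ?thesis
    by (simp add: eq)
qed

text \<open>Each cutoff is the difference of two smooth steps of steepness \<open>r n\<close> at
  \<open>a\<close> and \<open>b\<close>, so its derivative is a mollifier at \<open>a\<close> minus
  a mollifier at \<open>b\<close>; hence the limit \<open>f a - f b\<close>.\<close>

lemma time_cutoffs:
  fixes a b T :: real
  assumes "0 < a" "a < b" "b < T"
  obtains \<phi> :: "nat \<Rightarrow> real \<Rightarrow> real"
  where "\<And>n. test_fun {0<..<T} (\<phi> n)" and "\<And>n x. 0 \<le> \<phi> n x" and "\<And>n x. \<phi> n x \<le> 1"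
    and "\<And>x. x \<noteq> a \<Longrightarrow> x \<noteq> b \<Longrightarrow> (\<lambda>n. \<phi> n x) \<longlonglongrightarrow> indicator {a<..<b} x"
    and "\<And>f. continuous_on {0..T} f \<Longrightarrow>
      (\<lambda>n. \<integral>t\<in>{0<..<T}. deriv (\<phi> n) t * f t \<partial>lborel) \<longlonglongrightarrow> f a - f b"
proof -
  obtain F :: "nat \<Rightarrow> real \<Rightarrow> real" where
    F: "\<And>n x. (F n has_real_derivative F (Suc n) x) (at x)"
      and F0: "\<And>x. x \<le> -1 \<Longrightarrow> F 0 x = 0" and F1: "\<And>x. 1 \<le> x \<Longrightarrow> F 0 x = 1"
      and \<rho>: "\<And>x. 0 \<le> F (Suc 0) x" "\<And>x. 1 < \<bar>x\<bar> \<Longrightarrow> F (Suc 0) x = 0"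
    by (rule smooth_step) blast
  \<comment> \<open>As \<open>r n\<close> is at least \<open>k\<close>, the margin
    \<open>1 / r n\<close> of the support is below both \<open>a\<close> and \<open>T - b\<close>,
    which keeps the support inside the open interval for every \<open>n\<close>.\<close>
  define k where "k = 1 + 1 / a + 1 / (T - b)"
  define r where "r n = real n + k" for n :: nat
  have k: "k > 1 / a" "k > 1 / (T - b)" "k > 0"
    using assms by (simp_all add: k_def add_pos_pos)
  have r_pos: "r n > 0" for n
    using k by (simp add: r_def)
  have r_top: "filterlim r at_top sequentially"
    unfolding r_def using filterlim_tendsto_add_at_top[OF tendsto_const filterlim_real_sequentially, of k] by (simp add: add.commute)
  have mono: "F 0 x \<le> F 0 y" if "x \<le> y" for x y
    by (rule DERIV_nonneg_imp_nondecreasing[OF that]) (use F \<rho> in blast)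
  have F_nonneg: "0 \<le> F 0 x" for x
    using F0[of x] F0[of "-1"] mono[of "-1" x] by (cases "x \<le> -1") auto
  have F_le: "F 0 x \<le> 1" for x
    using F1[of x] F1[of 1] mono[of x 1] by (cases "1 \<le> x") auto
  define \<phi> where "\<phi> n x = F 0 (r n * (x - a)) - F 0 (r n * (x - b))" for n x
  have D\<phi>: "(\<phi> n has_real_derivative r n * (F (Suc 0) (r n * (x - a)) - F (Suc 0) (r n * (x - b)))) (at x)" for n x
    unfolding \<phi>_def
    by (auto intro!: derivative_eq_intros DERIV_chain2[OF F] simp: algebra_simps)
  have cont: "continuous_on UNIV (F (Suc 0))"
    using F[of "Suc 0"] by (meson DERIV_continuous continuous_at_imp_continuous_on)
  have int\<rho>: "(\<integral>x. F (Suc 0) x \<partial>lborel) = 1"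
  proof -
    have "(\<integral>x. F (Suc 0) x \<partial>lborel) = (\<integral>x. F (Suc 0) x * indicator {-1..1} x \<partial>lborel)"
    proof (rule Bochner_Integration.integral_cong)
      fix x
      have "F (Suc 0) x = 0" if "x \<notin> {-1..1}"
        by (rule \<rho>(2)) (use that in auto)
      then show "F (Suc 0) x = F (Suc 0) x * indicator {-1..1} x"
        by (auto simp: indicator_def)
    qed simp
    also have "\<dots> = F 0 1 - F 0 (-1)"
      using F cont by (intro integral_FTC_Icc_real) (auto simp: continuous_on_eq_continuous_at)
    finally show ?thesis
      by (simp add: F0 F1)
  qed
  show ?thesis
  proof
    fix n
    have smooth: "smooth_fun (\<phi> n)"
    proof -
      define G where "G m x = r n ^ m * (F m (r n * (x - a)) - F m (r n * (x - b)))" for m x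
      have "(G m has_real_derivative G (Suc m) x) (at x)" for m x
        unfolding G_def
        by (auto intro!: derivative_eq_intros DERIV_chain2[OF F] simp: algebra_simps)
      then have "smooth_fun (G 0)"
        by (rule smooth_fun_real)
      also have "G 0 = \<phi> n"
        by (simp add: G_def \<phi>_def fun_eq_iff)
      finally show ?thesis .
    qed
    have supp: "x \<in> {a - 1 / r n..b + 1 / r n}" if "\<phi> n x \<noteq> 0" for x
    proof -
      have le: "r n * (x - b) \<le> r n * (x - a)"
        using assms r_pos[of n] by (intro mult_left_mono) auto
      have "\<not> r n * (x - a) \<le> - 1"
        using that F0[of "r n * (x - a)"] F0[of "r n * (x - b)"] le by (auto simp: \<phi>_def)
      moreover have "\<not> 1 \<le> r n * (x - b)"
        using that F1[of "r n * (x - a)"] F1[of "r n * (x - b)"] le by (auto simp: \<phi>_def)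
      ultimately show ?thesis
        using r_pos[of n] by (auto simp: field_simps)
    qed
    have "1 / k < a" "1 / k < T - b"
      using k assms by (simp_all add: field_simps)
    moreover have "1 / r n \<le> 1 / k"
      using k by (intro divide_left_mono) (simp_all add: r_def add_nonneg_pos)
    ultimately have sub: "{a - 1 / r n..b + 1 / r n} \<subseteq> {0<..<T}"
      by auto
    have cl: "closure {x. \<phi> n x \<noteq> 0} \<subseteq> {a - 1 / r n..b + 1 / r n}"
      using supp by (intro closure_minimal) auto
    have "compact (closure {x. \<phi> n x \<noteq> 0})"
      using bounded_subset[OF _ cl] by (simp add: compact_eq_bounded_closed)
    with cl sub smooth show "test_fun {0<..<T} (\<phi> n)"
      unfolding test_fun_def by auto
    show "0 \<le> \<phi> n x" for x
      using mono[of "r n * (x - b)" "r n * (x - a)"] assms r_pos[of n] by (simp add: \<phi>_def)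
    show "\<phi> n x \<le> 1" for x
      using F_nonneg[of "r n * (x - b)"] F_le[of "r n * (x - a)"] by (simp add: \<phi>_def)
  next
    fix x assume x: "x \<noteq> a" "x \<noteq> b"
    have step: "\<forall>\<^sub>F n in sequentially. F 0 (r n * (x - c)) = of_bool (c < x)" if "x \<noteq> c" for c
    proof -
      have "\<forall>\<^sub>F n in sequentially. 1 / \<bar>x - c\<bar> \<le> r n"
        using r_top by (simp add: filterlim_at_top)
      then show ?thesis
      proof eventually_elim
        case (elim n)
        then have "1 \<le> r n * \<bar>x - c\<bar>"
          using that by (simp add: field_simps)
        then show ?case
          using F0[of "r n * (x - c)"] F1[of "r n * (x - c)"] that by (auto simp: abs_if algebra_simps split: if_splits)
      qed
    qed
    have "\<forall>\<^sub>F n in sequentially. \<phi> n x = indicator {a<..<b} x"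
      using step[OF x(1)] step[OF x(2)]
      by eventually_elim (use assms x in \<open>auto simp: \<phi>_def indicator_def\<close>)
    then show "(\<lambda>n. \<phi> n x) \<longlonglongrightarrow> indicator {a<..<b} x"
      by (rule tendsto_eventually)
  next
    fix f :: "real \<Rightarrow> real" assume f: "continuous_on {0..T} f"
    have int: "set_integrable lborel {0<..<T} (\<lambda>t. r n * F (Suc 0) (r n * (t - c)) * f t)" for n c
    proof -
      have "continuous_on {0..T} (\<lambda>t. r n * F (Suc 0) (r n * (t - c)) * f t)"
        by (intro continuous_intros f continuous_on_compose2[OF cont]) auto
      then have "set_integrable lborel {0..T} (\<lambda>t. r n * F (Suc 0) (r n * (t - c)) * f t)"
        by (rule borel_integrable_atLeastAtMost')
      then show ?thesis
        by (rule set_integrable_subset) auto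
    qed
    have "(\<lambda>n. (\<integral>t\<in>{0<..<T}. r n * F (Suc 0) (r n * (t - a)) * f t \<partial>lborel)
        - (\<integral>t\<in>{0<..<T}. r n * F (Suc 0) (r n * (t - b)) * f t \<partial>lborel)) \<longlonglongrightarrow> f a - f b"
      using assms by (intro tendsto_diff approximate_identity cont \<rho> int\<rho> f r_pos r_top) auto
    also have "(\<lambda>n. (\<integral>t\<in>{0<..<T}. r n * F (Suc 0) (r n * (t - a)) * f t \<partial>lborel)
        - (\<integral>t\<in>{0<..<T}. r n * F (Suc 0) (r n * (t - b)) * f t \<partial>lborel))
      = (\<lambda>n. \<integral>t\<in>{0<..<T}. deriv (\<phi> n) t * f t \<partial>lborel)"
      by (subst set_integral_diff(2)[symmetric, OF int int])
         (simp add: DERIV_imp_deriv[OF D\<phi>] algebra_simps)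
    finally show "(\<lambda>n. \<integral>t\<in>{0<..<T}. deriv (\<phi> n) t * f t \<partial>lborel) \<longlonglongrightarrow> f a - f b" .
  qed
qed

text \<open>In the limit of the cutoffs the left side of \<open>weak\<close> becomes
  \<open>f a - f b\<close> and the right side minus the integral over \<open>{a<..<b}\<close>.
  Continuity of \<open>f\<close> gives the identity at every pair of interior points, not just at
  almost all.\<close>

lemma increment_of_weak_derivative:
  fixes f g :: "real \<Rightarrow> real"
  assumes f: "continuous_on {0..T} f" and g: "set_integrable lborel {0<..<T} g"
    and weak: "\<And>\<phi>. test_fun {0<..<T} \<phi> \<Longrightarrow>
      (\<integral>t\<in>{0<..<T}. deriv \<phi> t * f t \<partial>lborel) = - (\<integral>t\<in>{0<..<T}. \<phi> t * g t \<partial>lborel)"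
    and ab: "0 < a" "a < b" "b < T"
  shows "f b - f a = (\<integral>t\<in>{a<..<b}. g t \<partial>lborel)"
proof -
  obtain \<phi> :: "nat \<Rightarrow> real \<Rightarrow> real"
    where \<phi>: "\<And>n. test_fun {0<..<T} (\<phi> n)" and nonneg: "\<And>n x. 0 \<le> \<phi> n x" and le: "\<And>n x. \<phi> n x \<le> 1"
    and lim: "\<And>x. x \<noteq> a \<Longrightarrow> x \<noteq> b \<Longrightarrow> (\<lambda>n. \<phi> n x) \<longlonglongrightarrow> indicator {a<..<b} x"
    and D: "\<And>f. continuous_on {0..T} f \<Longrightarrow>
      (\<lambda>n. \<integral>t\<in>{0<..<T}. deriv (\<phi> n) t * f t \<partial>lborel) \<longlonglongrightarrow> f a - f b"
    using time_cutoffs[OF ab] by blast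
  have [measurable]: "\<phi> n \<in> borel_measurable borel" for n
    using \<phi>[of n] unfolding test_fun_def smooth_fun_def
    by (intro borel_measurable_continuous_onI) (metis Ck.simps(1))
  have g': "integrable lborel (\<lambda>t. indicator {0<..<T} t * g t)"
    using g by (simp add: set_integrable_def)
  have g_meas: "(\<lambda>t. indicator {0<..<T} t * g t) \<in> borel_measurable lborel"
    using g' by (rule borel_measurable_integrable)
  have "(\<lambda>n. \<integral>t. \<phi> n t * (indicator {0<..<T} t * g t) \<partial>lborel)
      \<longlonglongrightarrow> (\<integral>t. indicator {a<..<b} t * (indicator {0<..<T} t * g t) \<partial>lborel)"
  proof (rule integral_dominated_convergence[where w = "\<lambda>t. \<bar>indicator {0<..<T} t * g t\<bar>"])
    show "integrable lborel (\<lambda>t. \<bar>indicator {0<..<T} t * g t\<bar>)"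
      using g' by (rule integrable_abs)
    have "AE t in lborel. t \<noteq> a \<and> t \<noteq> b"
      using AE_lborel_singleton[of a] AE_lborel_singleton[of b] by eventually_elim auto
    then show "AE t in lborel. (\<lambda>n. \<phi> n t * (indicator {0<..<T} t * g t))
        \<longlonglongrightarrow> indicator {a<..<b} t * (indicator {0<..<T} t * g t)"
      by eventually_elim (intro tendsto_intros lim; simp)
    show "AE t in lborel. norm (\<phi> n t * (indicator {0<..<T} t * g t)) \<le> \<bar>indicator {0<..<T} t * g t\<bar>" for n
      using nonneg le by (intro AE_I2) (auto simp: abs_mult intro!: mult_left_le_one_le)
  qed (use g_meas in measurable)
  also have "(\<lambda>n. \<integral>t. \<phi> n t * (indicator {0<..<T} t * g t) \<partial>lborel) = (\<lambda>n. - (\<integral>t\<in>{0<..<T}. deriv (\<phi> n) t * f t \<partial>lborel))"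
    unfolding weak[OF \<phi>] by (simp add: set_lebesgue_integral_def mult_ac)
  also have "(\<integral>t. indicator {a<..<b} t * (indicator {0<..<T} t * g t) \<partial>lborel) = (\<integral>t\<in>{a<..<b}. g t \<partial>lborel)"
    unfolding set_lebesgue_integral_def using ab by (intro Bochner_Integration.integral_cong) (auto simp: indicator_def)
  finally have "(\<lambda>n. - (\<integral>t\<in>{0<..<T}. deriv (\<phi> n) t * f t \<partial>lborel)) \<longlonglongrightarrow> (\<integral>t\<in>{a<..<b}. g t \<partial>lborel)" .
  moreover have "(\<lambda>n. - (\<integral>t\<in>{0<..<T}. deriv (\<phi> n) t * f t \<partial>lborel)) \<longlonglongrightarrow> - (f a - f b)"
    by (intro tendsto_minus D f)
  ultimately show ?thesis
    using LIMSEQ_unique by fastforce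
qed

section \<open>p-th power integrals\<close>

text \<open>The p-th power of the L^p norm, without the root and with values in
  \<open>ennreal\<close>. The measure is a parameter because three of them occur: Lebesgue measure,
  its restriction to the domain, and the kernel measure on pairs of points.\<close>

definition Lp_mass :: "'b measure \<Rightarrow> real \<Rightarrow> ('b \<Rightarrow> real) \<Rightarrow> ennreal" where
  "Lp_mass M p f = (\<integral>\<^sup>+ x. ennreal (\<bar>f x\<bar> powr p) \<partial>M)"

text \<open>Convexity of the power at \<open>\<bar>a\<bar> / l\<close> and
  \<open>\<bar>b\<bar> / (1 - l)\<close> with weights \<open>l\<close> and \<open>1 - l\<close>. The
  free weight matters: as \<open>l\<close> tends to 1, the first factor tends to 1, and so the
  Sobolev constant survives the passage to the limit.\<close>

lemma powr_add_le:
  fixes a b p l :: real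
  assumes p: "1 \<le> p" and l: "0 < l" "l < 1"
  shows "\<bar>a + b\<bar> powr p \<le> l powr (1 - p) * \<bar>a\<bar> powr p + (1 - l) powr (1 - p) * \<bar>b\<bar> powr p"
proof -
  have one: "1 \<le> c powr (1 - p)" if "0 < c" "c < 1" for c :: real
    using powr_mono'[of "1 - p" 0 c] that p by simp
  have le: "r \<le> c powr (1 - p) * r" if "0 < c" "c < 1" "0 \<le> r" for c r :: real
    using mult_right_mono[OF one[OF that(1,2)] that(3)] by simp
  consider "a = 0" | "b = 0" | "a \<noteq> 0" "b \<noteq> 0"
    by blast
  then show ?thesis
  proof cases
    case 1
    then show ?thesis using le[of "1 - l" "\<bar>b\<bar> powr p"] l by simp
  next
    case 2
    then show ?thesis using le[of l "\<bar>a\<bar> powr p"] l by simp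
  next
    case 3
    have "\<bar>a + b\<bar> powr p \<le> (\<bar>a\<bar> + \<bar>b\<bar>) powr p"
      using p by (intro powr_mono2) auto
    also have "\<dots> = (l * (\<bar>a\<bar> / l) + (1 - l) * (\<bar>b\<bar> / (1 - l))) powr p"
      using l by simp
    also have "\<dots> \<le> l * (\<bar>a\<bar> / l) powr p + (1 - l) * (\<bar>b\<bar> / (1 - l)) powr p"
      using convex_onD[OF powr_convex[OF p], of "1 - l" "\<bar>a\<bar> / l" "\<bar>b\<bar> / (1 - l)"] l 3 by simp
    also have "\<dots> = l powr (1 - p) * \<bar>a\<bar> powr p + (1 - l) powr (1 - p) * \<bar>b\<bar> powr p"
      using l by (simp add: powr_divide powr_diff)
    finally show ?thesis .
  qed
qed

lemma Lp_mass_add_le: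
  assumes [measurable]: "f \<in> borel_measurable M" "g \<in> borel_measurable M" and "1 \<le> p" "0 < l" "l < 1"
  shows "Lp_mass M p (\<lambda>x. f x + g x)
    \<le> ennreal (l powr (1 - p)) * Lp_mass M p f + ennreal ((1 - l) powr (1 - p)) * Lp_mass M p g"
proof -
  have "Lp_mass M p (\<lambda>x. f x + g x)
      \<le> (\<integral>\<^sup>+ x. ennreal (l powr (1 - p)) * ennreal (\<bar>f x\<bar> powr p)
            + ennreal ((1 - l) powr (1 - p)) * ennreal (\<bar>g x\<bar> powr p) \<partial>M)"
    unfolding Lp_mass_def using powr_add_le[OF assms(3-5)]
    by (intro nn_integral_mono) (simp flip: ennreal_mult ennreal_plus)
  also have "\<dots> = ennreal (l powr (1 - p)) * Lp_mass M p f + ennreal ((1 - l) powr (1 - p)) * Lp_mass M p g"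
    unfolding Lp_mass_def by (simp add: nn_integral_add nn_integral_cmult)
  finally show ?thesis .
qed

lemma Lp_mass_add_finite:
  assumes "f \<in> borel_measurable M" "g \<in> borel_measurable M" "1 \<le> p"
    and "Lp_mass M p f < top" "Lp_mass M p g < top"
  shows "Lp_mass M p (\<lambda>x. f x + g x) < top"
  using Lp_mass_add_le[OF assms(1-3), of "1 / 2"] assms(4,5)
  by (auto simp: ennreal_mult_less_top intro: le_less_trans)

lemma Lp_mass_minus_commute: "Lp_mass M p (\<lambda>x. f x - g x) = Lp_mass M p (\<lambda>x. g x - f x)"
  by (simp add: Lp_mass_def abs_minus_commute)

lemma Lp_mass_minus: "Lp_mass M p (\<lambda>x. - f x) = Lp_mass M p f"
  by (simp add: Lp_mass_def)

lemma Lp_mass_diff_finite: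
  assumes "f \<in> borel_measurable M" "g \<in> borel_measurable M" "1 \<le> p"
    and "Lp_mass M p f < top" "Lp_mass M p g < top"
  shows "Lp_mass M p (\<lambda>x. f x - g x) < top"
  using Lp_mass_add_finite[of f M "\<lambda>x. - g x" p] assms by (simp add: Lp_mass_minus)

lemma Lp_mass_cmult:
  assumes [measurable]: "f \<in> borel_measurable M"
  shows "Lp_mass M p (\<lambda>x. c * f x) = ennreal (\<bar>c\<bar> powr p) * Lp_mass M p f"
  unfolding Lp_mass_def by (simp add: abs_mult powr_mult ennreal_mult nn_integral_cmult)

lemma Lp_mass_2: "Lp_mass M 2 f = (\<integral>\<^sup>+ x. ennreal ((f x)\<^sup>2) \<partial>M)"
  by (simp add: Lp_mass_def)

lemma Lp_mass_finite_iff: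
  assumes [measurable]: "f \<in> borel_measurable M"
  shows "Lp_mass M p f < top \<longleftrightarrow> integrable M (\<lambda>x. \<bar>f x\<bar> powr p)"
  unfolding Lp_mass_def by (simp add: integrable_iff_bounded)

lemma Lp_mass_eq_integral:
  assumes [measurable]: "f \<in> borel_measurable M" and "Lp_mass M p f < top"
  shows "Lp_mass M p f = ennreal (\<integral>x. \<bar>f x\<bar> powr p \<partial>M)"
  using assms(2) unfolding Lp_mass_def
  by (subst nn_integral_eq_integral) (auto simp: Lp_mass_finite_iff[OF assms(1), symmetric] Lp_mass_def)

lemma Lp_mass_AE_subseq:
  assumes [measurable]: "\<And>k. f k \<in> borel_measurable M" "g \<in> borel_measurable M"
    and fin: "\<And>k. Lp_mass M p (\<lambda>x. f k x - g x) < top"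
    and lim: "(\<lambda>k. Lp_mass M p (\<lambda>x. f k x - g x)) \<longlonglongrightarrow> 0" and "0 < p"
  obtains r :: "nat \<Rightarrow> nat" where "strict_mono r" "AE x in M. (\<lambda>k. f (r k) x) \<longlonglongrightarrow> g x"
proof -
  have int: "integrable M (\<lambda>x. \<bar>f k x - g x\<bar> powr p)" for k
    using fin[of k] by (simp add: Lp_mass_finite_iff)
  have "(\<lambda>k. ennreal (\<integral>x. \<bar>f k x - g x\<bar> powr p \<partial>M)) \<longlonglongrightarrow> ennreal 0"
    using lim fin by (simp add: Lp_mass_eq_integral)
  then have "(\<lambda>k. \<integral>x. norm (\<bar>f k x - g x\<bar> powr p) \<partial>M) \<longlonglongrightarrow> 0"
    by (subst (asm) tendsto_ennreal_iff) auto
  then obtain r where r: "strict_mono r" "AE x in M. (\<lambda>k. \<bar>f (r k) x - g x\<bar> powr p) \<longlonglongrightarrow> 0"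
    using tendsto_L1_AE_subseq[of M "\<lambda>k x. \<bar>f k x - g x\<bar> powr p"] int by blast
  from r(2) have "AE x in M. (\<lambda>k. f (r k) x) \<longlonglongrightarrow> g x"
  proof eventually_elim
    case (elim x)
    then have "(\<lambda>k. (\<bar>f (r k) x - g x\<bar> powr p) powr (1 / p)) \<longlonglongrightarrow> 0 powr (1 / p)"
      by (rule tendsto_powr') (use \<open>0 < p\<close> in auto)
    then have "(\<lambda>k. \<bar>f (r k) x - g x\<bar>) \<longlonglongrightarrow> 0"
      using \<open>0 < p\<close> by (simp add: powr_powr)
    then show ?case
      by (simp add: LIM_zero_iff tendsto_rabs_zero_iff)
  qed
  with r(1) show ?thesis
    by (rule that)
qed

text \<open>Hoelder's inequality on a finite measure space, obtained by integrating a pointwise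
  Young inequality at a suitable scale. If the measure or the mass is 0, no such scale exists, but
  then \<open>f\<close> vanishes almost everywhere.\<close>

lemma Lp_mass_2_le:
  assumes "finite_measure M" and [measurable]: "f \<in> borel_measurable M"
    and q: "2 \<le> q" and fin: "Lp_mass M q f < top"
  shows "Lp_mass M 2 f \<le> ennreal (measure M (space M) powr (1 - 2 / q) * enn2real (Lp_mass M q f) powr (2 / q))"
proof -
  interpret finite_measure M by fact
  define m where "m = measure M (space M)"
  define A where "A = enn2real (Lp_mass M q f)"
  have A: "Lp_mass M q f = ennreal A" "0 \<le> A"
    using fin by (simp_all add: A_def)
  show ?thesis
  proof (cases "A = 0 \<or> m = 0")
    case True
    have "AE x in M. f x = 0"
    proof (cases "m = 0")
      case True
      then have "emeasure M (space M) = 0"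
        by (simp add: emeasure_eq_measure m_def)
      then show ?thesis
        by (rule emeasure_0_AE)
    next
      case False
      then have "(\<integral>\<^sup>+ x. ennreal (\<bar>f x\<bar> powr q) \<partial>M) = 0"
        using True A by (simp add: Lp_mass_def)
      then show ?thesis
        by (subst (asm) nn_integral_0_iff_AE) auto
    qed
    then have "Lp_mass M 2 f = (\<integral>\<^sup>+ x. 0 \<partial>M)"
      unfolding Lp_mass_2 by (intro nn_integral_cong_AE) auto
    then show ?thesis
      by simp
  next
    case False
    then have pos: "A > 0" "m > 0"
      using A by (simp_all add: m_def zero_less_measure_iff less_le)
    \<comment> \<open>\<open>r\<close> is the mean of order \<open>q\<close> of \<open>f\<close>. At
      this scale the two terms of Young's inequality integrate to fractions 2/q and 1 - 2/q of
      \<open>m * r\<^sup>2\<close>, which is the Hoelder bound without loss.\<close>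
    define r where "r = (A / m) powr (1 / q)"
    have r: "r > 0" "r powr q = A / m"
      using pos q by (simp_all add: r_def powr_powr)
    have bern: "y\<^sup>2 \<le> (2 / q) * (\<bar>y\<bar> powr q) + (1 - 2 / q)" for y :: real
    proof (cases "y = 0")
      case True
      then show ?thesis using q by simp
    next
      case False
      then show ?thesis
        using Youngs_inequality_0[of "2 / q" "1 - 2 / q" "\<bar>y\<bar> powr q" 1] q by (simp add: powr_powr)
    qed
    have pt: "(f x)\<^sup>2 \<le> r\<^sup>2 * ((2 / q) * (m / A)) * (\<bar>f x\<bar> powr q) + r\<^sup>2 * (1 - 2 / q)" for x
    proof -
      have "(f x)\<^sup>2 = r\<^sup>2 * (f x / r)\<^sup>2"
        using r by (simp add: power_divide)
      also have "\<dots> \<le> r\<^sup>2 * ((2 / q) * (\<bar>f x / r\<bar> powr q) + (1 - 2 / q))"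
        by (intro mult_left_mono bern) simp
      also have "\<bar>f x / r\<bar> powr q = (m / A) * \<bar>f x\<bar> powr q"
        using r pos by (simp add: powr_divide)
      finally show ?thesis
        by (simp add: algebra_simps)
    qed
    have "Lp_mass M 2 f \<le> (\<integral>\<^sup>+ x. ennreal (r\<^sup>2 * ((2 / q) * (m / A))) * ennreal (\<bar>f x\<bar> powr q)
        + ennreal (r\<^sup>2 * (1 - 2 / q)) \<partial>M)"
      unfolding Lp_mass_2 using pt q pos
      by (intro nn_integral_mono) (simp flip: ennreal_mult ennreal_plus)
    also have "\<dots> = ennreal (r\<^sup>2 * ((2 / q) * (m / A))) * ennreal A + ennreal (r\<^sup>2 * (1 - 2 / q)) * ennreal m"
      unfolding A(1)[symmetric] Lp_mass_def
      by (simp add: nn_integral_add nn_integral_cmult emeasure_eq_measure m_def)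
    also have "\<dots> = ennreal (r\<^sup>2 * ((2 / q) * (m / A)) * A + r\<^sup>2 * (1 - 2 / q) * m)"
      using q pos by (simp flip: ennreal_mult ennreal_plus)
    also have "r\<^sup>2 * ((2 / q) * (m / A)) * A + r\<^sup>2 * (1 - 2 / q) * m = m * r\<^sup>2"
      using pos by (simp add: algebra_simps)
    also have "r\<^sup>2 = (A / m) powr (2 / q)"
      using pos by (simp add: r_def powr_powr flip: powr_numeral)
    also have "m * (A / m) powr (2 / q) = m powr (1 - 2 / q) * A powr (2 / q)"
      using pos by (simp add: powr_divide powr_diff)
    finally show ?thesis
      by (simp add: m_def A_def)
  qed
qed

section \<open>The nonlinearity of the p-Laplacian and Young's inequality\<close>

definition spow :: "real \<Rightarrow> real \<Rightarrow> real" where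
  "spow p r = \<bar>r\<bar> powr (p - 2) * r"

lemma spow_measurable[measurable]: "spow p \<in> borel_measurable borel"
  unfolding spow_def by measurable

lemma abs_spow: "\<bar>spow p r\<bar> = \<bar>r\<bar> powr (p - 1)"
  using powr_mult_base[of "\<bar>r\<bar>" "p - 2"] by (simp add: spow_def abs_mult mult.commute)

lemma spow_mult_self: "spow p r * r = \<bar>r\<bar> powr p"
proof -
  have "spow p r * r = \<bar>r\<bar> * (\<bar>r\<bar> * \<bar>r\<bar> powr (p - 2))"
    by (simp add: spow_def)
  then show ?thesis
    by (simp add: powr_mult_base)
qed

text \<open>For \<open>p < 2\<close> the factor \<open>\<bar>r\<bar> powr (p - 2)\<close> is
  singular at 0. The limit 0 is therefore treated through the absolute value, whose exponent
  \<open>p - 1\<close> is positive.\<close>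

lemma tendsto_spow:
  assumes "(f \<longlongrightarrow> a) F" and "1 < p"
  shows "((\<lambda>x. spow p (f x)) \<longlongrightarrow> spow p a) F"
proof -
  have eq: "spow p r = sgn r * \<bar>r\<bar> powr (p - 1)" for r
    using powr_mult_base[of "\<bar>r\<bar>" "p - 2"]
    by (cases "r = 0") (auto simp: spow_def sgn_if mult.commute)
  show ?thesis
  proof (cases "a = 0")
    case True
    have "((\<lambda>x. \<bar>f x\<bar> powr (p - 1)) \<longlongrightarrow> \<bar>a\<bar> powr (p - 1)) F"
      using assms by (intro tendsto_powr' tendsto_intros) auto
    then have "((\<lambda>x. \<bar>spow p (f x)\<bar>) \<longlongrightarrow> 0) F"
      using True by (simp add: abs_spow)
    then show ?thesis
      using True by (simp add: tendsto_rabs_zero_iff spow_def)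
  next
    case False
    then show ?thesis
      unfolding spow_def by (intro tendsto_intros assms) auto
  qed
qed

text \<open>Conjugate exponents p / (p - 1) and p, the first of which turns
  \<open>\<bar>spow p a\<bar>\<close> into the p-th power of \<open>\<bar>a\<bar>\<close>. The exact
  weights are kept because they must add up to 1 in the energy estimate.\<close>

lemma spow_Young:
  assumes "1 < p"
  shows "\<bar>spow p a * b\<bar> \<le> (1 - 1 / p) * \<bar>a\<bar> powr p + 1 / p * \<bar>b\<bar> powr p"
proof -
  have "\<bar>spow p a\<bar> * \<bar>b\<bar> \<le> \<bar>spow p a\<bar> powr (p / (p - 1)) / (p / (p - 1)) + \<bar>b\<bar> powr p / p"
    using assms by (intro Youngs_inequality) (auto simp: field_simps)
  moreover have "\<bar>spow p a\<bar> powr (p / (p - 1)) = \<bar>a\<bar> powr p"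
    using assms by (simp add: abs_spow powr_powr)
  moreover have "\<bar>a\<bar> powr p / (p / (p - 1)) = (1 - 1 / p) * \<bar>a\<bar> powr p"
    using assms by (simp add: field_simps)
  ultimately show ?thesis
    by (simp add: abs_mult)
qed

text \<open>Scaling \<open>a\<close> by \<open>l\<close> is compensated by scaling \<open>b\<close>
  by \<open>l powr (1 - p)\<close>. A small \<open>l\<close> makes the first term small at the
  expense of the second; the Young weights are at most 1 and are dropped.\<close>

lemma spow_Young_scaled:
  assumes "1 < p" "0 < l"
  shows "\<bar>spow p a * b\<bar> \<le> l powr p * \<bar>a\<bar> powr p + (l powr (1 - p)) powr p * \<bar>b\<bar> powr p"
proof -
  have "spow p a * b = spow p (l * a) * (l powr (1 - p) * b)"
    using assms by (simp add: spow_def abs_mult powr_mult powr_diff powr_numeral field_simps power2_eq_square)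
  also have "\<bar>\<dots>\<bar> \<le> (1 - 1 / p) * \<bar>l * a\<bar> powr p + 1 / p * \<bar>l powr (1 - p) * b\<bar> powr p"
    by (rule spow_Young) fact
  also have "\<dots> \<le> 1 * \<bar>l * a\<bar> powr p + 1 * \<bar>l powr (1 - p) * b\<bar> powr p"
    using assms by (intro add_mono mult_right_mono) auto
  finally show ?thesis
    using assms by (simp add: abs_mult powr_mult)
qed

lemma spow_integrable:
  assumes [measurable]: "f \<in> borel_measurable M" "g \<in> borel_measurable M"
    and "1 < p" "Lp_mass M p f < top" "Lp_mass M p g < top"
  shows "integrable M (\<lambda>x. spow p (f x) * g x)"
proof (rule Bochner_Integration.integrable_bound)
  show "integrable M (\<lambda>x. (1 - 1 / p) * \<bar>f x\<bar> powr p + 1 / p * \<bar>g x\<bar> powr p)"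
    using assms(4,5) by (simp add: Lp_mass_finite_iff)
  show "AE x in M. norm (spow p (f x) * g x) \<le> norm ((1 - 1 / p) * \<bar>f x\<bar> powr p + 1 / p * \<bar>g x\<bar> powr p)"
    using spow_Young[OF \<open>1 < p\<close>] by (intro AE_I2) (force intro: order_trans[OF _ abs_ge_self])
qed simp

section \<open>The space W0\<close>

lemma Ck_add: "Ck n f \<Longrightarrow> Ck n g \<Longrightarrow> Ck n (\<lambda>x. f x + g x)"
proof (induction n arbitrary: f g)
  case (Suc n)
  then have D: "f differentiable (at x)" "g differentiable (at x)" for x
    by (auto simp: differentiable_on_def)
  have "frechet_derivative (\<lambda>x. f x + g x) (at x) v
      = frechet_derivative f (at x) v + frechet_derivative g (at x) v" for x v
    using frechet_derivative_at[OF has_derivative_add[OF D(1)[unfolded frechet_derivative_works]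
        D(2)[unfolded frechet_derivative_works]]] by (metis (no_types))
  then show ?case
    using Suc by (auto intro!: differentiable_on_add)
qed (auto intro: continuous_on_add)

lemma Ck_cmult: "Ck n f \<Longrightarrow> Ck n (\<lambda>x. c * f x)"
proof (induction n arbitrary: f)
  case (Suc n)
  then have D: "f differentiable (at x)" for x
    by (auto simp: differentiable_on_def)
  have "frechet_derivative (\<lambda>x. c * f x) (at x) v = c * frechet_derivative f (at x) v" for x v
    using frechet_derivative_at[OF has_derivative_mult_right[OF D[unfolded frechet_derivative_works]]]
    by (metis (no_types))
  then show ?case
    using Suc by (auto intro!: differentiable_on_mult)
qed (auto intro: continuous_on_mult_left)

lemma test_fun_diff:
  assumes "test_fun U f" "test_fun U g"
  shows "test_fun U (\<lambda>x. f x - g x)"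
proof -
  have "Ck n (\<lambda>x. f x + (-1) * g x)" for n
    using assms by (intro Ck_add Ck_cmult) (auto simp: test_fun_def smooth_fun_def)
  then have "smooth_fun (\<lambda>x. f x - g x)"
    by (simp add: smooth_fun_def)
  moreover have cl: "closure {x. f x - g x \<noteq> 0} \<subseteq> closure {x. f x \<noteq> 0} \<union> closure {x. g x \<noteq> 0}"
    unfolding closure_Un[symmetric] by (intro closure_mono) auto
  moreover have "compact (closure {x. f x \<noteq> 0} \<union> closure {x. g x \<noteq> 0})"
    using assms by (auto simp: test_fun_def)
  then have "compact (closure {x. f x - g x \<noteq> 0})"
    using bounded_subset[OF _ cl] by (simp add: compact_eq_bounded_closed)
  ultimately show ?thesis
    using assms unfolding test_fun_def by auto
qed

lemma test_fun_mono: "test_fun U f \<Longrightarrow> U \<subseteq> V \<Longrightarrow> test_fun V f"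
  by (auto simp: test_fun_def)

lemma test_fun_continuous: "test_fun U f \<Longrightarrow> continuous_on UNIV f"
  unfolding test_fun_def smooth_fun_def by (metis Ck.simps(1))

lemma test_fun_measurable: "test_fun U f \<Longrightarrow> f \<in> borel_measurable borel"
  by (intro borel_measurable_continuous_onI test_fun_continuous)

lemma test_fun_zero: "test_fun U f \<Longrightarrow> x \<notin> U \<Longrightarrow> f x = 0"
  using closure_subset[of "{x. f x \<noteq> 0}"] by (auto simp: test_fun_def)

lemma test_fun_bounded:
  assumes "test_fun U f"
  obtains B where "0 \<le> B" "\<And>x. \<bar>f x\<bar> \<le> B"
proof -
  let ?K = "closure {x. f x \<noteq> 0}"
  have "compact (f ` ?K)"
    using assms test_fun_continuous[OF assms]
    by (intro compact_continuous_image) (auto simp: test_fun_def intro: continuous_on_subset)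
  then obtain B where B: "\<forall>x\<in>?K. \<bar>f x\<bar> \<le> B"
    using compact_imp_bounded[of "f ` ?K"] unfolding bounded_iff by auto
  have "\<bar>f x\<bar> \<le> max B 0" for x
    using B closure_subset[of "{x. f x \<noteq> 0}"] by (cases "f x = 0") (auto intro: max.coboundedI1)
  then show ?thesis
    by (intro that[of "max B 0"]) auto
qed

lemma test_fun_Lp_mass_finite:
  assumes f: "test_fun U f" and "0 < q"
  shows "Lp_mass lborel q f < top"
proof -
  obtain B where B: "0 \<le> B" "\<And>x. \<bar>f x\<bar> \<le> B"
    by (rule test_fun_bounded[OF f]) blast
  let ?K = "closure {x. f x \<noteq> 0}"
  have "ennreal (\<bar>f x\<bar> powr q) \<le> ennreal (B powr q) * indicator ?K x" for x
  proof (cases "f x = 0")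
    case False
    then have "x \<in> ?K"
      using closure_subset[of "{x. f x \<noteq> 0}"] by auto
    then show ?thesis
      using B(2)[of x] \<open>0 < q\<close> by (simp add: powr_mono2)
  qed (use \<open>0 < q\<close> in simp)
  then have "Lp_mass lborel q f \<le> (\<integral>\<^sup>+ x. ennreal (B powr q) * indicator ?K x \<partial>lborel)"
    unfolding Lp_mass_def by (intro nn_integral_mono)
  also have "\<dots> = ennreal (B powr q) * emeasure lborel ?K"
    by (simp add: nn_integral_cmult)
  also have "\<dots> < top"
    using f emeasure_bounded_finite[of ?K]
    by (auto simp: test_fun_def ennreal_mult_less_top compact_imp_bounded less_top)
  finally show ?thesis .
qed

section \<open>The Gagliardo seminorm as a p-th power integral\<close>

lemma lpn_eq: "lpn q v = Lp_mass lborel q v"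
  by (simp add: lpn_def Lp_mass_def)

text \<open>With the singular kernel absorbed into the measure, the Gagliardo energy is an L^p mass
  of increments, and the form of the p-Laplacian is an ordinary pairing of increments. On the
  diagonal the density is 1 / 0 = 0.\<close>

definition gag_measure :: "real \<Rightarrow> real \<Rightarrow> ('a::euclidean_space \<times> 'a) measure" where
  "gag_measure s p = density (lborel \<Otimes>\<^sub>M lborel)
     (\<lambda>z. ennreal (1 / norm (fst z - snd z) powr (real DIM('a) + p * s)))"

definition incr :: "('a \<Rightarrow> real) \<Rightarrow> 'a \<times> 'a \<Rightarrow> real" where
  "incr v z = v (fst z) - v (snd z)"

lemma sets_gag_measure[measurable_cong]: "sets (gag_measure s p) = sets (lborel \<Otimes>\<^sub>M lborel)"
  by (simp add: gag_measure_def)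

lemma incr_measurable[measurable]:
  assumes [measurable]: "v \<in> borel_measurable borel"
  shows "incr v \<in> borel_measurable (gag_measure s p)"
  unfolding incr_def by measurable

lemma incr_diff: "incr (\<lambda>x. f x - g x) = (\<lambda>z. incr f z - incr g z)"
  by (auto simp: incr_def)

lemma incr_cmult: "incr (\<lambda>x. c * f x) = (\<lambda>z. c * incr f z)"
  by (auto simp: incr_def algebra_simps)

lemma gag_eq:
  fixes v :: "'a::euclidean_space \<Rightarrow> real"
  assumes [measurable]: "v \<in> borel_measurable borel"
  shows "gag s p v = Lp_mass (gag_measure s p) p (incr v)"
proof -
  have "Lp_mass (gag_measure s p) p (incr v) = (\<integral>\<^sup>+ z. ennreal (\<bar>v (fst z) - v (snd z)\<bar> powr p
      / norm (fst z - snd z) powr (real DIM('a) + p * s)) \<partial>(lborel \<Otimes>\<^sub>M lborel))"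
    unfolding Lp_mass_def gag_measure_def incr_def
    by (subst nn_integral_density) (auto intro!: nn_integral_cong simp flip: ennreal_mult)
  also have "\<dots> = gag s p v"
    unfolding gag_def by (subst lborel.nn_integral_fst[symmetric]) auto
  finally show ?thesis ..
qed

text \<open>The measure has a density with respect to the product of Lebesgue measures, for which
  the strip over a null set in either variable is null.\<close>

lemma AE_gag_measure:
  assumes "AE x in lborel. P x"
  shows "AE z in gag_measure s p. P (fst z) \<and> P (snd z)"
proof -
  obtain N where N: "N \<in> null_sets lborel" "{x. \<not> P x} \<subseteq> N"
    using assms by (auto elim: AE_E2 simp: eventually_ae_filter)
  then have [measurable]: "N \<in> sets lborel"
    by auto
  have "AE z in lborel \<Otimes>\<^sub>M lborel. fst z \<notin> N \<and> snd z \<notin> N"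
  proof (rule lborel_pair.AE_pair_measure)
    show "{z \<in> space (lborel \<Otimes>\<^sub>M lborel). fst z \<notin> N \<and> snd z \<notin> N} \<in> sets (lborel \<Otimes>\<^sub>M lborel)"
      by measurable
    show "AE x in lborel. AE y in lborel. fst (x, y) \<notin> N \<and> snd (x, y) \<notin> N"
      using AE_not_in[OF N(1)] by (auto elim!: eventually_mono)
  qed
  then have "AE z in lborel \<Otimes>\<^sub>M lborel. P (fst z) \<and> P (snd z)"
    by eventually_elim (use N in auto)
  then show ?thesis
    unfolding gag_measure_def by (subst AE_density) (auto elim: eventually_mono)
qed

lemma W0_measurable: "v \<in> W0 s p \<Omega> \<Longrightarrow> v \<in> borel_measurable borel"
  by (simp add: W0_def)

text \<open>The limit in the definition of \<open>W0\<close> is split into its two parts and made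
  finite at every index. The seminorms of the approximants are then finite because those of
  \<open>v\<close> and of the differences are.\<close>

lemma W0_approx:
  assumes v: "v \<in> W0 s p \<Omega>" and "1 \<le> p"
  obtains \<phi> where "\<And>k. test_fun \<Omega> (\<phi> k)" "\<And>k. gag s p (\<phi> k) < top"
    "(\<lambda>k. lpn p (\<lambda>x. \<phi> k x - v x)) \<longlonglongrightarrow> 0" "(\<lambda>k. gag s p (\<lambda>x. \<phi> k x - v x)) \<longlonglongrightarrow> 0"
    "\<And>k. lpn p (\<lambda>x. \<phi> k x - v x) < top" "\<And>k. gag s p (\<lambda>x. \<phi> k x - v x) < top"
proof -
  obtain \<psi> where \<psi>: "\<And>k. test_fun \<Omega> (\<psi> k)"
    and lim: "(\<lambda>k. lpn p (\<lambda>x. \<psi> k x - v x) + gag s p (\<lambda>x. \<psi> k x - v x)) \<longlonglongrightarrow> 0"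
    using v by (auto simp: W0_def)
  have [measurable]: "v \<in> borel_measurable borel"
    using v by (rule W0_measurable)
  have [measurable]: "\<psi> k \<in> borel_measurable borel" for k
    using \<psi> by (rule test_fun_measurable)
  have "\<forall>\<^sub>F k in sequentially. lpn p (\<lambda>x. \<psi> k x - v x) + gag s p (\<lambda>x. \<psi> k x - v x) < top"
    using lim by (rule order_tendstoD) simp
  then obtain K where K: "\<And>k. k \<ge> K \<Longrightarrow> lpn p (\<lambda>x. \<psi> k x - v x) + gag s p (\<lambda>x. \<psi> k x - v x) < top"
    by (auto simp: eventually_sequentially)
  \<comment> \<open>The shift discards the initial indices, where the distance to \<open>v\<close>
    might be infinite; later uses convert these distances to real numbers.\<close>
  define \<phi> where "\<phi> k = \<psi> (k + K)" for k
  have lim': "(\<lambda>k. lpn p (\<lambda>x. \<phi> k x - v x) + gag s p (\<lambda>x. \<phi> k x - v x)) \<longlonglongrightarrow> 0"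
    unfolding \<phi>_def using LIMSEQ_ignore_initial_segment[OF lim, of K] .
  show ?thesis
  proof
    show "test_fun \<Omega> (\<phi> k)" for k
      by (simp add: \<phi>_def \<psi>)
    show "(\<lambda>k. lpn p (\<lambda>x. \<phi> k x - v x)) \<longlonglongrightarrow> 0" "(\<lambda>k. gag s p (\<lambda>x. \<phi> k x - v x)) \<longlonglongrightarrow> 0"
      by (rule tendsto_sandwich[OF _ _ tendsto_const lim']; simp)+
    show fin: "lpn p (\<lambda>x. \<phi> k x - v x) < top" "gag s p (\<lambda>x. \<phi> k x - v x) < top" for k
      using K[of "k + K"] by (auto simp: \<phi>_def)
    show "gag s p (\<phi> k) < top" for k
    proof -
      have "Lp_mass (gag_measure s p) p (\<lambda>z. incr (\<lambda>x. \<phi> k x - v x) z + incr v z) < top"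
        using fin(2)[of k] v \<open>1 \<le> p\<close> by (intro Lp_mass_add_finite) (auto simp: gag_eq \<phi>_def W0_def)
      then show ?thesis
        by (simp add: gag_eq incr_diff \<phi>_def)
    qed
  qed
qed

lemma test_fun_W0:
  assumes \<psi>: "test_fun \<Omega> \<psi>" and "gag s p \<psi> < top" "0 < p"
  shows "\<psi> \<in> W0 s p \<Omega>"
proof -
  have "(\<lambda>k::nat. lpn p (\<lambda>x. \<psi> x - \<psi> x) + gag s p (\<lambda>x. \<psi> x - \<psi> x)) \<longlonglongrightarrow> 0"
    by (simp add: lpn_def gag_def)
  moreover have "lpn p \<psi> < top"
    using test_fun_Lp_mass_finite[OF \<psi> \<open>0 < p\<close>] by (simp add: lpn_eq)
  ultimately show ?thesis
    using assms test_fun_measurable[OF \<psi>] unfolding W0_def by auto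
qed

text \<open>It places the errors of an approximation by test functions in \<open>W0\<close>, where
  the Sobolev inequality controls them. The approximants of the difference are
  \<open>\<psi> - \<phi> k\<close>.\<close>

lemma W0_diff_test:
  assumes v: "v \<in> W0 s p \<Omega>" and \<psi>: "test_fun \<Omega> \<psi>" and gag: "gag s p \<psi> < top" and p: "1 \<le> p"
  shows "(\<lambda>x. \<psi> x - v x) \<in> W0 s p \<Omega>"
proof -
  have [measurable]: "v \<in> borel_measurable borel" "\<psi> \<in> borel_measurable borel"
    using v \<psi> W0_measurable test_fun_measurable by auto
  obtain \<phi> where \<phi>: "\<And>k. test_fun \<Omega> (\<phi> k)"
    and lim: "(\<lambda>k. lpn p (\<lambda>x. \<phi> k x - v x) + gag s p (\<lambda>x. \<phi> k x - v x)) \<longlonglongrightarrow> 0"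
    using v by (auto simp: W0_def)
  have [measurable]: "\<phi> k \<in> borel_measurable borel" for k
    using \<phi> by (rule test_fun_measurable)
  have "lpn p (\<lambda>x. \<psi> x - v x) < top"
    using v p test_fun_Lp_mass_finite[OF \<psi>, of p]
    by (auto simp: lpn_eq W0_def intro!: Lp_mass_diff_finite)
  moreover have "gag s p (\<lambda>x. \<psi> x - v x) < top"
    using v p gag by (auto simp: gag_eq W0_def incr_diff intro!: Lp_mass_diff_finite)
  moreover have "lpn p (\<lambda>x. \<phi> k x - v x) = lpn p (\<lambda>x. \<psi> x - \<phi> k x - (\<psi> x - v x))"
    "gag s p (\<lambda>x. \<phi> k x - v x) = gag s p (\<lambda>x. \<psi> x - \<phi> k x - (\<psi> x - v x))" for k
    using Lp_mass_minus_commute[of lborel p "\<phi> k" v]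
      Lp_mass_minus_commute[of "gag_measure s p" p "incr (\<phi> k)" "incr v"]
    by (simp_all add: lpn_eq gag_eq incr_diff)
  ultimately show ?thesis
    using lim \<phi> \<psi> unfolding W0_def
    by (auto intro!: exI[of _ "\<lambda>k x. \<psi> x - \<phi> k x"] test_fun_diff)
qed

text \<open>The approximating test functions vanish outside \<open>\<Omega>\<close>, so the mass of
  \<open>v\<close> there is at most its distance to each of them.\<close>

lemma W0_zero_outside:
  fixes v :: "'a::euclidean_space \<Rightarrow> real"
  assumes v: "v \<in> W0 s p \<Omega>" and "open \<Omega>" "1 \<le> p"
  shows "AE x in lborel. x \<notin> \<Omega> \<longrightarrow> v x = 0"
proof -
  have [measurable]: "v \<in> borel_measurable borel" "\<Omega> \<in> sets borel"
    using v \<open>open \<Omega>\<close> by (auto intro: W0_measurable)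
  obtain \<phi> where \<phi>: "\<And>k. test_fun \<Omega> (\<phi> k)" and lim: "(\<lambda>k. lpn p (\<lambda>x. \<phi> k x - v x)) \<longlonglongrightarrow> 0"
    using W0_approx[OF v \<open>1 \<le> p\<close>] by metis
  have "(\<integral>\<^sup>+ x. ennreal (indicator (- \<Omega>) x * \<bar>v x\<bar> powr p) \<partial>lborel) \<le> lpn p (\<lambda>x. \<phi> k x - v x)" for k
    unfolding lpn_def using test_fun_zero[OF \<phi>[of k]]
    by (intro nn_integral_mono ennreal_leI) (auto simp: indicator_def)
  then have "(\<integral>\<^sup>+ x. ennreal (indicator (- \<Omega>) x * \<bar>v x\<bar> powr p) \<partial>lborel) \<le> 0"
    using LIMSEQ_le_const[OF lim] by blast
  then have "AE x in lborel. ennreal (indicator (- \<Omega>) x * \<bar>v x\<bar> powr p) = 0"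
    by (subst nn_integral_0_iff_AE[symmetric]) auto
  then show ?thesis
    by eventually_elim (auto simp: indicator_def ennreal_eq_0_iff split: if_splits)
qed

text \<open>Fatou's lemma along an almost everywhere convergent subsequence handles the left side,
  and the weighted convexity inequality the right side. The bound is put on \<open>lpn q v\<close>
  itself, since with \<open>enn2real\<close> it would say nothing about finiteness.\<close>

lemma W0_Sobolev:
  fixes v :: "'a::euclidean_space \<Rightarrow> real"
  assumes sob: "\<forall>v :: 'a \<Rightarrow> real. test_fun UNIV v \<longrightarrow>
      ennreal (S * enn2real (lpn q v) powr (p / q)) \<le> gag s p v"
    and "0 < S" "1 < p" "0 < q" and v: "v \<in> W0 s p \<Omega>"
  shows "lpn q v \<le> ennreal ((enn2real (gag s p v) / S) powr (q / p))"
proof -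
  have [measurable]: "v \<in> borel_measurable borel"
    using v by (rule W0_measurable)
  obtain \<phi> where \<phi>: "\<And>k. test_fun \<Omega> (\<phi> k)" "\<And>k. gag s p (\<phi> k) < top"
    and lim: "(\<lambda>k. lpn p (\<lambda>x. \<phi> k x - v x)) \<longlonglongrightarrow> 0" "(\<lambda>k. gag s p (\<lambda>x. \<phi> k x - v x)) \<longlonglongrightarrow> 0"
    and fin: "\<And>k. lpn p (\<lambda>x. \<phi> k x - v x) < top" "\<And>k. gag s p (\<lambda>x. \<phi> k x - v x) < top"
    by (rule W0_approx[OF v less_imp_le[OF \<open>1 < p\<close>]]) blast
  have [measurable]: "\<phi> k \<in> borel_measurable borel" for k
    using \<phi>(1) by (rule test_fun_measurable)
  obtain r where r: "strict_mono r" "AE x in lborel. (\<lambda>k. \<phi> (r k) x) \<longlonglongrightarrow> v x"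
    using Lp_mass_AE_subseq[of \<phi> lborel v p] lim(1) fin(1) \<open>1 < p\<close> unfolding lpn_eq by auto
  define g where "g = enn2real (gag s p v)"
  have g: "gag s p v = ennreal g" "0 \<le> g"
    using v by (simp_all add: g_def W0_def)
  define d where "d k = enn2real (gag s p (\<lambda>x. \<phi> k x - v x))" for k
  have d: "gag s p (\<lambda>x. \<phi> k x - v x) = ennreal (d k)" "0 \<le> d k" for k
    using fin(2)[of k] by (simp_all add: d_def)
  have d0: "d \<longlonglongrightarrow> 0"
    using lim(2) by (simp add: d tendsto_ennreal_iff[of d _ 0, simplified])
  have bound: "lpn q (\<phi> k) \<le> ennreal (((l powr (1 - p) * g + (1 - l) powr (1 - p) * d k) / S) powr (q / p))"
    if l: "0 < l" "l < 1" for l k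
  proof -
    define A where "A = enn2real (lpn q (\<phi> k))"
    have A: "lpn q (\<phi> k) = ennreal A" "0 \<le> A"
      using test_fun_Lp_mass_finite[OF \<phi>(1) \<open>0 < q\<close>, of k] by (simp_all add: A_def lpn_eq)
    have "ennreal (S * A powr (p / q)) \<le> gag s p (\<phi> k)"
      using sob \<phi>(1)[of k] by (auto simp: A_def intro: test_fun_mono)
    also have "gag s p (\<phi> k) = Lp_mass (gag_measure s p) p (\<lambda>z. incr v z + incr (\<lambda>x. \<phi> k x - v x) z)"
      by (simp add: gag_eq incr_diff)
    also have "\<dots> \<le> ennreal (l powr (1 - p)) * gag s p v + ennreal ((1 - l) powr (1 - p)) * gag s p (\<lambda>x. \<phi> k x - v x)"
      using l \<open>1 < p\<close> by (subst (1 2) gag_eq) (auto intro!: Lp_mass_add_le)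
    also have "\<dots> = ennreal (l powr (1 - p) * g + (1 - l) powr (1 - p) * d k)"
      using g d by (simp flip: ennreal_mult ennreal_plus)
    finally have "S * A powr (p / q) \<le> l powr (1 - p) * g + (1 - l) powr (1 - p) * d k"
      using g d by (subst (asm) ennreal_le_iff) auto
    then have "A powr (p / q) \<le> (l powr (1 - p) * g + (1 - l) powr (1 - p) * d k) / S"
      using \<open>0 < S\<close> by (simp add: field_simps)
    then have "(A powr (p / q)) powr (q / p) \<le> ((l powr (1 - p) * g + (1 - l) powr (1 - p) * d k) / S) powr (q / p)"
      using \<open>1 < p\<close> \<open>0 < q\<close> by (intro powr_mono2) auto
    also have "(A powr (p / q)) powr (q / p) = A"
      using \<open>1 < p\<close> \<open>0 < q\<close> A by (simp add: powr_powr)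
    finally show ?thesis
      by (simp add: A ennreal_leI)
  qed
  have lim_l: "lpn q v \<le> ennreal ((l powr (1 - p) * g / S) powr (q / p))" if l: "0 < l" "l < 1" for l
  proof -
    let ?B = "\<lambda>k. ((l powr (1 - p) * g + (1 - l) powr (1 - p) * d k) / S) powr (q / p)"
    have "lpn q v = (\<integral>\<^sup>+ x. liminf (\<lambda>k. ennreal (\<bar>\<phi> (r k) x\<bar> powr q)) \<partial>lborel)"
      unfolding lpn_def
    proof (rule nn_integral_cong_AE)
      show "AE x in lborel. ennreal (\<bar>v x\<bar> powr q) = liminf (\<lambda>k. ennreal (\<bar>\<phi> (r k) x\<bar> powr q))"
        using r(2)
      proof eventually_elim
        case (elim x)
        then have "(\<lambda>k. ennreal (\<bar>\<phi> (r k) x\<bar> powr q)) \<longlonglongrightarrow> ennreal (\<bar>v x\<bar> powr q)"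
          using \<open>0 < q\<close> by (intro tendsto_ennrealI tendsto_powr' tendsto_intros) auto
        then show ?case
          by (intro lim_imp_Liminf[symmetric]) auto
      qed
    qed
    also have "\<dots> \<le> liminf (\<lambda>k. lpn q (\<phi> (r k)))"
      unfolding lpn_def by (intro nn_integral_liminf) auto
    also have "\<dots> \<le> liminf (\<lambda>k. ennreal (?B (r k)))"
      using bound[OF l] by (intro Liminf_mono always_eventually allI)
    also have "\<dots> = ennreal ((l powr (1 - p) * g / S) powr (q / p))"
    proof -
      have "(\<lambda>k. ?B (r k)) \<longlonglongrightarrow> ((l powr (1 - p) * g + (1 - l) powr (1 - p) * 0) / S) powr (q / p)"
        using \<open>0 < S\<close> \<open>1 < p\<close> \<open>0 < q\<close> g d LIMSEQ_subseq_LIMSEQ[OF d0 r(1)]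
        by (intro tendsto_powr' tendsto_intros) (auto simp: comp_def)
      then show ?thesis
        by (intro lim_imp_Liminf tendsto_ennrealI) auto
    qed
    finally show ?thesis .
  qed
  \<comment> \<open>The error \<open>d k\<close> is already gone, so \<open>l\<close> may tend to 1;
    this restores the constant \<open>S\<close>.\<close>
  have "((\<lambda>l. ennreal ((l powr (1 - p) * g / S) powr (q / p))) \<longlongrightarrow> ennreal ((1 powr (1 - p) * g / S) powr (q / p))) (at_left 1)"
    using \<open>0 < S\<close> \<open>1 < p\<close> \<open>0 < q\<close> g by (intro tendsto_ennrealI tendsto_powr' tendsto_intros) auto
  moreover have "\<forall>\<^sub>F l in at_left (1::real). lpn q v \<le> ennreal ((l powr (1 - p) * g / S) powr (q / p))"
    by (rule eventually_mono[OF eventually_at_left_real[of 0 1]]) (use lim_l in auto)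
  ultimately have "lpn q v \<le> ennreal ((1 powr (1 - p) * g / S) powr (q / p))"
    by (intro tendsto_lowerbound) auto
  then show ?thesis
    by (simp add: g_def)
qed

section \<open>The weak formulation\<close>

lemma L2_Cauchy_Schwarz:
  assumes [measurable]: "f \<in> borel_measurable M" "g \<in> borel_measurable M"
    and fin: "Lp_mass M 2 f < top" "Lp_mass M 2 g < top"
  shows "integrable M (\<lambda>x. f x * g x)"
    and "(\<integral>x. f x * g x \<partial>M)\<^sup>2 \<le> (\<integral>x. (f x)\<^sup>2 \<partial>M) * (\<integral>x. (g x)\<^sup>2 \<partial>M)"
proof -
  have int: "integrable M (\<lambda>x. (f x)\<^sup>2)" "integrable M (\<lambda>x. (g x)\<^sup>2)"
    using fin by (simp_all add: Lp_mass_finite_iff)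
  show int_mult: "integrable M (\<lambda>x. f x * g x)"
  proof (rule Bochner_Integration.integrable_bound)
    show "integrable M (\<lambda>x. (f x)\<^sup>2 + (g x)\<^sup>2)"
      using int by simp
    have "\<bar>a * b\<bar> \<le> a\<^sup>2 + b\<^sup>2" for a b :: real
    proof -
      have "2 * (\<bar>a\<bar> * \<bar>b\<bar>) \<le> a\<^sup>2 + b\<^sup>2"
        using sum_squares_bound[of "\<bar>a\<bar>" "\<bar>b\<bar>"] by (simp add: mult.assoc)
      moreover have "0 \<le> \<bar>a\<bar> * \<bar>b\<bar>"
        by simp
      ultimately show ?thesis
        unfolding abs_mult by linarith
    qed
    then show "AE x in M. norm (f x * g x) \<le> norm ((f x)\<^sup>2 + (g x)\<^sup>2)"
      by (intro AE_I2) simp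
  qed simp
  have "ennreal (\<bar>\<integral>x. f x * g x \<partial>M\<bar>) \<le> (\<integral>\<^sup>+ x. ennreal \<bar>f x\<bar> * ennreal \<bar>g x\<bar> \<partial>M)"
    using integral_norm_bound_ennreal[OF int_mult] by (simp add: abs_mult ennreal_mult)
  then have "(ennreal (\<bar>\<integral>x. f x * g x \<partial>M\<bar>))\<^sup>2 \<le> (\<integral>\<^sup>+ x. ennreal \<bar>f x\<bar> * ennreal \<bar>g x\<bar> \<partial>M)\<^sup>2"
    by (intro power_mono) auto
  also have "\<dots> \<le> (\<integral>\<^sup>+ x. ennreal \<bar>f x\<bar> ^ 2 \<partial>M) * (\<integral>\<^sup>+ x. ennreal \<bar>g x\<bar> ^ 2 \<partial>M)"
    by (rule Cauchy_Schwarz_nn_integral) auto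
  also have "\<dots> = ennreal (\<integral>x. (f x)\<^sup>2 \<partial>M) * ennreal (\<integral>x. (g x)\<^sup>2 \<partial>M)"
    using int by (simp add: ennreal_power nn_integral_eq_integral)
  finally show "(\<integral>x. f x * g x \<partial>M)\<^sup>2 \<le> (\<integral>x. (f x)\<^sup>2 \<partial>M) * (\<integral>x. (g x)\<^sup>2 \<partial>M)"
    by (simp add: ennreal_power flip: ennreal_mult)
qed

lemma tendsto_zero_of_square_le:
  fixes f g :: "'b \<Rightarrow> real"
  assumes "\<forall>\<^sub>F x in F. (f x)\<^sup>2 \<le> g x * c" and "(g \<longlongrightarrow> 0) F"
  shows "(f \<longlongrightarrow> 0) F"
proof -
  have lim: "((\<lambda>x. g x * c) \<longlongrightarrow> 0) F"
    using tendsto_mult_right[OF assms(2), of c] by simp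
  have "((\<lambda>x. (f x)\<^sup>2) \<longlongrightarrow> 0) F"
    by (rule tendsto_sandwich[OF _ assms(1) tendsto_const lim]) auto
  then have "((\<lambda>x. sqrt ((f x)\<^sup>2)) \<longlongrightarrow> sqrt 0) F"
    by (rule tendsto_real_sqrt)
  then show ?thesis
    by (simp add: tendsto_rabs_zero_iff)
qed

text \<open>The density takes finite values everywhere, and this suffices however singular the
  kernel is near the diagonal. Measurability in time of the kernel integrals rests on it.\<close>

lemma sigma_finite_gag_measure: "sigma_finite_measure (gag_measure s p :: ('a::euclidean_space \<times> 'a) measure)"
proof -
  have sf: "sigma_finite_measure (lborel \<Otimes>\<^sub>M lborel :: ('a \<times> 'a) measure)"
    unfolding lborel_prod by (rule lborel.sigma_finite_measure_axioms)
  show ?thesis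
    unfolding gag_measure_def
    by (subst sigma_finite_measure.sigma_finite_iff_density_finite[OF sf]) auto
qed

lemma test_fun_cmult:
  assumes "test_fun U f"
  shows "test_fun U (\<lambda>x. c * f x)"
proof -
  have cl: "closure {x. c * f x \<noteq> 0} \<subseteq> closure {x. f x \<noteq> 0}"
    by (intro closure_mono) auto
  have "compact (closure {x. c * f x \<noteq> 0})"
    using bounded_subset[OF _ cl] assms by (simp add: compact_eq_bounded_closed test_fun_def)
  with cl show ?thesis
    using assms unfolding test_fun_def smooth_fun_def by (blast intro: Ck_cmult)
qed

lemma gag_cmult:
  assumes "v \<in> borel_measurable borel"
  shows "gag s p (\<lambda>x. c * v x) = ennreal (\<bar>c\<bar> powr p) * gag s p v"
  using assms by (simp add: gag_eq incr_cmult Lp_mass_cmult)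

lemma wnorm_cmult:
  assumes "v \<in> borel_measurable borel" "0 < p"
  shows "wnorm s p (\<lambda>x. c * v x) = \<bar>c\<bar> * wnorm s p v"
  using assms
  by (simp add: wnorm_def gag_cmult lpn_eq Lp_mass_cmult enn2real_mult powr_mult powr_powr distrib_left)

definition gag_form :: "real \<Rightarrow> real \<Rightarrow> ('a::euclidean_space \<Rightarrow> real) \<Rightarrow> ('a \<Rightarrow> real) \<Rightarrow> real" where
  "gag_form s p a b = (\<integral>z. spow p (incr a z) * incr b z \<partial>gag_measure s p)"

lemma gag_form_integrable:
  assumes "a \<in> borel_measurable borel" "b \<in> borel_measurable borel" "1 < p"
    "gag s p a < top" "gag s p b < top"
  shows "integrable (gag_measure s p) (\<lambda>z. spow p (incr a z) * incr b z)"
  using assms by (intro spow_integrable) (auto simp: gag_eq)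

lemma gag_form_cmult: "gag_form s p a (\<lambda>x. c * b x) = c * gag_form s p a b"
  by (simp add: gag_form_def incr_cmult mult.left_commute[of _ c])

lemma gag_form_diff:
  assumes "a \<in> borel_measurable borel" "b \<in> borel_measurable borel" "c \<in> borel_measurable borel" "1 < p"
    "gag s p a < top" "gag s p b < top" "gag s p c < top"
  shows "gag_form s p a (\<lambda>x. b x - c x) = gag_form s p a b - gag_form s p a c"
  using gag_form_integrable[of a b p s] gag_form_integrable[of a c p s] assms
  by (simp add: gag_form_def incr_diff right_diff_distrib)

lemma gag_form_bound:
  assumes [measurable]: "a \<in> borel_measurable borel" "b \<in> borel_measurable borel" and "1 < p" "0 < l"
  shows "ennreal \<bar>gag_form s p a b\<bar> \<le> ennreal (l powr p) * gag s p a + ennreal ((l powr (1 - p)) powr p) * gag s p b"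
proof (cases "integrable (gag_measure s p) (\<lambda>z. spow p (incr a z) * incr b z)")
  case True
  have "ennreal \<bar>gag_form s p a b\<bar> \<le> (\<integral>\<^sup>+ z. ennreal \<bar>spow p (incr a z) * incr b z\<bar> \<partial>gag_measure s p)"
    using integral_norm_bound_ennreal[OF True] by (simp add: gag_form_def)
  also have "\<dots> \<le> (\<integral>\<^sup>+ z. ennreal (l powr p) * ennreal (\<bar>incr a z\<bar> powr p)
      + ennreal ((l powr (1 - p)) powr p) * ennreal (\<bar>incr b z\<bar> powr p) \<partial>gag_measure s p)"
    using spow_Young_scaled[OF \<open>1 < p\<close> \<open>0 < l\<close>]
    by (intro nn_integral_mono) (simp flip: ennreal_mult ennreal_plus)
  also have "\<dots> = ennreal (l powr p) * gag s p a + ennreal ((l powr (1 - p)) powr p) * gag s p b"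
    by (simp add: nn_integral_add nn_integral_cmult gag_eq Lp_mass_def)
  finally show ?thesis .
next
  case False
  then have "gag_form s p a b = 0"
    unfolding gag_form_def by (rule not_integrable_integral_eq)
  then show ?thesis
    by simp
qed

text \<open>Outside \<open>D_set \<Omega>\<close> both points lie outside \<open>\<Omega>\<close>,
  so the increment of \<open>b\<close> is 0 and the integral extends to all pairs. Vanishing is
  asked at every point: test functions satisfy this, while \<open>W0\<close> gives it only almost
  everywhere.\<close>

lemma gag_form_eq_D_set:
  fixes a b :: "'a::euclidean_space \<Rightarrow> real"
  assumes [measurable]: "a \<in> borel_measurable borel" "b \<in> borel_measurable borel"
    and zero: "\<And>x. x \<notin> \<Omega> \<Longrightarrow> b x = 0"
  shows "(\<integral>z\<in>D_set \<Omega>. frac_kernel s p a b z \<partial>(lborel \<Otimes>\<^sub>M lborel)) = gag_form s p a b"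
proof -
  have "indicator (D_set \<Omega>) z *\<^sub>R frac_kernel s p a b z
      = (1 / norm (fst z - snd z) powr (real DIM('a) + p * s)) *\<^sub>R (spow p (incr a z) * incr b z)" for z
    using zero[of "fst z"] zero[of "snd z"]
    by (cases z) (auto simp: indicator_def D_set_def frac_kernel_def Let_def spow_def incr_def)
  then show ?thesis
    unfolding set_lebesgue_integral_def gag_form_def gag_measure_def
    by (subst integral_density) (auto simp: incr_def)
qed

text \<open>\<open>q\<close> stands for the critical Sobolev exponent. Given that its denominator is
  positive, the lower bound on \<open>p\<close> in the theorem amounts to \<open>2 \<le> q\<close>,
  the form in which Hoelder's inequality uses it.\<close>

locale frac_flow =
  fixes \<Omega> :: "'a::euclidean_space set" and s p S q :: real
    and u0 :: "'a \<Rightarrow> real" and u :: "'a \<Rightarrow> real \<Rightarrow> real"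
  assumes open_\<Omega>: "open \<Omega>" and bounded_\<Omega>: "bounded \<Omega>" and p: "1 < p" and q: "2 \<le> q" and S: "0 < S"
    and sobolev: "\<forall>v :: 'a \<Rightarrow> real. test_fun UNIV v \<longrightarrow>
      ennreal (S * enn2real (lpn q v) powr (p / q)) \<le> gag s p v"
    and sol: "\<And>T. T > 0 \<Longrightarrow> energy_solution s p \<Omega> u0 T u"
begin

abbreviation M where "M \<equiv> restrict_space lborel \<Omega>"

abbreviation U where "U t \<equiv> (\<lambda>x. u x t)"

definition y where "y t = (\<integral>x. (u x t)\<^sup>2 \<partial>M)"

lemma \<Omega>_sets[measurable]: "\<Omega> \<in> sets borel"
  using open_\<Omega> by simp

lemma measurable_M: "f \<in> borel_measurable borel \<Longrightarrow> f \<in> borel_measurable M"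
  by (simp add: measurable_restrict_space1)

lemma finite_measure_M: "finite_measure M"
  using emeasure_bounded_finite[OF bounded_\<Omega>]
  by (intro finite_measureI) (simp add: emeasure_restrict_space space_restrict_space less_top)

lemma measure_M: "measure M (space M) = measure lborel \<Omega>"
  by (simp add: measure_restrict_space space_restrict_space)

lemma Lp_mass_M: "Lp_mass M 2 f = (\<integral>\<^sup>+ x\<in>\<Omega>. ennreal ((f x)\<^sup>2) \<partial>lborel)"
  by (simp add: Lp_mass_2 nn_integral_restrict_space)

lemma integral_M: "(\<integral>x. f x \<partial>M) = (\<integral>x\<in>\<Omega>. f x \<partial>lborel)"
  for f :: "'a \<Rightarrow> real"
  by (simp add: integral_restrict_space set_lebesgue_integral_def)

lemma Lp_mass_M_le: "f \<in> borel_measurable borel \<Longrightarrow> Lp_mass M r f \<le> Lp_mass lborel r f"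
  unfolding Lp_mass_def
  by (subst nn_integral_restrict_space) (auto intro!: nn_integral_mono simp: indicator_def)

lemma u_measurable: "(\<lambda>z. u (fst z) (snd z)) \<in> borel_measurable (lborel \<Otimes>\<^sub>M lborel)"
  using sol[of 1] by (simp add: energy_solution_def LpW_def split_beta')

lemma U_measurable[measurable]: "U t \<in> borel_measurable borel"
  using measurable_compose[OF _ u_measurable, of "\<lambda>x. (x, t)" borel] by simp

lemma U_M[measurable]: "U t \<in> borel_measurable M"
  by (intro measurable_M) measurable

lemma U_L2: "0 \<le> t \<Longrightarrow> Lp_mass M 2 (U t) < top"
  using sol[of "t + 1"] by (auto simp: energy_solution_def Lp_mass_M)

lemma U_continuous:
  assumes "0 < T" "t0 \<in> {0..T}"
  shows "((\<lambda>t. Lp_mass M 2 (\<lambda>x. u x t - u x t0)) \<longlongrightarrow> 0) (at t0 within {0..T})"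
  using sol[OF \<open>0 < T\<close>] assms by (auto simp: energy_solution_def Lp_mass_M)

text \<open>The exceptional null set may depend on the final time, so countably many final times are
  used.\<close>

lemma U_W0: "AE t in lborel. 0 < t \<longrightarrow> U t \<in> W0 s p \<Omega>"
proof -
  have "AE t in lborel. \<forall>n. t \<in> {0<..<real (Suc n)} \<longrightarrow> U t \<in> W0 s p \<Omega>"
    unfolding AE_all_countable
  proof
    fix n
    have "energy_solution s p \<Omega> u0 (real (Suc n)) u"
      by (rule sol) simp
    then show "AE t in lborel. t \<in> {0<..<real (Suc n)} \<longrightarrow> U t \<in> W0 s p \<Omega>"
      by (simp add: energy_solution_def LpW_def)
  qed
  then show ?thesis
  proof eventually_elim
    case (elim t)
    obtain n where "t < real n"
      using reals_Archimedean2 by blast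
    then show ?case
      using elim[rule_format, of n] by auto
  qed
qed

lemma W0_gag: "v \<in> W0 s p \<Omega> \<Longrightarrow> gag s p v < top"
  by (simp add: W0_def)

lemma gag_U_integrable:
  assumes "0 < T"
  shows "(\<integral>\<^sup>+ t\<in>{0<..<T}. gag s p (U t) \<partial>lborel) < top"
proof -
  have "AE t in lborel. t \<in> {0<..<T} \<longrightarrow> gag s p (U t) \<le> ennreal (wnorm s p (U t) powr p)"
    using U_W0
  proof eventually_elim
    case (elim t)
    show ?case
    proof
      assume "t \<in> {0<..<T}"
      then have fin: "gag s p (U t) < top"
        using elim W0_gag by simp
      have "enn2real (gag s p (U t)) = (enn2real (gag s p (U t)) powr (1 / p)) powr p"
        using p by (simp add: powr_powr)
      also have "\<dots> \<le> wnorm s p (U t) powr p"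
        using p by (intro powr_mono2) (auto simp: wnorm_def)
      finally show "gag s p (U t) \<le> ennreal (wnorm s p (U t) powr p)"
        using fin by (metis ennreal_enn2real ennreal_leI)
    qed
  qed
  then have "(\<integral>\<^sup>+ t\<in>{0<..<T}. gag s p (U t) \<partial>lborel) \<le> (\<integral>\<^sup>+ t\<in>{0<..<T}. ennreal (wnorm s p (U t) powr p) \<partial>lborel)"
    by (intro nn_integral_mono_AE) (auto elim!: eventually_mono simp: indicator_def)
  also have "\<dots> < top"
    using sol[OF assms] by (simp add: energy_solution_def LpW_def)
  finally show ?thesis .
qed

section \<open>The equation tested with products of time and space functions\<close>

lemma LpW_tensor:
  assumes \<psi>: "test_fun \<Omega> \<psi>" and gag: "gag s p \<psi> < top" and \<phi>: "test_fun {0<..<T} \<phi>"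
  shows "LpW s p \<Omega> T (\<lambda>x t. \<phi> t * \<psi> x)"
  unfolding LpW_def
proof (intro conjI)
  have [measurable]: "\<phi> \<in> borel_measurable borel" "\<psi> \<in> borel_measurable borel"
    using \<phi> \<psi> by (auto intro: test_fun_measurable)
  show "(\<lambda>(x, t). \<phi> t * \<psi> x) \<in> borel_measurable (lborel \<Otimes>\<^sub>M lborel)"
    by measurable
  have "(\<lambda>x. \<phi> t * \<psi> x) \<in> W0 s p \<Omega>" for t
    using gag p by (intro test_fun_W0 test_fun_cmult \<psi>) (auto simp: gag_cmult ennreal_mult_less_top)
  then show "AE t in lborel. t \<in> {0<..<T} \<longrightarrow> (\<lambda>x. \<phi> t * \<psi> x) \<in> W0 s p \<Omega>"
    by simp
  obtain B where B: "0 \<le> B" "\<And>t. \<bar>\<phi> t\<bar> \<le> B"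
    by (rule test_fun_bounded[OF \<phi>]) blast
  have "wnorm s p (\<lambda>x. \<phi> t * \<psi> x) powr p \<le> (B * wnorm s p \<psi>) powr p" for t
    using p B by (subst wnorm_cmult) (auto intro!: powr_mono2 mult_mono simp: wnorm_def)
  then have "(\<integral>\<^sup>+ t\<in>{0<..<T}. ennreal (wnorm s p (\<lambda>x. \<phi> t * \<psi> x) powr p) \<partial>lborel)
      \<le> (\<integral>\<^sup>+ t. ennreal ((B * wnorm s p \<psi>) powr p) * indicator {0<..<T} t \<partial>lborel)"
    by (intro nn_integral_mono) (auto simp: indicator_def intro: ennreal_leI)
  also have "\<dots> < top"
    by (cases "0 \<le> T") (auto simp: nn_integral_cmult ennreal_mult_less_top)
  finally show "(\<integral>\<^sup>+ t\<in>{0<..<T}. ennreal (wnorm s p (\<lambda>x. \<phi> t * \<psi> x) powr p) \<partial>lborel) < \<infinity>"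
    by simp
qed

text \<open>Here the functionals \<open>w t\<close> disappear. Linearity pulls the factor
  \<open>\<phi> t\<close> out, the weak formulation expresses the result by the form, and the
  distributional identity expresses it by the derivative of the cutoff.\<close>

lemma weak_tensor:
  assumes "0 < T" and \<psi>: "test_fun \<Omega> \<psi>" and gag: "gag s p \<psi> < top" and \<phi>: "test_fun {0<..<T} \<phi>"
  shows "(\<integral>t\<in>{0<..<T}. deriv \<phi> t * (\<integral>x. u x t * \<psi> x \<partial>M) \<partial>lborel)
    = - (\<integral>t\<in>{0<..<T}. \<phi> t * (- (1 / 2) * gag_form s p (U t) \<psi>) \<partial>lborel)"
proof -
  have \<psi>W: "\<psi> \<in> W0 s p \<Omega>"
    using p by (intro test_fun_W0 \<psi> gag) auto
  have [measurable]: "\<psi> \<in> borel_measurable borel"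
    using \<psi> by (rule test_fun_measurable)
  obtain w :: "real \<Rightarrow> ('a \<Rightarrow> real) \<Rightarrow> real" where
    lin: "\<And>t v1 v2 a b. t \<in> {0<..<T} \<Longrightarrow> v1 \<in> W0 s p \<Omega> \<Longrightarrow> v2 \<in> W0 s p \<Omega> \<Longrightarrow>
       w t (\<lambda>x. a * v1 x + b * v2 x) = a * w t v1 + b * w t v2"
    and dist: "\<And>v \<phi>. test_fun \<Omega> v \<Longrightarrow> test_fun {0<..<T} \<phi> \<Longrightarrow>
       (\<integral>t\<in>{0<..<T}. deriv \<phi> t * (\<integral>x\<in>\<Omega>. u x t * v x \<partial>lborel) \<partial>lborel)
             = - (\<integral>t\<in>{0<..<T}. \<phi> t * w t v \<partial>lborel)"
    and weak: "\<And>v. LpW s p \<Omega> T v \<Longrightarrow> (\<integral>t\<in>{0<..<T}. w t (\<lambda>x. v x t) \<partial>lborel)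
           + 1 / 2 * (\<integral>t\<in>{0<..<T}.
                (\<integral>z\<in>D_set \<Omega>. frac_kernel s p (\<lambda>x. u x t) (\<lambda>x. v x t) z \<partial>(lborel \<Otimes>\<^sub>M lborel))
              \<partial>lborel) = 0"
    using sol[OF \<open>0 < T\<close>] unfolding energy_solution_def by blast
  have "w t (\<lambda>x. \<phi> t * \<psi> x) = \<phi> t * w t \<psi>" if "t \<in> {0<..<T}" for t
    using lin[OF that \<psi>W \<psi>W, of "\<phi> t" 0] by simp
  then have "(\<integral>t\<in>{0<..<T}. \<phi> t * w t \<psi> \<partial>lborel) = (\<integral>t\<in>{0<..<T}. w t (\<lambda>x. \<phi> t * \<psi> x) \<partial>lborel)"
    by (intro set_lebesgue_integral_cong) auto
  also have "\<dots> = - (1 / 2) * (\<integral>t\<in>{0<..<T}. (\<integral>z\<in>D_set \<Omega>. frac_kernel s p (U t) (\<lambda>x. \<phi> t * \<psi> x) z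
      \<partial>(lborel \<Otimes>\<^sub>M lborel)) \<partial>lborel)"
    using weak[OF LpW_tensor[OF \<psi> gag \<phi>]] by simp
  also have "\<dots> = (\<integral>t\<in>{0<..<T}. \<phi> t * (- (1 / 2) * gag_form s p (U t) \<psi>) \<partial>lborel)"
    using test_fun_zero[OF \<psi>]
    by (subst gag_form_eq_D_set) (auto simp: gag_form_cmult set_lebesgue_integral_def simp flip: integral_mult_right_zero
        intro!: Bochner_Integration.integral_cong)
  finally show ?thesis
    using dist[OF \<psi> \<phi>] by (simp add: integral_M)
qed

lemma incr_U_measurable[measurable]:
  "(\<lambda>x. incr (U (f x)) (g x)) \<in> borel_measurable N"
  if [measurable]: "f \<in> measurable N borel" "g \<in> measurable N (gag_measure s p)"
proof -
  have [measurable]: "g \<in> measurable N (lborel \<Otimes>\<^sub>M lborel)"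
    using that(2) by (simp cong: measurable_cong_sets add: sets_gag_measure)
  have "(\<lambda>x. u (fst (g x)) (f x)) \<in> borel_measurable N" "(\<lambda>x. u (snd (g x)) (f x)) \<in> borel_measurable N"
    using measurable_compose[OF _ u_measurable, of "\<lambda>x. (fst (g x), f x)" N]
      measurable_compose[OF _ u_measurable, of "\<lambda>x. (snd (g x), f x)" N] by simp_all
  then show ?thesis
    unfolding incr_def by (rule borel_measurable_diff)
qed

lemma gag_U_measurable[measurable]: "(\<lambda>t. gag s p (U t)) \<in> borel_measurable borel"
proof -
  interpret sigma_finite_measure "gag_measure s p :: ('a \<times> 'a) measure"
    by (rule sigma_finite_gag_measure)
  show ?thesis
    unfolding gag_eq[OF U_measurable] Lp_mass_def by measurable
qed

lemma gag_form_measurable: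
  assumes [measurable]: "b \<in> borel_measurable borel"
  shows "(\<lambda>t. gag_form s p (U t) b) \<in> borel_measurable borel"
proof -
  interpret sigma_finite_measure "gag_measure s p :: ('a \<times> 'a) measure"
    by (rule sigma_finite_gag_measure)
  show ?thesis
    unfolding gag_form_def by measurable
qed

lemma gag_U_finite: "AE t in lborel. 0 < t \<longrightarrow> gag s p (U t) < top"
  using U_W0 by eventually_elim (auto intro: W0_gag)

lemma gag_form_set_integrable:
  assumes b[measurable]: "b \<in> borel_measurable borel" and gag: "gag s p b < top" and T: "0 < T"
  shows "set_integrable lborel {0<..<T} (\<lambda>t. gag_form s p (U t) b)"
  unfolding set_integrable_def
proof (rule integrableI_bounded)
  note [measurable] = gag_form_measurable[OF b]
  show "(\<lambda>t. indicat_real {0<..<T} t *\<^sub>R gag_form s p (U t) b) \<in> borel_measurable lborel"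
    by simp
  have bound: "ennreal \<bar>gag_form s p (U t) b\<bar> \<le> gag s p (U t) + gag s p b" for t
    using gag_form_bound[of "U t" b p 1 s] p by simp
  have "(\<integral>\<^sup>+ t. ennreal (norm (indicat_real {0<..<T} t *\<^sub>R gag_form s p (U t) b)) \<partial>lborel)
      \<le> (\<integral>\<^sup>+ t. gag s p (U t) * indicator {0<..<T} t + gag s p b * indicator {0<..<T} t \<partial>lborel)"
    using bound by (intro nn_integral_mono) (auto simp: indicator_def)
  also have "\<dots> = (\<integral>\<^sup>+ t\<in>{0<..<T}. gag s p (U t) \<partial>lborel) + gag s p b * ennreal T"
    using T by (simp add: nn_integral_add nn_integral_cmult)
  also have "\<dots> < \<infinity>"
    using gag_U_integrable[OF T] gag by (simp add: ennreal_mult_less_top)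
  finally show "(\<integral>\<^sup>+ t. ennreal (norm (indicat_real {0<..<T} t *\<^sub>R gag_form s p (U t) b)) \<partial>lborel) < \<infinity>" .
qed

section \<open>Continuity in time of norms and pairings\<close>

lemma L2_dist_tendsto:
  assumes "0 < T" "t0 \<in> {0..T}"
  shows "((\<lambda>t. \<integral>x. (u x t - u x t0)\<^sup>2 \<partial>M) \<longlongrightarrow> 0) (at t0 within {0..T})"
proof -
  have eq: "Lp_mass M 2 (\<lambda>x. u x t - u x t0) = ennreal (\<integral>x. (u x t - u x t0)\<^sup>2 \<partial>M)" if "t \<in> {0..T}" for t
    using that assms U_L2[of t] U_L2[of t0]
    by (subst Lp_mass_eq_integral) (auto intro!: Lp_mass_diff_finite)
  have "((\<lambda>t. ennreal (\<integral>x. (u x t - u x t0)\<^sup>2 \<partial>M)) \<longlongrightarrow> ennreal 0) (at t0 within {0..T})"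
    using U_continuous[OF assms]
    unfolding ennreal_0 by (rule Lim_transform_eventually) (auto simp: eventually_at_filter eq)
  then show ?thesis
    by (subst (asm) tendsto_ennreal_iff) auto
qed

lemma U_diff_L2: "0 \<le> t \<Longrightarrow> 0 \<le> t0 \<Longrightarrow> Lp_mass M 2 (\<lambda>x. u x t - u x t0) < top"
  using U_L2[of t] U_L2[of t0] by (intro Lp_mass_diff_finite) auto

lemma inner_U_continuous:
  assumes "0 < T" and [measurable]: "g \<in> borel_measurable borel" and g: "Lp_mass M 2 g < top"
  shows "continuous_on {0..T} (\<lambda>t. \<integral>x. u x t * g x \<partial>M)"
  unfolding continuous_on_def
proof
  fix t0 assume t0: "t0 \<in> {0..T}"
  have [measurable]: "g \<in> borel_measurable M"
    by (rule measurable_M) fact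
  have "((\<lambda>t. \<integral>x. (u x t - u x t0) * g x \<partial>M) \<longlongrightarrow> 0) (at t0 within {0..T})"
  proof (rule tendsto_zero_of_square_le)
    show "\<forall>\<^sub>F t in at t0 within {0..T}. (\<integral>x. (u x t - u x t0) * g x \<partial>M)\<^sup>2
        \<le> (\<integral>x. (u x t - u x t0)\<^sup>2 \<partial>M) * (\<integral>x. (g x)\<^sup>2 \<partial>M)"
      unfolding eventually_at_filter using t0 g
      by (intro always_eventually) (auto intro!: L2_Cauchy_Schwarz U_diff_L2)
    show "((\<lambda>t. \<integral>x. (u x t - u x t0)\<^sup>2 \<partial>M) \<longlongrightarrow> 0) (at t0 within {0..T})"
      by (rule L2_dist_tendsto) fact+
  qed
  then have "((\<lambda>t. (\<integral>x. u x t * g x \<partial>M) - (\<integral>x. u x t0 * g x \<partial>M)) \<longlongrightarrow> 0) (at t0 within {0..T})"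
  proof (rule Lim_transform_eventually)
    show "\<forall>\<^sub>F t in at t0 within {0..T}. (\<integral>x. (u x t - u x t0) * g x \<partial>M)
        = (\<integral>x. u x t * g x \<partial>M) - (\<integral>x. u x t0 * g x \<partial>M)"
      unfolding eventually_at_filter using t0 g
      by (intro always_eventually) (auto simp: left_diff_distrib U_L2 L2_Cauchy_Schwarz intro!: Bochner_Integration.integral_diff)
  qed
  then show "((\<lambda>t. \<integral>x. u x t * g x \<partial>M) \<longlongrightarrow> (\<integral>x. u x t0 * g x \<partial>M)) (at t0 within {0..T})"
    by (simp add: LIM_zero_iff)
qed

text \<open>Expansion around the state at time \<open>t\<close>. The square enters with a minus
  sign, so dropping it bounds the increment from above; with the two times exchanged, the identity
  gives continuity of \<open>y\<close>.\<close>

lemma y_diff: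
  assumes "0 \<le> t" "0 \<le> t0"
  shows "y t - y t0 = 2 * (\<integral>x. (u x t - u x t0) * u x t \<partial>M) - (\<integral>x. (u x t - u x t0)\<^sup>2 \<partial>M)"
proof -
  have int: "integrable M (\<lambda>x. (u x r)\<^sup>2)" if "0 \<le> r" for r
    using L2_Cauchy_Schwarz(1)[OF U_M U_M U_L2[OF that] U_L2[OF that]] by (simp add: power2_eq_square)
  have int': "integrable M (\<lambda>x. (u x t - u x t0) * u x t)"
    using assms by (intro L2_Cauchy_Schwarz U_diff_L2 U_L2) auto
  have int'': "integrable M (\<lambda>x. (u x t - u x t0)\<^sup>2)"
    using U_diff_L2[OF assms] by (simp add: Lp_mass_finite_iff)
  have "y t - y t0 = (\<integral>x. 2 * ((u x t - u x t0) * u x t) - (u x t - u x t0)\<^sup>2 \<partial>M)"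
    unfolding y_def Bochner_Integration.integral_diff[OF int[OF assms(1)] int[OF assms(2)], symmetric]
    by (intro Bochner_Integration.integral_cong) (auto simp: power2_eq_square algebra_simps)
  then show ?thesis
    using int' int'' by simp
qed

lemma y_continuous:
  assumes "0 < T"
  shows "continuous_on {0..T} y"
  unfolding continuous_on_def
proof
  fix t0 assume t0: "t0 \<in> {0..T}"
  have lim: "((\<lambda>t. 2 * ((\<integral>x. u x t * u x t0 \<partial>M) - (\<integral>x. u x t0 * u x t0 \<partial>M)) + (\<integral>x. (u x t - u x t0)\<^sup>2 \<partial>M)) \<longlongrightarrow> 2 * 0 + 0) (at t0 within {0..T})"
    using inner_U_continuous[OF assms U_measurable U_L2, of t0] t0
    by (intro tendsto_intros L2_dist_tendsto assms) (auto simp: continuous_on_def LIM_zero_iff)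
  have eq: "2 * ((\<integral>x. u x t * u x t0 \<partial>M) - (\<integral>x. u x t0 * u x t0 \<partial>M)) + (\<integral>x. (u x t - u x t0)\<^sup>2 \<partial>M) = y t - y t0"
    if "t \<in> {0..T}" for t
  proof -
    have "(\<integral>x. (u x t0 - u x t) * u x t0 \<partial>M) = (\<integral>x. u x t0 * u x t0 \<partial>M) - (\<integral>x. u x t * u x t0 \<partial>M)"
      using t0 that by (auto simp: left_diff_distrib U_L2 L2_Cauchy_Schwarz intro!: Bochner_Integration.integral_diff)
    then show ?thesis
      using y_diff[of t0 t] t0 that by (simp add: power2_commute)
  qed
  have "((\<lambda>t. y t - y t0) \<longlongrightarrow> 2 * 0 + 0) (at t0 within {0..T})"
    using lim
  proof (rule Lim_transform_eventually)
    show "\<forall>\<^sub>F t in at t0 within {0..T}. 2 * ((\<integral>x. u x t * u x t0 \<partial>M) - (\<integral>x. u x t0 * u x t0 \<partial>M))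
        + (\<integral>x. (u x t - u x t0)\<^sup>2 \<partial>M) = y t - y t0"
      unfolding eventually_at_filter by (intro always_eventually allI impI eq)
  qed
  then show "(y \<longlongrightarrow> y t0) (at t0 within {0..T})"
    by (simp add: LIM_zero_iff)
qed

lemma y_nonneg: "0 \<le> y t"
  by (simp add: y_def)

text \<open>Sobolev in L^q followed by Hoelder on the bounded set. For errors of approximation it
  turns convergence in the seminorm into convergence in L^2; for \<open>U t\<close> it is the lower
  bound of the energy by a power of \<open>y\<close>.\<close>

lemma W0_L2:
  assumes v: "v \<in> W0 s p \<Omega>"
  shows "Lp_mass M 2 v \<le> ennreal (measure lborel \<Omega> powr (1 - 2 / q) * (enn2real (gag s p v) / S) powr (2 / p))"
proof -
  have [measurable]: "v \<in> borel_measurable borel"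
    using v by (rule W0_measurable)
  have v_M: "v \<in> borel_measurable M"
    by (rule measurable_M) fact
  have le: "Lp_mass M q v \<le> ennreal ((enn2real (gag s p v) / S) powr (q / p))"
    using W0_Sobolev[OF sobolev S p _ v] q Lp_mass_M_le[of v q] by (auto simp: lpn_eq)
  then have fin: "Lp_mass M q v < top"
    by (rule le_less_trans) simp
  have "enn2real (Lp_mass M q v) \<le> (enn2real (gag s p v) / S) powr (q / p)"
    using le by (intro enn2real_leI) auto
  then have "enn2real (Lp_mass M q v) powr (2 / q) \<le> ((enn2real (gag s p v) / S) powr (q / p)) powr (2 / q)"
    using q by (intro powr_mono2) auto
  also have "\<dots> = (enn2real (gag s p v) / S) powr (2 / p)"
    using q p by (simp add: powr_powr)
  finally have "ennreal (measure lborel \<Omega> powr (1 - 2 / q) * enn2real (Lp_mass M q v) powr (2 / q))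
      \<le> ennreal (measure lborel \<Omega> powr (1 - 2 / q) * (enn2real (gag s p v) / S) powr (2 / p))"
    by (intro ennreal_leI mult_left_mono) auto
  with Lp_mass_2_le[OF finite_measure_M v_M q fin] show ?thesis
    unfolding measure_M by (rule order_trans)
qed

section \<open>Increments of the solution against fixed functions\<close>

lemma increment_test:
  assumes \<psi>: "test_fun \<Omega> \<psi>" and gag: "gag s p \<psi> < top" and ab: "0 < a" "a < b"
  shows "(\<integral>x. u x b * \<psi> x \<partial>M) - (\<integral>x. u x a * \<psi> x \<partial>M) = - (1 / 2) * (\<integral>t\<in>{a<..<b}. gag_form s p (U t) \<psi> \<partial>lborel)"
proof -
  have \<psi>_meas: "\<psi> \<in> borel_measurable borel"
    using \<psi> by (rule test_fun_measurable)
  have "Lp_mass M 2 \<psi> < top"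
    using le_less_trans[OF Lp_mass_M_le[OF \<psi>_meas] test_fun_Lp_mass_finite[OF \<psi>, of 2]] by simp
  then have "(\<integral>x. u x b * \<psi> x \<partial>M) - (\<integral>x. u x a * \<psi> x \<partial>M)
      = (\<integral>t\<in>{a<..<b}. - (1 / 2) * gag_form s p (U t) \<psi> \<partial>lborel)"
    using ab gag
    by (intro increment_of_weak_derivative[where T = "b + 1"] inner_U_continuous \<psi>_meas
          set_integrable_mult_right gag_form_set_integrable weak_tensor \<psi>) auto
  then show ?thesis
    by (simp only: set_integral_mult_right)
qed

text \<open>Density of test functions. The pairings converge by Cauchy-Schwarz and
  \<open>W0_L2\<close>, the time integral of the form by the scaled Young inequality.\<close>

lemma increment_W0:
  assumes v: "v \<in> W0 s p \<Omega>" and ab: "0 < a" "a < b"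
  shows "(\<integral>x. u x b * v x \<partial>M) - (\<integral>x. u x a * v x \<partial>M) = - (1 / 2) * (\<integral>t\<in>{a<..<b}. gag_form s p (U t) v \<partial>lborel)"
proof -
  obtain \<psi> where \<psi>: "\<And>k. test_fun \<Omega> (\<psi> k)" "\<And>k. gag s p (\<psi> k) < top"
    and lim: "(\<lambda>k. gag s p (\<lambda>x. \<psi> k x - v x)) \<longlonglongrightarrow> 0"
    and fin: "\<And>k. gag s p (\<lambda>x. \<psi> k x - v x) < top"
    by (rule W0_approx[OF v less_imp_le[OF p]]) blast
  have v_meas[measurable]: "v \<in> borel_measurable borel"
    using v by (rule W0_measurable)
  have \<psi>_meas[measurable]: "\<psi> k \<in> borel_measurable borel" for k
    using \<psi>(1) by (rule test_fun_measurable)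
  note [measurable] = measurable_M[OF v_meas] measurable_M[OF \<psi>_meas]
  have e_W0: "(\<lambda>x. \<psi> k x - v x) \<in> W0 s p \<Omega>" for k
    using v \<psi> p by (intro W0_diff_test) auto
  define d where "d k = enn2real (gag s p (\<lambda>x. \<psi> k x - v x))" for k
  have d: "gag s p (\<lambda>x. \<psi> k x - v x) = ennreal (d k)" "0 \<le> d k" for k
    using fin[of k] by (simp_all add: d_def)
  have d0: "d \<longlonglongrightarrow> 0"
    using lim by (simp add: d tendsto_ennreal_iff[of d _ 0, simplified])
  have L2: "Lp_mass M 2 w < top" if "w \<in> W0 s p \<Omega>" for w
    using W0_L2[OF that] by (rule le_less_trans) simp
  have e_L2: "(\<lambda>k. \<integral>x. (\<psi> k x - v x)\<^sup>2 \<partial>M) \<longlonglongrightarrow> 0"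
  proof (rule tendsto_sandwich[OF _ _ tendsto_const])
    have "Lp_mass M 2 (\<lambda>x. \<psi> k x - v x) = ennreal (\<integral>x. (\<psi> k x - v x)\<^sup>2 \<partial>M)" for k
      using L2[OF e_W0[of k]] by (subst Lp_mass_eq_integral) auto
    then have "(\<integral>x. (\<psi> k x - v x)\<^sup>2 \<partial>M) \<le> measure lborel \<Omega> powr (1 - 2 / q) * (d k / S) powr (2 / p)" for k
      using W0_L2[OF e_W0[of k]] by (simp add: d_def)
    then show "\<forall>\<^sub>F k in sequentially. (\<integral>x. (\<psi> k x - v x)\<^sup>2 \<partial>M) \<le> measure lborel \<Omega> powr (1 - 2 / q) * (d k / S) powr (2 / p)"
      by simp
    have "(\<lambda>k. measure lborel \<Omega> powr (1 - 2 / q) * (d k / S) powr (2 / p))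
        \<longlonglongrightarrow> measure lborel \<Omega> powr (1 - 2 / q) * (0 / S) powr (2 / p)"
      using d(2) S p by (intro tendsto_mult tendsto_const tendsto_powr' tendsto_divide d0) auto
    then show "(\<lambda>k. measure lborel \<Omega> powr (1 - 2 / q) * (d k / S) powr (2 / p)) \<longlonglongrightarrow> 0"
      by simp
  qed simp
  have inner_lim: "(\<lambda>k. \<integral>x. u x r * \<psi> k x \<partial>M) \<longlonglongrightarrow> (\<integral>x. u x r * v x \<partial>M)" if "0 \<le> r" for r
  proof -
    have "(\<lambda>k. \<integral>x. (\<psi> k x - v x) * u x r \<partial>M) \<longlonglongrightarrow> 0"
      by (rule tendsto_zero_of_square_le[OF _ e_L2, where c = "\<integral>x. (u x r)\<^sup>2 \<partial>M"])
         (use that in \<open>auto intro!: always_eventually L2_Cauchy_Schwarz L2 e_W0 U_L2\<close>)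
    also have "(\<lambda>k. \<integral>x. (\<psi> k x - v x) * u x r \<partial>M) = (\<lambda>k. (\<integral>x. u x r * \<psi> k x \<partial>M) - (\<integral>x. u x r * v x \<partial>M))"
    proof
      fix k
      have "\<psi> k \<in> W0 s p \<Omega>"
        using \<psi> p by (intro test_fun_W0) auto
      then have "integrable M (\<lambda>x. u x r * \<psi> k x)" "integrable M (\<lambda>x. u x r * v x)"
        using v that by (auto intro!: L2_Cauchy_Schwarz L2 U_L2)
      then show "(\<integral>x. (\<psi> k x - v x) * u x r \<partial>M) = (\<integral>x. u x r * \<psi> k x \<partial>M) - (\<integral>x. u x r * v x \<partial>M)"
        by (simp add: algebra_simps flip: Bochner_Integration.integral_diff)
    qed
    finally show ?thesis
      by (simp add: LIM_zero_iff)
  qed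
  define I where "I = enn2real (\<integral>\<^sup>+ t\<in>{0<..<b}. gag s p (U t) \<partial>lborel)"
  have I: "(\<integral>\<^sup>+ t\<in>{0<..<b}. gag s p (U t) \<partial>lborel) = ennreal I" "0 \<le> I"
    using gag_U_integrable[of b] ab by (simp_all add: I_def)
  have int: "set_integrable lborel {a<..<b} (\<lambda>t. gag_form s p (U t) w)" if "w \<in> W0 s p \<Omega>" for w
    using that ab W0_measurable W0_gag
    by (intro set_integrable_subset[OF gag_form_set_integrable[where T = b]]) auto
  let ?F = "\<lambda>w. \<integral>t\<in>{a<..<b}. gag_form s p (U t) w \<partial>lborel"
  \<comment> \<open>The energy of \<open>U t\<close> is known to be integrable in time, not bounded.
    Its contribution is made small by the weight \<open>l\<close>, and only then that of
    \<open>w\<close> by its seminorm.\<close>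
  have F_bound: "\<bar>?F w\<bar> \<le> l powr p * I + (l powr (1 - p)) powr p * enn2real (gag s p w) * (b - a)"
    if w: "w \<in> W0 s p \<Omega>" and l: "0 < l" for w l
  proof -
    have [measurable]: "w \<in> borel_measurable borel"
      using w by (rule W0_measurable)
    have "ennreal \<bar>?F w\<bar> \<le> (\<integral>\<^sup>+ t. ennreal \<bar>indicator {a<..<b} t * gag_form s p (U t) w\<bar> \<partial>lborel)"
      using integral_norm_bound_ennreal[OF int[OF w, unfolded set_integrable_def]]
      by (simp add: set_lebesgue_integral_def)
    also have "\<dots> \<le> (\<integral>\<^sup>+ t. ennreal (l powr p) * (gag s p (U t) * indicator {0<..<b} t)
        + ennreal ((l powr (1 - p)) powr p) * gag s p w * indicator {a<..<b} t \<partial>lborel)"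
      using gag_form_bound[of "U _" w p l s] p l ab by (intro nn_integral_mono) (auto simp: indicator_def)
    also have "\<dots> = ennreal (l powr p) * ennreal I + ennreal ((l powr (1 - p)) powr p) * gag s p w * ennreal (b - a)"
      using ab by (simp add: nn_integral_add nn_integral_cmult I(1)[symmetric])
    also have "\<dots> = ennreal (l powr p) * ennreal I + ennreal ((l powr (1 - p)) powr p) * ennreal (enn2real (gag s p w)) * ennreal (b - a)"
      using W0_gag[OF w] by simp
    also have "\<dots> = ennreal (l powr p * I + (l powr (1 - p)) powr p * enn2real (gag s p w) * (b - a))"
      using I ab by (simp flip: ennreal_mult ennreal_plus)
    finally show ?thesis
      using I ab by (subst (asm) ennreal_le_iff) auto
  qed
  have F_diff: "?F (\<psi> k) - ?F v = ?F (\<lambda>x. \<psi> k x - v x)" for k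
  proof -
    have "\<psi> k \<in> W0 s p \<Omega>"
      using \<psi> p by (intro test_fun_W0) auto
    then have "?F (\<psi> k) - ?F v = (\<integral>t\<in>{a<..<b}. gag_form s p (U t) (\<psi> k) - gag_form s p (U t) v \<partial>lborel)"
      using int v by (intro set_integral_diff(2)[symmetric]) auto
    also have "\<dots> = ?F (\<lambda>x. \<psi> k x - v x)"
    proof (rule set_lebesgue_integral_cong_AE)
      note [measurable] = gag_form_measurable
      show "(\<lambda>t. gag_form s p (U t) (\<psi> k) - gag_form s p (U t) v) \<in> borel_measurable lborel"
        "(\<lambda>t. gag_form s p (U t) (\<lambda>x. \<psi> k x - v x)) \<in> borel_measurable lborel"
        by measurable
      show "AE t in lborel. t \<in> {a<..<b} \<longrightarrow> gag_form s p (U t) (\<psi> k) - gag_form s p (U t) v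
          = gag_form s p (U t) (\<lambda>x. \<psi> k x - v x)"
        using gag_U_finite
        by eventually_elim (use ab p \<psi>(2)[of k] W0_gag[OF v] in \<open>auto simp: gag_form_diff\<close>)
    qed simp
    finally show ?thesis .
  qed
  have "(\<lambda>k. ?F (\<lambda>x. \<psi> k x - v x)) \<longlonglongrightarrow> 0"
  proof (rule tendstoI)
    fix \<epsilon> :: real assume "\<epsilon> > 0"
    \<comment> \<open>Chosen so that \<open>l powr p * I\<close> is at most half of
      \<open>\<epsilon>\<close>; the summand 1 covers \<open>I = 0\<close>.\<close>
    define l where "l = (\<epsilon> / (2 * (I + 1))) powr (1 / p)"
    have l: "l > 0"
      using \<open>\<epsilon> > 0\<close> I by (simp add: l_def)
    have "l powr p * I = \<epsilon> / 2 * (I / (I + 1))"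
      using \<open>\<epsilon> > 0\<close> I p by (simp add: l_def powr_powr)
    also have "\<dots> \<le> \<epsilon> / 2 * 1"
      using \<open>\<epsilon> > 0\<close> I by (intro mult_left_mono) auto
    finally have lI: "l powr p * I \<le> \<epsilon> / 2"
      by simp
    have "(\<lambda>k. (l powr (1 - p)) powr p * d k * (b - a)) \<longlonglongrightarrow> (l powr (1 - p)) powr p * 0 * (b - a)"
      by (intro tendsto_intros d0)
    then have "\<forall>\<^sub>F k in sequentially. (l powr (1 - p)) powr p * d k * (b - a) < \<epsilon> / 2"
      using \<open>\<epsilon> > 0\<close> by (intro order_tendstoD) auto
    then show "\<forall>\<^sub>F k in sequentially. dist (?F (\<lambda>x. \<psi> k x - v x)) 0 < \<epsilon>"
    proof eventually_elim
      case (elim k)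
      then show ?case
        using F_bound[OF e_W0[of k] l] lI by (simp add: d_def)
    qed
  qed
  then have "(\<lambda>k. ?F (\<psi> k)) \<longlonglongrightarrow> ?F v"
    unfolding F_diff[symmetric] by (simp add: LIM_zero_iff)
  then have "(\<lambda>k. - (1 / 2) * ?F (\<psi> k)) \<longlonglongrightarrow> - (1 / 2) * ?F v"
    by (intro tendsto_intros)
  moreover have "(\<lambda>k. - (1 / 2) * ?F (\<psi> k)) \<longlonglongrightarrow> (\<integral>x. u x b * v x \<partial>M) - (\<integral>x. u x a * v x \<partial>M)"
    unfolding increment_test[OF \<psi> ab, symmetric] using ab by (intro tendsto_diff inner_lim) auto
  ultimately show ?thesis
    by (rule LIMSEQ_unique[symmetric])
qed

text \<open>The 2 in \<open>y_diff\<close> cancels the 1/2 of the weak formulation, and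
  \<open>h < t\<close> keeps the earlier time positive. The test function must be a member of
  \<open>W0\<close>, so this is available for almost every \<open>t\<close>.\<close>

lemma energy_step:
  assumes "U t \<in> W0 s p \<Omega>" "0 < h" "h < t"
  shows "y t - y (t - h) \<le> - (\<integral>\<tau>\<in>{t - h<..<t}. gag_form s p (U \<tau>) (U t) \<partial>lborel)"
proof -
  have "y t - y (t - h) \<le> 2 * (\<integral>x. (u x t - u x (t - h)) * u x t \<partial>M)"
    using y_diff[of t "t - h"] assms by simp
  also have "(\<integral>x. (u x t - u x (t - h)) * u x t \<partial>M) = (\<integral>x. u x t * u x t \<partial>M) - (\<integral>x. u x (t - h) * u x t \<partial>M)"
    using assms by (auto simp: left_diff_distrib U_L2 L2_Cauchy_Schwarz intro!: Bochner_Integration.integral_diff)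
  also have "\<dots> = - (1 / 2) * (\<integral>\<tau>\<in>{t - h<..<t}. gag_form s p (U \<tau>) (U t) \<partial>lborel)"
    using assms by (intro increment_W0) auto
  finally show ?thesis
    by simp
qed

end

section \<open>Energy inequality\<close>

lemma AE_lborel_shift:
  fixes c :: real
  assumes "AE t in lborel. P t"
  shows "AE t in lborel. P (t - c)"
proof -
  obtain N where N: "N \<in> null_sets lborel" "{t. \<not> P t} \<subseteq> N"
    using assms by (auto simp: eventually_ae_filter)
  then have [measurable]: "N \<in> sets borel"
    by auto
  have "AE t in distr lborel borel ((+) (- c)). t \<notin> N"
    unfolding lborel_distr_plus using AE_not_in[OF N(1)] .
  then have "AE t in lborel. - c + t \<notin> N"
    by (subst (asm) AE_distr_iff) auto
  then show ?thesis
    by eventually_elim (use N(2) in \<open>auto simp: algebra_simps\<close>)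
qed

text \<open>The substitution \<tau> = t - \<sigma> makes the window independent of \<open>t\<close>,
  after which Tonelli's theorem applies. Afterwards each fixed lag can be studied as it tends to
  0.\<close>

lemma nn_integral_lag:
  fixes f :: "real \<Rightarrow> real \<Rightarrow> ennreal" and h t1 t2 :: real
  assumes [measurable]: "case_prod f \<in> borel_measurable (lborel \<Otimes>\<^sub>M lborel)"
  shows "(\<integral>\<^sup>+ t\<in>{t1..t2}. (\<integral>\<^sup>+ \<tau>\<in>{t - h<..<t}. f \<tau> t \<partial>lborel) \<partial>lborel)
    = (\<integral>\<^sup>+ \<sigma>\<in>{0<..<h}. (\<integral>\<^sup>+ t\<in>{t1..t2}. f (t - \<sigma>) t \<partial>lborel) \<partial>lborel)"
proof -
  have [measurable]: "(\<lambda>x. f (g x) (k x)) \<in> borel_measurable N"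
    if [measurable]: "g \<in> measurable N borel" "k \<in> measurable N borel" for g k and N :: "(real \<times> real) measure"
    using measurable_compose[OF _ assms, of "\<lambda>x. (g x, k x)" N] by simp
  have [measurable]: "(\<lambda>x. f (g x) (k x)) \<in> borel_measurable N"
    if [measurable]: "g \<in> measurable N borel" "k \<in> measurable N borel" for g k and N :: "real measure"
    using measurable_compose[OF _ assms, of "\<lambda>x. (g x, k x)" N] by simp
  have "(\<integral>\<^sup>+ \<tau>\<in>{t - h<..<t}. f \<tau> t \<partial>lborel) = (\<integral>\<^sup>+ \<sigma>\<in>{0<..<h}. f (t - \<sigma>) t \<partial>lborel)" for t
    by (subst nn_integral_real_affine[where c = "-1" and t = t])
       (auto intro!: nn_integral_cong simp: indicator_def)
  then have "(\<integral>\<^sup>+ t\<in>{t1..t2}. (\<integral>\<^sup>+ \<tau>\<in>{t - h<..<t}. f \<tau> t \<partial>lborel) \<partial>lborel)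
      = (\<integral>\<^sup>+ t. (\<integral>\<^sup>+ \<sigma>. f (t - \<sigma>) t * indicator {0<..<h} \<sigma> * indicator {t1..t2} t \<partial>lborel) \<partial>lborel)"
    by (simp add: nn_integral_multc)
  also have "\<dots> = (\<integral>\<^sup>+ \<sigma>. (\<integral>\<^sup>+ t. f (t - \<sigma>) t * indicator {0<..<h} \<sigma> * indicator {t1..t2} t \<partial>lborel) \<partial>lborel)"
    by (rule lborel_pair.Fubini') measurable
  also have "\<dots> = (\<integral>\<^sup>+ \<sigma>\<in>{0<..<h}. (\<integral>\<^sup>+ t\<in>{t1..t2}. f (t - \<sigma>) t \<partial>lborel) \<partial>lborel)"
    by (intro nn_integral_cong) (auto simp: indicator_def)
  finally show ?thesis .
qed

text \<open>By Young's inequality the integrand below is nonnegative, so Fatou's lemma applies to it although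
  \<open>gag_form\<close> itself has no sign.\<close>

definition gag_excess :: "real \<Rightarrow> real \<Rightarrow> ('a::euclidean_space \<Rightarrow> real) \<Rightarrow> ('a \<Rightarrow> real) \<Rightarrow> ennreal" where
  "gag_excess s p a b = (\<integral>\<^sup>+ z. ennreal (spow p (incr a z) * incr b z
      + (1 - 1 / p) * \<bar>incr a z\<bar> powr p + 1 / p * \<bar>incr b z\<bar> powr p) \<partial>gag_measure s p)"

lemma gag_excess_eq:
  assumes [measurable]: "a \<in> borel_measurable borel" "b \<in> borel_measurable borel" and p: "1 < p"
    and fin: "gag s p a < top" "gag s p b < top"
  shows "gag_excess s p a b = ennreal (gag_form s p a b + (1 - 1 / p) * enn2real (gag s p a) + 1 / p * enn2real (gag s p b))"
    and "0 \<le> gag_form s p a b + (1 - 1 / p) * enn2real (gag s p a) + 1 / p * enn2real (gag s p b)"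
proof -
  have int: "integrable (gag_measure s p) (\<lambda>z. \<bar>incr w z\<bar> powr p)"
    and eq: "enn2real (gag s p w) = (\<integral>z. \<bar>incr w z\<bar> powr p \<partial>gag_measure s p)"
    if "gag s p w < top" and [measurable]: "w \<in> borel_measurable borel" for w
    using that Lp_mass_eq_integral[of "incr w" "gag_measure s p" p] by (simp_all add: gag_eq Lp_mass_finite_iff)
  have form: "integrable (gag_measure s p) (\<lambda>z. spow p (incr a z) * incr b z)"
    using p fin by (intro gag_form_integrable) auto
  have nonneg: "0 \<le> spow p (incr a z) * incr b z
      + (1 - 1 / p) * \<bar>incr a z\<bar> powr p + 1 / p * \<bar>incr b z\<bar> powr p" for z
    using spow_Young[OF p, of "incr a z" "incr b z"] by linarith
  have sum: "(\<integral>z. spow p (incr a z) * incr b z + (1 - 1 / p) * \<bar>incr a z\<bar> powr p + 1 / p * \<bar>incr b z\<bar> powr p \<partial>gag_measure s p)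
      = gag_form s p a b + (1 - 1 / p) * enn2real (gag s p a) + 1 / p * enn2real (gag s p b)"
    using form int[OF fin(1)] int[OF fin(2)] by (simp add: eq fin gag_form_def)
  show "gag_excess s p a b = ennreal (gag_form s p a b + (1 - 1 / p) * enn2real (gag s p a) + 1 / p * enn2real (gag s p b))"
    unfolding gag_excess_def sum[symmetric] using form int[OF fin(1)] int[OF fin(2)] nonneg
    by (intro nn_integral_eq_integral) auto
  show "0 \<le> gag_form s p a b + (1 - 1 / p) * enn2real (gag s p a) + 1 / p * enn2real (gag s p b)"
    unfolding sum[symmetric] using nonneg by (intro integral_nonneg_AE) auto
qed

text \<open>In the pointwise limit all three terms are multiples of the p-th power of
  \<open>\<bar>incr b z\<bar>\<close>, with weights 1, 1 - 1/p and 1/p; their sum is the factor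
  2.\<close>

lemma gag_excess_liminf_AE:
  fixes a :: "nat \<Rightarrow> 'a::euclidean_space \<Rightarrow> real"
  assumes [measurable]: "\<And>n. a n \<in> borel_measurable borel" "b \<in> borel_measurable borel" and p: "1 < p"
    and lim: "AE x in lborel. (\<lambda>n. a n x) \<longlonglongrightarrow> b x"
  shows "2 * gag s p b \<le> liminf (\<lambda>n. gag_excess s p (a n) b)"
proof -
  have "2 * gag s p b = (\<integral>\<^sup>+ z. 2 * ennreal (\<bar>incr b z\<bar> powr p) \<partial>gag_measure s p)"
    by (simp add: gag_eq Lp_mass_def nn_integral_cmult)
  also have "\<dots> = (\<integral>\<^sup>+ z. liminf (\<lambda>n. ennreal (spow p (incr (a n) z) * incr b z
      + (1 - 1 / p) * \<bar>incr (a n) z\<bar> powr p + 1 / p * \<bar>incr b z\<bar> powr p)) \<partial>gag_measure s p)"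
  proof (rule nn_integral_cong_AE)
    show "AE z in gag_measure s p. 2 * ennreal (\<bar>incr b z\<bar> powr p) = liminf (\<lambda>n. ennreal (spow p (incr (a n) z) * incr b z
      + (1 - 1 / p) * \<bar>incr (a n) z\<bar> powr p + 1 / p * \<bar>incr b z\<bar> powr p))"
      using AE_gag_measure[OF lim]
    proof eventually_elim
      case (elim z)
      then have "(\<lambda>n. incr (a n) z) \<longlonglongrightarrow> incr b z"
        unfolding incr_def by (intro tendsto_diff) auto
      then have "(\<lambda>n. ennreal (spow p (incr (a n) z) * incr b z
          + (1 - 1 / p) * \<bar>incr (a n) z\<bar> powr p + 1 / p * \<bar>incr b z\<bar> powr p))
        \<longlonglongrightarrow> ennreal (spow p (incr b z) * incr b z + (1 - 1 / p) * \<bar>incr b z\<bar> powr p + 1 / p * \<bar>incr b z\<bar> powr p)"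
        using p by (intro tendsto_ennrealI tendsto_add tendsto_mult tendsto_spow tendsto_powr' tendsto_rabs tendsto_const) auto
      also have "ennreal (spow p (incr b z) * incr b z + (1 - 1 / p) * \<bar>incr b z\<bar> powr p + 1 / p * \<bar>incr b z\<bar> powr p)
          = 2 * ennreal (\<bar>incr b z\<bar> powr p)"
        unfolding spow_mult_self by (simp add: algebra_simps flip: ennreal_numeral ennreal_mult)
      finally show ?case
        by (intro lim_imp_Liminf[symmetric]) auto
    qed
  qed
  also have "\<dots> \<le> liminf (\<lambda>n. gag_excess s p (a n) b)"
    unfolding gag_excess_def by (intro nn_integral_liminf) auto
  finally show ?thesis .
qed

section \<open>Vanishing lag at a fixed time\<close>

context frac_flow
begin

text \<open>Almost everywhere convergence comes from L^2 continuity inside \<open>\<Omega>\<close>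
  and from \<open>W0_zero_outside\<close> elsewhere. It holds only along a subsequence, so a
  subsequence realising the liminf is fixed beforehand.\<close>

lemma gag_excess_liminf:
  assumes t: "0 < t" and W: "U t \<in> W0 s p \<Omega>" "\<And>n. U (t - \<sigma> n) \<in> W0 s p \<Omega>"
    and \<sigma>: "\<And>n. 0 < \<sigma> n" "\<And>n. \<sigma> n < t" "\<sigma> \<longlonglongrightarrow> 0"
  shows "2 * gag s p (U t) \<le> liminf (\<lambda>n. gag_excess s p (U (t - \<sigma> n)) (U t))"
proof -
  let ?X = "\<lambda>n. gag_excess s p (U (t - \<sigma> n)) (U t)"
  obtain r where r: "strict_mono r" "(?X \<circ> r) \<longlonglongrightarrow> liminf ?X"
    using liminf_subseq_lim[of ?X] by blast
  have "filterlim (\<lambda>n. t - \<sigma> n) (at t within {0..t}) sequentially"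
  proof -
    have "(\<lambda>n. t - \<sigma> n) \<longlonglongrightarrow> t - 0"
      by (intro tendsto_intros \<sigma>)
    moreover have "t - \<sigma> n \<in> {0..t}" "t - \<sigma> n \<noteq> t" for n
      using \<sigma>(1,2)[of n] by auto
    ultimately show ?thesis
      by (auto simp: filterlim_at)
  qed
  then have L2: "(\<lambda>n. Lp_mass M 2 (\<lambda>x. u x (t - \<sigma> n) - u x t)) \<longlonglongrightarrow> 0"
    using filterlim_compose[OF U_continuous[OF t, of t]] t by simp
  have L2_fin: "Lp_mass M 2 (\<lambda>x. u x (t - \<sigma> n) - u x t) < top" for n
    using \<sigma>(2)[of n] t by (intro U_diff_L2) auto
  obtain r' where r': "strict_mono r'" "AE x in M. (\<lambda>k. u x (t - \<sigma> (r (r' k)))) \<longlonglongrightarrow> u x t"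
  proof (rule Lp_mass_AE_subseq[where f = "\<lambda>k. U (t - \<sigma> (r k))" and g = "U t" and M = M and p = 2])
    show "(\<lambda>k. Lp_mass M 2 (\<lambda>x. u x (t - \<sigma> (r k)) - u x t)) \<longlonglongrightarrow> 0"
      using LIMSEQ_subseq_LIMSEQ[OF L2 r(1)] by (simp add: comp_def)
  qed (use L2_fin in auto)
  have in_\<Omega>: "AE x in lborel. x \<in> \<Omega> \<longrightarrow> (\<lambda>k. u x (t - \<sigma> (r (r' k)))) \<longlonglongrightarrow> u x t"
    using r'(2) by (subst (asm) AE_restrict_space_iff) auto
  have out: "AE x in lborel. \<forall>n. x \<notin> \<Omega> \<longrightarrow> u x (t - \<sigma> n) = 0"
    unfolding AE_all_countable using W0_zero_outside[OF W(2) open_\<Omega>] p by auto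
  have "AE x in lborel. x \<notin> \<Omega> \<longrightarrow> u x t = 0"
    using W0_zero_outside[OF W(1) open_\<Omega>] p by auto
  with in_\<Omega> out have "AE x in lborel. (\<lambda>k. u x (t - \<sigma> (r (r' k)))) \<longlonglongrightarrow> u x t"
  proof eventually_elim
    case (elim x)
    then show ?case
      by (cases "x \<in> \<Omega>") auto
  qed
  then have "2 * gag s p (U t) \<le> liminf (\<lambda>k. ?X (r (r' k)))"
    using p by (intro gag_excess_liminf_AE) auto
  also have "(\<lambda>k. ?X (r (r' k))) \<longlonglongrightarrow> liminf ?X"
    using LIMSEQ_subseq_LIMSEQ[OF r(2) r'(1)] by (simp add: comp_def)
  then have "liminf (\<lambda>k. ?X (r (r' k))) = liminf ?X"
    by (intro lim_imp_Liminf) auto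
  finally show ?thesis .
qed

lemma gag_excess_measurable[measurable]:
  "(\<lambda>x. gag_excess s p (U (f x)) (U (g x))) \<in> borel_measurable N"
  if [measurable]: "f \<in> measurable N borel" "g \<in> measurable N borel"
proof -
  interpret sigma_finite_measure "gag_measure s p :: ('a \<times> 'a) measure"
    by (rule sigma_finite_gag_measure)
  show ?thesis
    unfolding gag_excess_def by measurable
qed

lemma y_measurable[measurable]: "y \<in> borel_measurable borel"
proof -
  interpret finite_measure M
    by (rule finite_measure_M)
  have [measurable]: "(\<lambda>z. u (snd z) (fst z)) \<in> borel_measurable (borel \<Otimes>\<^sub>M M)"
  proof -
    have [measurable]: "(\<lambda>x. x) \<in> measurable M lborel"
      by (intro measurable_restrict_space1) simp
    show ?thesis
      using measurable_compose[OF _ u_measurable, of "\<lambda>z. (snd z, fst z)" "borel \<Otimes>\<^sub>M M"] by simp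
  qed
  show ?thesis
    unfolding y_def by measurable
qed

text \<open>This is \<open>energy_step\<close> with the Young terms added on both sides, so that all
  terms are nonnegative and no subtraction occurs in \<open>ennreal\<close>. The coefficient
  \<open>h / p\<close> is the weight 1/p times the length of the window, over which
  \<open>gag s p (U t)\<close> is constant.\<close>

lemma gag_excess_step:
  assumes h: "0 < h"
  shows "AE t in lborel. h < t \<longrightarrow>
    (\<integral>\<^sup>+ \<tau>\<in>{t - h<..<t}. gag_excess s p (U \<tau>) (U t) \<partial>lborel) + ennreal (y t)
    \<le> ennreal (y (t - h)) + ennreal (1 - 1 / p) * (\<integral>\<^sup>+ \<tau>\<in>{t - h<..<t}. gag s p (U \<tau>) \<partial>lborel)
      + ennreal (h / p) * gag s p (U t)"
  using U_W0
proof eventually_elim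
  case (elim t)
  show ?case
  proof
    assume t: "h < t"
    then have W: "U t \<in> W0 s p \<Omega>"
      using elim h by simp
    let ?J = "{t - h<..<t}"
    define g where "g \<tau> = enn2real (gag s p (U \<tau>))" for \<tau>
    have gt: "gag s p (U t) = ennreal (g t)" "0 \<le> g t"
      using W0_gag[OF W] by (simp_all add: g_def)
    have g_meas[measurable]: "g \<in> borel_measurable borel"
      unfolding g_def by measurable
    have pos: "\<tau> \<in> ?J \<Longrightarrow> 0 < \<tau>" for \<tau>
      using t by auto
    have gag_J: "(\<integral>\<^sup>+ \<tau>\<in>?J. gag s p (U \<tau>) \<partial>lborel) = (\<integral>\<^sup>+ \<tau>. ennreal (indicator ?J \<tau> * g \<tau>) \<partial>lborel)"
    proof (rule nn_integral_cong_AE)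
      show "AE \<tau> in lborel. gag s p (U \<tau>) * indicator ?J \<tau> = ennreal (indicator ?J \<tau> * g \<tau>)"
        using gag_U_finite by eventually_elim (use pos in \<open>auto simp: indicator_def g_def\<close>)
    qed
    have "(\<integral>\<^sup>+ \<tau>\<in>?J. gag s p (U \<tau>) \<partial>lborel) \<le> (\<integral>\<^sup>+ \<tau>\<in>{0<..<t}. gag s p (U \<tau>) \<partial>lborel)"
      using t by (intro nn_integral_mono) (auto simp: indicator_def)
    also have "\<dots> < top"
      using t h by (intro gag_U_integrable) auto
    finally have g_int: "integrable lborel (\<lambda>\<tau>. indicator ?J \<tau> * g \<tau>)"
      unfolding gag_J by (intro integrableI_nonneg) (auto simp: g_def)
    define \<gamma> where "\<gamma> = (\<integral>\<tau>. indicator ?J \<tau> * g \<tau> \<partial>lborel)"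
    have \<gamma>: "(\<integral>\<^sup>+ \<tau>\<in>?J. gag s p (U \<tau>) \<partial>lborel) = ennreal \<gamma>" "0 \<le> \<gamma>"
      unfolding gag_J \<gamma>_def using g_int
      by (auto intro!: nn_integral_eq_integral integral_nonneg_AE simp: g_def)
    define E where "E \<tau> = gag_form s p (U \<tau>) (U t)" for \<tau>
    have "set_integrable lborel ?J E"
      unfolding E_def using W t h W0_gag
      by (intro set_integrable_subset[OF gag_form_set_integrable[where T = t]]) auto
    then have E_int: "integrable lborel (\<lambda>\<tau>. indicator ?J \<tau> * E \<tau>)"
      by (simp add: set_integrable_def)
    have one_int: "integrable lborel (\<lambda>\<tau>. indicator ?J \<tau> * (1 / p * g t))"
      by (intro integrable_mult_left integrable_real_indicator) (use h in auto)
    define R where "R \<tau> = indicator ?J \<tau> * E \<tau> + (1 - 1 / p) * (indicator ?J \<tau> * g \<tau>) + indicator ?J \<tau> * (1 / p * g t)" for \<tau>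
    have R_int: "integrable lborel R"
      unfolding R_def using E_int g_int one_int by simp
    have R_eq: "AE \<tau> in lborel. gag_excess s p (U \<tau>) (U t) * indicator ?J \<tau> = ennreal (R \<tau>) \<and> 0 \<le> R \<tau>"
      using gag_U_finite
    proof eventually_elim
      case (elim \<tau>)
      then show ?case
        using gag_excess_eq[of "U \<tau>" "U t" p s] p W0_gag[OF W] pos
        by (cases "\<tau> \<in> ?J") (auto simp: R_def E_def g_def)
    qed
    have "(\<integral>\<^sup>+ \<tau>\<in>?J. gag_excess s p (U \<tau>) (U t) \<partial>lborel) = (\<integral>\<^sup>+ \<tau>. ennreal (R \<tau>) \<partial>lborel)"
      using R_eq by (intro nn_integral_cong_AE) auto
    also have "\<dots> = ennreal (\<integral>\<tau>. R \<tau> \<partial>lborel)"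
      using R_eq R_int by (intro nn_integral_eq_integral) auto
    finally have exc: "(\<integral>\<^sup>+ \<tau>\<in>?J. gag_excess s p (U \<tau>) (U t) \<partial>lborel) = ennreal (\<integral>\<tau>. R \<tau> \<partial>lborel)" .
    have R_nonneg: "0 \<le> (\<integral>\<tau>. R \<tau> \<partial>lborel)"
      using R_eq by (intro integral_nonneg_AE) auto
    have "(\<integral>\<tau>. R \<tau> \<partial>lborel) = (\<integral>\<tau>\<in>?J. E \<tau> \<partial>lborel) + (1 - 1 / p) * \<gamma> + h / p * g t"
      unfolding R_def using E_int g_int one_int h
      by (simp add: \<gamma>_def set_lebesgue_integral_def)
    moreover have "y t - y (t - h) \<le> - (\<integral>\<tau>\<in>?J. E \<tau> \<partial>lborel)"
      unfolding E_def using W h t by (intro energy_step) auto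
    ultimately have "(\<integral>\<tau>. R \<tau> \<partial>lborel) + y t \<le> y (t - h) + (1 - 1 / p) * \<gamma> + h / p * g t"
      by linarith
    then have "ennreal ((\<integral>\<tau>. R \<tau> \<partial>lborel) + y t) \<le> ennreal (y (t - h) + (1 - 1 / p) * \<gamma> + h / p * g t)"
      by (rule ennreal_leI)
    then show "(\<integral>\<^sup>+ \<tau>\<in>?J. gag_excess s p (U \<tau>) (U t) \<partial>lborel) + ennreal (y t)
      \<le> ennreal (y (t - h)) + ennreal (1 - 1 / p) * (\<integral>\<^sup>+ \<tau>\<in>?J. gag s p (U \<tau>) \<partial>lborel) + ennreal (h / p) * gag s p (U t)"
      unfolding exc \<gamma>(1) gt(1) using R_nonneg y_nonneg \<gamma>(2) gt(2) p h
      by (simp flip: ennreal_mult ennreal_plus)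
  qed
qed

end

text \<open>\<open>y\<close> need not be differentiable, so it is replaced by the right-hand bound
  \<open>Y\<close>, which is. From Y \<le> y follows Y' = - c y^\<theta> \<le> - c Y^\<theta>, hence
  \<open>Z\<close> decreases. \<open>Y\<close> agrees with \<open>y\<close> at \<open>b\<close> and
  lies below it at \<open>a\<close>; positivity of \<open>y b\<close> keeps \<open>Y\<close> away
  from the singularity of the power.\<close>

lemma decay_of_power_inequality:
  fixes y :: "real \<Rightarrow> real"
  assumes ab: "a \<le> b" and cont: "continuous_on {a..b} y" and nonneg: "\<And>t. t \<in> {a..b} \<Longrightarrow> 0 \<le> y t"
    and c: "0 \<le> c" and \<theta>: "0 < \<theta>" "\<theta> < 1" and pos: "0 < y b"
    and ineq: "\<And>t. t \<in> {a..b} \<Longrightarrow> y b + c * integral {t..b} (\<lambda>r. y r powr \<theta>) \<le> y t"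
  shows "y b powr (1 - \<theta>) + (1 - \<theta>) * c * (b - a) \<le> y a powr (1 - \<theta>)"
proof -
  define Y where "Y t = y b + c * integral {t..b} (\<lambda>r. y r powr \<theta>)" for t
  define Z where "Z t = Y t powr (1 - \<theta>) + (1 - \<theta>) * c * t" for t
  have cont_pow: "continuous_on {a..b} (\<lambda>r. y r powr \<theta>)"
    using nonneg \<theta> by (intro continuous_on_powr' cont continuous_on_const) auto
  have int_nonneg: "0 \<le> integral {t..b} (\<lambda>r. y r powr \<theta>)" if "t \<in> {a..b}" for t
    using that by (intro integral_nonneg integrable_continuous_real continuous_on_subset[OF cont_pow]) auto
  have Y_pos: "0 < Y t" if "t \<in> {a..b}" for t
    using int_nonneg[OF that] pos c by (simp add: Y_def add_pos_nonneg)
  have Y_le: "Y t \<le> y t" if "t \<in> {a..b}" for t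
    using ineq[OF that] by (simp add: Y_def)
  have DY: "(Y has_real_derivative - c * y t powr \<theta>) (at t within {a..b})" if "t \<in> {a..b}" for t
    unfolding Y_def using DERIV_cmult[OF integral_has_real_derivative'[OF cont_pow that], of c]
    by (auto intro: DERIV_add[OF DERIV_const, THEN DERIV_cong])
  have DZ: "(Z has_real_derivative (1 - \<theta>) * Y t powr (- \<theta>) * (- c * y t powr \<theta>) + (1 - \<theta>) * c) (at t within {a..b})"
    if "t \<in> {a..b}" for t
    unfolding Z_def using Y_pos[OF that] DY[OF that]
    by (auto intro!: derivative_eq_intros)
  have "Z b \<le> Z a"
  proof (rule DERIV_nonpos_imp_decreasing_open[OF ab])
    show "continuous_on {a..b} Z"
      using DZ by (rule DERIV_continuous_on)
    fix t assume t: "a < t" "t < b"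
    then have DZt: "(Z has_real_derivative (1 - \<theta>) * Y t powr (- \<theta>) * (- c * y t powr \<theta>) + (1 - \<theta>) * c) (at t)"
      using DZ[of t] by (simp add: at_within_interior[of t "{a..b}"])
    have "1 = Y t powr (- \<theta>) * Y t powr \<theta>"
      using Y_pos[of t] t by (simp flip: powr_add)
    also have "\<dots> \<le> Y t powr (- \<theta>) * y t powr \<theta>"
      using Y_pos[of t] Y_le[of t] t \<theta> by (intro mult_left_mono powr_mono2) auto
    finally have "(1 - \<theta>) * c * 1 \<le> (1 - \<theta>) * c * (Y t powr (- \<theta>) * y t powr \<theta>)"
      using c \<theta> by (intro mult_left_mono) auto
    then show "\<exists>d. DERIV Z t :> d \<and> d \<le> 0"
      using DZt by (intro exI conjI) (auto simp: algebra_simps)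
  qed
  moreover have "Y b = y b"
    by (simp add: Y_def)
  moreover have "Y a powr (1 - \<theta>) \<le> y a powr (1 - \<theta>)"
    using Y_pos[of a] Y_le[of a] ab \<theta> by (intro powr_mono2) auto
  ultimately show ?thesis
    by (simp add: Z_def algebra_simps)
qed

section \<open>Averaging in time and the limit of the averages\<close>

context frac_flow
begin

text \<open>\<open>nn_integral_lag\<close> turns the window into a lag. On the right the Young
  weights recombine to (1 - 1/p) h + h/p = h. The interval starts at \<open>t1 - h\<close> because
  the lagged times reach back that far.\<close>

lemma averaged_energy:
  assumes h: "0 < h" "h < t1" and t: "t1 < t2"
  shows "(\<integral>\<^sup>+ \<sigma>\<in>{0<..<h}. (\<integral>\<^sup>+ t\<in>{t1..t2}. gag_excess s p (U (t - \<sigma>)) (U t) \<partial>lborel) \<partial>lborel)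
      + (\<integral>\<^sup>+ t\<in>{t1..t2}. ennreal (y t) \<partial>lborel)
    \<le> (\<integral>\<^sup>+ t\<in>{t1..t2}. ennreal (y (t - h)) \<partial>lborel)
      + ennreal h * (\<integral>\<^sup>+ t\<in>{t1 - h..t2}. gag s p (U t) \<partial>lborel)"
proof -
  have [measurable]: "(\<lambda>x. gag s p (U (f x))) \<in> borel_measurable N"
    if "f \<in> measurable N borel" for f and N :: "real measure"
    using measurable_compose[OF that gag_U_measurable] .
  have [measurable]: "(\<lambda>x. gag s p (U (f x))) \<in> borel_measurable N"
    if "f \<in> measurable N borel" for f and N :: "(real \<times> real) measure"
    using measurable_compose[OF that gag_U_measurable] .
  let ?I = "\<integral>\<^sup>+ t\<in>{t1 - h..t2}. gag s p (U t) \<partial>lborel"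
  let ?ex = "\<lambda>t. \<integral>\<^sup>+ \<tau>\<in>{t - h<..<t}. gag_excess s p (U \<tau>) (U t) \<partial>lborel"
  let ?g = "\<lambda>t. \<integral>\<^sup>+ \<tau>\<in>{t - h<..<t}. gag s p (U \<tau>) \<partial>lborel"
  have ind: "(\<lambda>\<tau>. indicator {t - h<..<t} \<tau> :: ennreal) = (\<lambda>\<tau>. indicator {z. fst z - h < snd z \<and> snd z < fst z} (t, \<tau>))" for t
    by (auto simp: indicator_def fun_eq_iff)
  have ind_meas: "{z :: real \<times> real. fst z - h < snd z \<and> snd z < fst z} \<in> sets (borel \<Otimes>\<^sub>M borel)"
    unfolding borel_prod by (intro borel_open open_Collect_conj open_Collect_less continuous_intros)
  have ex_meas: "?ex \<in> borel_measurable borel"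
    unfolding ind using ind_meas by measurable
  have g_meas: "?g \<in> borel_measurable borel"
    unfolding ind using ind_meas by measurable
  note [measurable] = ex_meas g_meas
  have "(\<integral>\<^sup>+ t\<in>{t1..t2}. ?ex t + ennreal (y t) \<partial>lborel)
      \<le> (\<integral>\<^sup>+ t\<in>{t1..t2}. ennreal (y (t - h)) + ennreal (1 - 1 / p) * ?g t + ennreal (h / p) * gag s p (U t) \<partial>lborel)"
  proof (rule nn_integral_mono_AE)
    show "AE t in lborel. (?ex t + ennreal (y t)) * indicator {t1..t2} t
      \<le> (ennreal (y (t - h)) + ennreal (1 - 1 / p) * ?g t + ennreal (h / p) * gag s p (U t)) * indicator {t1..t2} t"
      using gag_excess_step[OF h(1)] by eventually_elim (use h in \<open>auto simp: indicator_def\<close>)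
  qed
  also have "(\<integral>\<^sup>+ t\<in>{t1..t2}. ?ex t + ennreal (y t) \<partial>lborel)
      = (\<integral>\<^sup>+ t\<in>{t1..t2}. ?ex t \<partial>lborel) + (\<integral>\<^sup>+ t\<in>{t1..t2}. ennreal (y t) \<partial>lborel)"
    by (simp add: distrib_right nn_integral_add)
  also have "(\<integral>\<^sup>+ t\<in>{t1..t2}. ?ex t \<partial>lborel) = (\<integral>\<^sup>+ \<sigma>\<in>{0<..<h}. (\<integral>\<^sup>+ t\<in>{t1..t2}. gag_excess s p (U (t - \<sigma>)) (U t) \<partial>lborel) \<partial>lborel)"
    by (rule nn_integral_lag) measurable
  also have "(\<integral>\<^sup>+ t\<in>{t1..t2}. ennreal (y (t - h)) + ennreal (1 - 1 / p) * ?g t + ennreal (h / p) * gag s p (U t) \<partial>lborel)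
      = (\<integral>\<^sup>+ t\<in>{t1..t2}. ennreal (y (t - h)) \<partial>lborel) + ennreal (1 - 1 / p) * (\<integral>\<^sup>+ t\<in>{t1..t2}. ?g t \<partial>lborel)
        + ennreal (h / p) * (\<integral>\<^sup>+ t\<in>{t1..t2}. gag s p (U t) \<partial>lborel)"
    by (simp add: distrib_right nn_integral_add nn_integral_cmult mult.assoc)
  also have "\<dots> \<le> (\<integral>\<^sup>+ t\<in>{t1..t2}. ennreal (y (t - h)) \<partial>lborel) + ennreal (1 - 1 / p) * (ennreal h * ?I) + ennreal (h / p) * ?I"
  proof (intro add_mono mult_left_mono order_refl)
    show "(\<integral>\<^sup>+ t\<in>{t1..t2}. gag s p (U t) \<partial>lborel) \<le> ?I"
      using h by (intro nn_integral_mono) (auto simp: indicator_def)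
    have "(\<integral>\<^sup>+ t\<in>{t1..t2}. ?g t \<partial>lborel) = (\<integral>\<^sup>+ \<sigma>\<in>{0<..<h}. (\<integral>\<^sup>+ t\<in>{t1..t2}. gag s p (U (t - \<sigma>)) \<partial>lborel) \<partial>lborel)"
      by (rule nn_integral_lag[where f = "\<lambda>\<tau> t. gag s p (U \<tau>)"]) measurable
    also have "\<dots> \<le> (\<integral>\<^sup>+ \<sigma>\<in>{0<..<h}. ?I \<partial>lborel)"
    proof (rule nn_integral_mono)
      fix \<sigma> :: real
      have "(\<integral>\<^sup>+ t\<in>{t1..t2}. gag s p (U (t - \<sigma>)) \<partial>lborel) = (\<integral>\<^sup>+ t. gag s p (U t) * indicator {t1..t2} (\<sigma> + t) \<partial>lborel)"
        by (subst nn_integral_real_affine[where c = 1 and t = \<sigma>]) auto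
      also have "\<dots> \<le> ?I" if "\<sigma> \<in> {0<..<h}"
        using that by (intro nn_integral_mono) (auto simp: indicator_def)
      finally show "(\<integral>\<^sup>+ t\<in>{t1..t2}. gag s p (U (t - \<sigma>)) \<partial>lborel) * indicator {0<..<h} \<sigma> \<le> ?I * indicator {0<..<h} \<sigma>"
        by (auto simp: indicator_def)
    qed
    also have "\<dots> = ennreal h * ?I"
      using h by (subst nn_integral_cmult_indicator) (simp_all add: mult.commute)
    finally show "(\<integral>\<^sup>+ t\<in>{t1..t2}. ?g t \<partial>lborel) \<le> ennreal h * ?I" .
  qed auto
  also have "\<dots> = (\<integral>\<^sup>+ t\<in>{t1..t2}. ennreal (y (t - h)) \<partial>lborel) + (ennreal (1 - 1 / p) * ennreal h + ennreal (h / p)) * ?I"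
    by (simp add: distrib_right mult.assoc add.assoc)
  also have "ennreal (1 - 1 / p) * ennreal h + ennreal (h / p) = ennreal h"
  proof -
    have "ennreal (1 - 1 / p) * ennreal h + ennreal (h / p) = ennreal ((1 - 1 / p) * h + h / p)"
      using p h by (simp add: ennreal_mult)
    then show ?thesis
      by (simp add: left_diff_distrib)
  qed
  finally show ?thesis .
qed

text \<open>Fatou's lemma in time on top of the bound at almost every time. The slack
  \<open>\<epsilon>\<close> turns a liminf into an inequality for all small lags, which can then be
  integrated over the lag; a negative left side is read as 0 by \<open>ennreal\<close>.\<close>

lemma excess_eventually_ge:
  assumes t: "0 < t1" "t1 < t2" and \<epsilon>: "0 < \<epsilon>"
  shows "\<forall>\<^sub>F \<sigma> in at_right 0. ennreal (2 * enn2real (\<integral>\<^sup>+ t\<in>{t1..t2}. gag s p (U t) \<partial>lborel) - \<epsilon>)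
    \<le> (\<integral>\<^sup>+ t\<in>{t1..t2}. gag_excess s p (U (t - \<sigma>)) (U t) \<partial>lborel)"
proof (rule sequentially_imp_eventually_at_right[OF t(1)])
  fix \<sigma> :: "nat \<Rightarrow> real"
  assume \<sigma>: "\<And>n. 0 < \<sigma> n" "\<And>n. \<sigma> n < t1" "\<sigma> \<longlonglongrightarrow> 0"
  define I where "I = (\<integral>\<^sup>+ t\<in>{t1..t2}. gag s p (U t) \<partial>lborel)"
  have "I \<le> (\<integral>\<^sup>+ t\<in>{0<..<t2 + 1}. gag s p (U t) \<partial>lborel)"
    unfolding I_def using t by (intro nn_integral_mono) (auto simp: indicator_def)
  then have I_fin: "I < top"
    using gag_U_integrable[of "t2 + 1"] t by (auto intro: le_less_trans)
  have "AE t in lborel. \<forall>n. 0 < t - \<sigma> n \<longrightarrow> U (t - \<sigma> n) \<in> W0 s p \<Omega>"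
    unfolding AE_all_countable using AE_lborel_shift[OF U_W0] by blast
  then have "AE t in lborel. 2 * (gag s p (U t) * indicator {t1..t2} t)
      \<le> liminf (\<lambda>n. gag_excess s p (U (t - \<sigma> n)) (U t) * indicator {t1..t2} t)"
    using U_W0
  proof eventually_elim
    case (elim t)
    show ?case
    proof (cases "t \<in> {t1..t2}")
      case True
      then have "\<sigma> n < t" for n
        using \<sigma>(2)[of n] by simp
      then show ?thesis
        using gag_excess_liminf[of t \<sigma>] elim True t \<sigma> by simp
    qed simp
  qed
  then have "(\<integral>\<^sup>+ t. 2 * (gag s p (U t) * indicator {t1..t2} t) \<partial>lborel)
      \<le> (\<integral>\<^sup>+ t. liminf (\<lambda>n. gag_excess s p (U (t - \<sigma> n)) (U t) * indicator {t1..t2} t) \<partial>lborel)"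
    by (rule nn_integral_mono_AE)
  also have "\<dots> \<le> liminf (\<lambda>n. \<integral>\<^sup>+ t\<in>{t1..t2}. gag_excess s p (U (t - \<sigma> n)) (U t) \<partial>lborel)"
    by (intro nn_integral_liminf) measurable
  finally have le: "2 * I \<le> liminf (\<lambda>n. \<integral>\<^sup>+ t\<in>{t1..t2}. gag_excess s p (U (t - \<sigma> n)) (U t) \<partial>lborel)"
    unfolding I_def by (simp add: nn_integral_cmult)
  have I2: "2 * I = ennreal (2 * enn2real I)"
    using I_fin by (simp add: ennreal_mult)
  show "\<forall>\<^sub>F n in sequentially. ennreal (2 * enn2real (\<integral>\<^sup>+ t\<in>{t1..t2}. gag s p (U t) \<partial>lborel) - \<epsilon>)
      \<le> (\<integral>\<^sup>+ t\<in>{t1..t2}. gag_excess s p (U (t - \<sigma> n)) (U t) \<partial>lborel)"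
  proof (cases "2 * enn2real I - \<epsilon> \<le> 0")
    case True
    then show ?thesis
      by (simp add: I_def ennreal_neg)
  next
    case False
    then have "ennreal (2 * enn2real I - \<epsilon>) < 2 * I"
      unfolding I2 using \<epsilon> by (intro ennreal_lessI) auto
    then have "\<forall>\<^sub>F n in sequentially. ennreal (2 * enn2real I - \<epsilon>)
        < (\<integral>\<^sup>+ t\<in>{t1..t2}. gag_excess s p (U (t - \<sigma> n)) (U t) \<partial>lborel)"
      using le by (intro less_LiminfD) (rule less_le_trans)
    then show ?thesis
      unfolding I_def by eventually_elim (rule less_imp_le)
  qed
qed

text \<open>The averaged inequality is divided by the lag. The averages of \<open>y\<close> and of
  its shift differ only near the ends of the interval, which leaves difference quotients of the
  primitive \<open>Y\<close> tending to \<open>y t1\<close> and \<open>y t2\<close>. In the limit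
  \<open>2 * I - \<epsilon>\<close> stands on the left and \<open>I\<close> on the right.\<close>

lemma energy_inequality:
  assumes t: "0 < t1" "t1 < t2"
  shows "y t2 + enn2real (\<integral>\<^sup>+ t\<in>{t1..t2}. gag s p (U t) \<partial>lborel) \<le> y t1"
proof -
  \<comment> \<open>\<open>t2\<close> has to be an interior point of \<open>{0..T}\<close>, so that
    \<open>Y\<close> has a two-sided derivative there.\<close>
  define T where "T = t2 + 1"
  define I where "I = enn2real (\<integral>\<^sup>+ t\<in>{t1..t2}. gag s p (U t) \<partial>lborel)"
  define g where "g t = enn2real (gag s p (U t))" for t
  have [measurable]: "g \<in> borel_measurable borel"
    unfolding g_def by measurable
  have g_int: "integrable lborel (\<lambda>t. indicator {0<..<T} t * g t)"
    and g_eq: "\<And>a b :: real. 0 < a \<Longrightarrow> b < T \<Longrightarrow> (\<integral>\<^sup>+ t\<in>{a..b}. gag s p (U t) \<partial>lborel) = ennreal (\<integral>t. indicator {a..b} t * g t \<partial>lborel)"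
  proof -
    have "AE t in lborel. ennreal (indicator {0<..<T} t * g t) = gag s p (U t) * indicator {0<..<T} t"
      using gag_U_finite by eventually_elim (auto simp: indicator_def g_def)
    then have "(\<integral>\<^sup>+ t. ennreal (indicator {0<..<T} t * g t) \<partial>lborel) = (\<integral>\<^sup>+ t\<in>{0<..<T}. gag s p (U t) \<partial>lborel)"
      by (rule nn_integral_cong_AE)
    then show g_int: "integrable lborel (\<lambda>t. indicator {0<..<T} t * g t)"
      using gag_U_integrable[of T] t by (intro integrableI_nonneg) (auto simp: g_def T_def)
    fix a b :: real assume ab: "0 < a" "b < T"
    have int: "integrable lborel (\<lambda>t. indicator {a..b} t * g t)"
      by (rule Bochner_Integration.integrable_bound[OF g_int]) (use ab in \<open>auto simp: indicator_def\<close>)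
    have "(\<integral>\<^sup>+ t\<in>{a..b}. gag s p (U t) \<partial>lborel) = (\<integral>\<^sup>+ t. ennreal (indicator {a..b} t * g t) \<partial>lborel)"
    proof (rule nn_integral_cong_AE)
      show "AE t in lborel. gag s p (U t) * indicator {a..b} t = ennreal (indicator {a..b} t * g t)"
        using gag_U_finite by eventually_elim (use ab in \<open>auto simp: indicator_def g_def\<close>)
    qed
    also have "\<dots> = ennreal (\<integral>t. indicator {a..b} t * g t \<partial>lborel)"
      using int by (intro nn_integral_eq_integral) (auto simp: g_def)
    finally show "(\<integral>\<^sup>+ t\<in>{a..b}. gag s p (U t) \<partial>lborel) = ennreal (\<integral>t. indicator {a..b} t * g t \<partial>lborel)" .
  qed
  define G where "G a = (\<integral>t. indicator {a..t2} t * g t \<partial>lborel)" for a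
  have G_nonneg: "0 \<le> G a" for a
    unfolding G_def by (intro integral_nonneg_AE) (auto simp: g_def)
  have I_eq: "I = G t1"
    unfolding I_def using t G_nonneg[of t1] by (subst g_eq) (auto simp: T_def G_def)
  define Y where "Y t = integral {0..t} y" for t
  have DY: "(Y has_real_derivative y t) (at t)" if "0 < t" "t < T" for t
  proof -
    have "at t within {0..T} = at t"
      using that by (intro at_within_interior) simp
    then show ?thesis
      using integral_has_real_derivative[OF y_continuous[of T], of t] that by (simp add: Y_def[abs_def])
  qed
  \<comment> \<open>Lags tending to 0; the 2 makes them strictly smaller than \<open>t1\<close> from
    \<open>n = 0\<close> on, as \<open>averaged_energy\<close> requires.\<close>
  define \<delta> where "\<delta> n = t1 / (real n + 2)" for n :: nat
  have \<delta>: "0 < \<delta> n" "\<delta> n < t1" for n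
    using t by (auto simp: \<delta>_def field_simps intro!: add_pos_nonneg mult_nonneg_nonneg)
  have \<delta>0: "\<delta> \<longlonglongrightarrow> 0"
    unfolding \<delta>_def
    by (intro real_tendsto_divide_at_top[OF tendsto_const] filterlim_at_top_mono[OF filterlim_real_sequentially]) auto
  have G_lim: "(\<lambda>n. G (t1 - \<delta> n)) \<longlonglongrightarrow> G t1"
    unfolding G_def
  proof (rule integral_dominated_convergence[OF _ _ g_int])
    show "AE t in lborel. (\<lambda>n. indicator {t1 - \<delta> n..t2} t * g t) \<longlonglongrightarrow> indicator {t1..t2} t * g t"
    proof (rule AE_I2)
      fix r
      have "\<forall>\<^sub>F n in sequentially. indicat_real {t1 - \<delta> n..t2} r = indicator {t1..t2} r"
      proof (cases "r < t1")
        case True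
        have "\<forall>\<^sub>F n in sequentially. \<delta> n < t1 - r"
          using \<delta>0 True by (intro order_tendstoD) auto
        then show ?thesis
          by eventually_elim (use True in \<open>auto simp: indicator_def\<close>)
      next
        case False
        then show ?thesis
          using \<delta>(1) by (intro always_eventually) (auto simp: indicator_def diff_le_eq intro: order_trans[OF _ add_increasing2[OF less_imp_le]])
      qed
      then show "(\<lambda>n. indicator {t1 - \<delta> n..t2} r * g r) \<longlonglongrightarrow> indicator {t1..t2} r * g r"
        by (intro tendsto_mult tendsto_const tendsto_eventually)
    qed
    show "AE t in lborel. norm (indicator {t1 - \<delta> n..t2} t * g t) \<le> indicator {0<..<T} t * g t" for n
      using \<delta>[of n] by (intro AE_I2) (auto simp: indicator_def g_def T_def)
  qed measurable
  have quot: "(\<lambda>n. (Y r - Y (r - \<delta> n)) / \<delta> n) \<longlonglongrightarrow> y r" if "0 < r" "r < T" for r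
  proof -
    have "filterlim (\<lambda>n. - \<delta> n) (at 0) sequentially"
    proof -
      have "(\<lambda>n. - \<delta> n) \<longlonglongrightarrow> - 0"
        by (intro tendsto_minus \<delta>0)
      then show ?thesis
        using \<delta>(1) by (auto simp: filterlim_at intro!: always_eventually less_imp_neq[THEN not_sym])
    qed
    then have "(\<lambda>n. (Y (r + - \<delta> n) - Y r) / (- \<delta> n)) \<longlonglongrightarrow> y r"
      using filterlim_compose[OF DY[OF that, unfolded DERIV_def]] by blast
    moreover have "(Y (r + - d) - Y r) / (- d) = (Y r - Y (r - d)) / d" for d
      by (metis add_uminus_conv_diff minus_diff_eq minus_divide_divide)
    ultimately show ?thesis
      by simp
  qed
  have key: "y t2 + (2 * I - \<epsilon>) \<le> y t1 + I" if \<epsilon>: "0 < \<epsilon>" for \<epsilon>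
  proof -
    \<comment> \<open>\<open>ennreal\<close> does not distinguish \<open>c\<close> from
      \<open>2 * I - \<epsilon>\<close>, but a nonnegative number can be carried back to an
      inequality of reals.\<close>
    define c where "c = max 0 (2 * I - \<epsilon>)"
    obtain b where b: "b > 0" and ge: "\<And>\<sigma>. 0 < \<sigma> \<Longrightarrow> \<sigma> < b \<Longrightarrow>
        ennreal (2 * I - \<epsilon>) \<le> (\<integral>\<^sup>+ t\<in>{t1..t2}. gag_excess s p (U (t - \<sigma>)) (U t) \<partial>lborel)"
      using excess_eventually_ge[OF t \<epsilon>] unfolding eventually_at_right_field I_def by blast
    have "\<forall>\<^sub>F n in sequentially. \<delta> n < b"
      using \<delta>0 b by (intro order_tendstoD) auto
    then have "\<forall>\<^sub>F n in sequentially. c + (Y t2 - Y (t2 - \<delta> n)) / \<delta> n \<le> (Y t1 - Y (t1 - \<delta> n)) / \<delta> n + G (t1 - \<delta> n)"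
    proof eventually_elim
      case (elim n)
      let ?h = "\<delta> n"
      have h: "0 < ?h" "?h < t1"
        using \<delta> by auto
      have c_eq: "ennreal (2 * I - \<epsilon>) = ennreal c"
        by (simp add: c_def max_def ennreal_neg)
      have "ennreal c * ennreal ?h = (\<integral>\<^sup>+ \<sigma>\<in>{0<..<?h}. ennreal c \<partial>lborel)"
        using h by (simp add: nn_integral_cmult)
      also have "\<dots> \<le> (\<integral>\<^sup>+ \<sigma>\<in>{0<..<?h}. (\<integral>\<^sup>+ t\<in>{t1..t2}. gag_excess s p (U (t - \<sigma>)) (U t) \<partial>lborel) \<partial>lborel)"
        using ge elim unfolding c_eq by (intro nn_integral_mono) (auto simp: indicator_def)
      finally have 1: "ennreal c * ennreal ?h \<le> \<dots>" .
      have 2: "(\<integral>\<^sup>+ t\<in>{t1..t2}. ennreal (y t) \<partial>lborel) = ennreal (Y t2 - Y t1)"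
        using t y_nonneg by (intro nn_integral_FTC_Icc DY) (auto simp: T_def)
      have D_shift: "((\<lambda>r. Y (r - ?h)) has_real_derivative y (r - ?h)) (at r)" if "t1 \<le> r" "r \<le> t2" for r
        using DY[of "r - ?h"] DERIV_shift[of Y "y (r - ?h)" r "- ?h"] that h by (simp add: T_def)
      have 3: "(\<integral>\<^sup>+ t\<in>{t1..t2}. ennreal (y (t - ?h)) \<partial>lborel) = ennreal (Y (t2 - ?h) - Y (t1 - ?h))"
        using t y_nonneg D_shift by (intro nn_integral_FTC_Icc[where F = "\<lambda>r. Y (r - ?h)"]) auto
      have 4: "(\<integral>\<^sup>+ t\<in>{t1 - ?h..t2}. gag s p (U t) \<partial>lborel) = ennreal (G (t1 - ?h))"
        unfolding G_def using h by (intro g_eq) (auto simp: T_def)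
      have Y_mono: "Y r \<le> Y r'" if "0 < r" "r \<le> r'" "r' < T" for r r'
        using that y_nonneg by (intro DERIV_nonneg_imp_nondecreasing[OF that(2)]) (auto intro!: exI[of _ "y _"] DY)
      have "ennreal c * ennreal ?h + ennreal (Y t2 - Y t1)
          \<le> ennreal (Y (t2 - ?h) - Y (t1 - ?h)) + ennreal ?h * ennreal (G (t1 - ?h))"
        using averaged_energy[OF h t(2)] add_right_mono[OF 1] unfolding 2 3 4 by (rule order_trans[rotated])
      then have "ennreal (c * ?h + (Y t2 - Y t1)) \<le> ennreal (Y (t2 - ?h) - Y (t1 - ?h) + ?h * G (t1 - ?h))"
        using h t Y_mono[of t1 t2] Y_mono[of "t1 - ?h" "t2 - ?h"] G_nonneg[of "t1 - ?h"]
        by (simp add: T_def c_def flip: ennreal_mult ennreal_plus)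
      then have "c * ?h + (Y t2 - Y t1) \<le> Y (t2 - ?h) - Y (t1 - ?h) + ?h * G (t1 - ?h)"
        using h t Y_mono[of "t1 - ?h" "t2 - ?h"] G_nonneg[of "t1 - ?h"]
        by (subst (asm) ennreal_le_iff) (auto simp: T_def)
      then have "(c * ?h + (Y t2 - Y (t2 - ?h))) / ?h \<le> ((Y t1 - Y (t1 - ?h)) + ?h * G (t1 - ?h)) / ?h"
        using h by (intro divide_right_mono) auto
      then show ?case
        using h by (simp add: add_divide_distrib)
    qed
    moreover have "(\<lambda>n. c + (Y t2 - Y (t2 - \<delta> n)) / \<delta> n) \<longlonglongrightarrow> c + y t2"
      using t by (intro tendsto_add tendsto_const quot) (auto simp: T_def)
    moreover have "(\<lambda>n. (Y t1 - Y (t1 - \<delta> n)) / \<delta> n + G (t1 - \<delta> n)) \<longlonglongrightarrow> y t1 + G t1"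
      using t by (intro tendsto_add quot G_lim) (auto simp: T_def)
    ultimately have "c + y t2 \<le> y t1 + G t1"
      using tendsto_le[OF sequentially_bot] by blast
    then show ?thesis
      unfolding I_eq by (simp add: c_def I_eq)
  qed
  have "y t2 + I \<le> y t1 + \<epsilon>" if "0 < \<epsilon>" for \<epsilon>
    using key[OF that] by linarith
  then show ?thesis
    unfolding I_def by (rule field_le_epsilon)
qed

section \<open>Decay of \<open>y\<close> and extinction in finite time\<close>

lemma y_power_le_gag:
  assumes t: "0 \<le> t" and W: "U t \<in> W0 s p \<Omega>"
  shows "S * measure lborel \<Omega> powr (p / q - p / 2) * y t powr (p / 2) \<le> enn2real (gag s p (U t))"
proof -
  define m where "m = measure lborel \<Omega>"
  define g where "g = enn2real (gag s p (U t))"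
  have "ennreal (y t) = Lp_mass M 2 (U t)"
    using U_L2[OF t] by (subst Lp_mass_eq_integral) (auto simp: y_def)
  also have "\<dots> \<le> ennreal (m powr (1 - 2 / q) * (g / S) powr (2 / p))"
    using W0_L2[OF W] by (simp add: m_def g_def)
  finally have "y t \<le> m powr (1 - 2 / q) * (g / S) powr (2 / p)"
    by (subst (asm) ennreal_le_iff) auto
  then have "y t powr (p / 2) \<le> (m powr (1 - 2 / q) * (g / S) powr (2 / p)) powr (p / 2)"
    using p y_nonneg by (intro powr_mono2) auto
  also have "\<dots> = m powr (p / 2 - p / q) * (g / S)"
    using p S q by (simp add: powr_mult powr_powr g_def algebra_simps)
  finally have "S * m powr (p / q - p / 2) * y t powr (p / 2)
      \<le> S * m powr (p / q - p / 2) * (m powr (p / 2 - p / q) * (g / S))"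
    using S by (intro mult_left_mono) auto
  also have "\<dots> = (m powr (p / q - p / 2) * m powr (p / 2 - p / q)) * g"
    using S by simp
  \<comment> \<open>The exponents cancel, but \<open>0 powr 0\<close> is 0; the inequality covers a
    domain of measure 0 as well.\<close>
  also have "\<dots> \<le> 1 * g"
    by (intro mult_right_mono) (auto simp: g_def simp flip: powr_add)
  finally show ?thesis
    by (simp add: m_def g_def)
qed

text \<open>The energy inequality on \<open>{r..t2}\<close> for each \<open>r\<close>, with the
  energy bounded below by \<open>y_power_le_gag\<close> at almost every time, is the integral
  inequality of the comparison lemma with \<theta> = p / 2.\<close>

lemma power_decay:
  assumes p2: "p < 2" and t: "0 < t1" "t1 < t2" and pos: "0 < y t2"
  shows "y t2 powr (1 - p / 2) + (1 - p / 2) * (S * measure lborel \<Omega> powr (p / q - p / 2)) * (t2 - t1)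
    \<le> y t1 powr (1 - p / 2)"
proof (rule decay_of_power_inequality)
  define c where "c = S * measure lborel \<Omega> powr (p / q - p / 2)"
  have c: "0 \<le> c"
    using S by (simp add: c_def)
  show cont: "continuous_on {t1..t2} y"
    using t by (intro continuous_on_subset[OF y_continuous[of t2]]) auto
  fix r assume r: "r \<in> {t1..t2}"
  show "0 \<le> y r"
    by (rule y_nonneg)
  show "y t2 + S * measure lborel \<Omega> powr (p / q - p / 2) * integral {r..t2} (\<lambda>r. y r powr (p / 2)) \<le> y r"
  proof (cases "r = t2")
    case False
    then have r': "0 < r" "r < t2"
      using r t by auto
    let ?G = "\<integral>\<^sup>+ t\<in>{r..t2}. gag s p (U t) \<partial>lborel"
    have "((\<lambda>r. c * y r powr (p / 2)) has_integral c * integral {r..t2} (\<lambda>r. y r powr (p / 2))) {r..t2}"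
      using p r y_nonneg
      by (intro has_integral_mult_right integrable_integral integrable_continuous_real continuous_on_powr'
          continuous_on_const continuous_on_subset[OF cont]) auto
    moreover have "(\<lambda>t. indicator {r..t2} t * (c * y t powr (p / 2))) = (\<lambda>t. if t \<in> {r..t2} then c * y t powr (p / 2) else 0)"
      by (auto simp: indicator_def fun_eq_iff)
    ultimately have "((\<lambda>t. indicator {r..t2} t * (c * y t powr (p / 2))) has_integral c * integral {r..t2} (\<lambda>r. y r powr (p / 2))) UNIV"
      by (simp only: has_integral_restrict_UNIV)
    then have "ennreal (c * integral {r..t2} (\<lambda>r. y r powr (p / 2))) = (\<integral>\<^sup>+ t. ennreal (indicator {r..t2} t * (c * y t powr (p / 2))) \<partial>lborel)"
      using c by (intro nn_integral_has_integral_lborel[symmetric]) auto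
    also have "\<dots> \<le> ?G"
    proof (rule nn_integral_mono_AE)
      show "AE t in lborel. ennreal (indicator {r..t2} t * (c * y t powr (p / 2))) \<le> gag s p (U t) * indicator {r..t2} t"
        using U_W0
      proof eventually_elim
        case (elim t)
        show ?case
        proof (cases "t \<in> {r..t2}")
          case True
          then have W: "U t \<in> W0 s p \<Omega>"
            using elim r' by simp
          then have "ennreal (c * y t powr (p / 2)) \<le> ennreal (enn2real (gag s p (U t)))"
            using y_power_le_gag[OF _ W] True r' by (intro ennreal_leI) (auto simp: c_def)
          then show ?thesis
            using True W0_gag[OF W] by simp
        qed simp
      qed
    qed
    finally have le: "ennreal (c * integral {r..t2} (\<lambda>r. y r powr (p / 2))) \<le> ?G" .
    have "?G \<le> (\<integral>\<^sup>+ t\<in>{0<..<t2 + 1}. gag s p (U t) \<partial>lborel)"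
      using r' by (intro nn_integral_mono) (auto simp: indicator_def)
    then have "?G < top"
      using gag_U_integrable[of "t2 + 1"] r' by (auto intro: le_less_trans)
    then have "c * integral {r..t2} (\<lambda>r. y r powr (p / 2)) \<le> enn2real ?G"
      using le by (cases ?G) (auto simp: ennreal_le_iff2)
    then show ?thesis
      using energy_inequality[OF r'] by (simp add: c_def)
  qed simp
qed (use assms S p in auto)

text \<open>If \<open>y t\<close> were positive, the linear decay of its power 1 - p/2 would hold
  from \<open>t / (n + 2)\<close> up to \<open>t\<close>. Continuity of \<open>y\<close> at 0 moves
  the starting time to 0, and then the decay has used up the whole initial value.\<close>

lemma extinction:
  assumes p2: "p < 2" and m: "0 < measure lborel \<Omega>" and t: "0 \<le> t"
    and ge: "2 / ((2 - p) * S) * y 0 powr (1 - p / 2) * measure lborel \<Omega> powr (p / 2 - p / q) \<le> t"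
  shows "y t = 0"
proof (rule ccontr)
  define c where "c = S * measure lborel \<Omega> powr (p / q - p / 2)"
  have c: "0 < c"
    using S m by (simp add: c_def)
  \<comment> \<open>The claimed bound is the initial value divided by the speed of decay: 2 / (2 -
    p) is 1 / (1 - p/2), and the power of the volume moves to the denominator with the opposite
    exponent.\<close>
  have "2 / ((2 - p) * S) * y 0 powr (1 - p / 2) * measure lborel \<Omega> powr (p / 2 - p / q)
      = y 0 powr (1 - p / 2) / ((1 - p / 2) * c)"
  proof -
    have "measure lborel \<Omega> powr (p / 2 - p / q) = 1 / measure lborel \<Omega> powr (p / q - p / 2)"
      using powr_minus_divide[of "measure lborel \<Omega>" "p / q - p / 2"] by simp
    moreover have "2 / ((2 - p) * S) * a * (1 / k) = a / ((1 - p / 2) * (S * k))" if "0 < k" for a k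
      using p2 S that by (simp add: divide_simps)
    ultimately show ?thesis
      using m by (simp add: c_def)
  qed
  then have ge': "y 0 powr (1 - p / 2) \<le> (1 - p / 2) * c * t"
    using ge c p2 by (simp add: pos_divide_le_eq mult_ac)
  assume "y t \<noteq> 0"
  then have pos: "0 < y t"
    using y_nonneg[of t] by simp
  have t0: "0 < t"
    using t ge' pos by (cases "t = 0") auto
  have "(\<lambda>n. y (t / (real n + 2)) powr (1 - p / 2) - (1 - p / 2) * c * (t - t / (real n + 2)))
      \<longlonglongrightarrow> y 0 powr (1 - p / 2) - (1 - p / 2) * c * (t - 0)"
  proof -
    have lim: "(\<lambda>n. t / (real n + 2)) \<longlonglongrightarrow> 0"
      by (intro real_tendsto_divide_at_top[OF tendsto_const] filterlim_at_top_mono[OF filterlim_real_sequentially]) auto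
    have "(\<lambda>n. y (t / (real n + 2))) \<longlonglongrightarrow> y 0"
      by (rule continuous_on_tendsto_compose[OF y_continuous[OF t0] lim])
         (use t0 in \<open>auto intro!: always_eventually simp: divide_le_eq\<close>)
    then show ?thesis
      using p2 y_nonneg lim by (intro tendsto_diff tendsto_mult tendsto_const tendsto_powr') auto
  qed
  moreover have "y t powr (1 - p / 2) \<le> y (t / (real n + 2)) powr (1 - p / 2) - (1 - p / 2) * c * (t - t / (real n + 2))" for n
  proof -
    have "0 < t / (real n + 2)" "t / (real n + 2) < t"
      using t0 by (simp_all add: divide_less_eq add_pos_nonneg)
    then show ?thesis
      using power_decay[OF p2 _ _ pos, of "t / (real n + 2)"] by (simp add: c_def)
  qed
  ultimately have "y t powr (1 - p / 2) \<le> y 0 powr (1 - p / 2) - (1 - p / 2) * c * (t - 0)"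
    by (intro LIMSEQ_le_const) auto
  then have "y t powr (1 - p / 2) \<le> 0"
    using ge' unfolding diff_zero by linarith
  then show False
    using pos by simp
qed

lemma y_zero_imp:
  assumes "0 \<le> t" "y t = 0"
  shows "AE x in lborel. x \<in> \<Omega> \<longrightarrow> u x t = 0"
proof -
  have "Lp_mass M 2 (U t) = 0"
    using assms U_L2[of t] by (subst Lp_mass_eq_integral) (auto simp: y_def)
  then have "AE x in M. u x t = 0"
    unfolding Lp_mass_2 by (subst (asm) nn_integral_0_iff_AE) auto
  then show ?thesis
    by (subst (asm) AE_restrict_space_iff) auto
qed

text \<open>The datum \<open>u0\<close> is tied to \<open>u\<close> by a limit from the right, while
  \<open>y 0\<close> is built from the value of \<open>u\<close> at time 0. Both are L^2 limits of
  the same states, so they agree almost everywhere in \<open>\<Omega>\<close>.\<close>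

lemma y_initial:
  assumes [measurable]: "u0 \<in> borel_measurable borel"
  shows "y 0 = enn2real (\<integral>\<^sup>+ x\<in>\<Omega>. ennreal ((u0 x)\<^sup>2) \<partial>lborel)"
proof -
  have [measurable]: "u0 \<in> borel_measurable M"
    by (rule measurable_M) fact
  \<comment> \<open>The constant 2 of \<open>Lp_mass_add_le\<close> for exponent 2 and equal
    weights, left in the form in which that lemma produces it.\<close>
  let ?C = "ennreal ((1 / 2) powr (1 - 2))"
  have "((\<lambda>t. Lp_mass M 2 (\<lambda>x. u x t - u x 0)) \<longlongrightarrow> 0) (at_right 0)"
    using U_continuous[of 1 0] by (simp add: at_within_Icc_at_right)
  moreover have "((\<lambda>t. Lp_mass M 2 (\<lambda>x. u x t - u0 x)) \<longlongrightarrow> 0) (at_right 0)"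
    using sol[of 1] by (simp add: energy_solution_def Lp_mass_M)
  ultimately have "((\<lambda>t. ?C * Lp_mass M 2 (\<lambda>x. u x t - u x 0) + ?C * Lp_mass M 2 (\<lambda>x. u x t - u0 x)) \<longlongrightarrow> ?C * 0 + ?C * 0) (at_right 0)"
    by (intro tendsto_add ennreal_tendsto_cmult) auto
  moreover have "Lp_mass M 2 (\<lambda>x. u x 0 - u0 x) \<le> ?C * Lp_mass M 2 (\<lambda>x. u x t - u x 0) + ?C * Lp_mass M 2 (\<lambda>x. u x t - u0 x)" for t
    using Lp_mass_add_le[of "\<lambda>x. u x 0 - u x t" M "\<lambda>x. u x t - u0 x" 2 "1 / 2"]
      Lp_mass_minus_commute[of M 2 "U 0" "U t"] by simp
  ultimately have "Lp_mass M 2 (\<lambda>x. u x 0 - u0 x) \<le> ?C * 0 + ?C * 0"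
    by (intro tendsto_lowerbound[OF _ always_eventually]) auto
  then have "AE x in M. u x 0 = u0 x"
    unfolding Lp_mass_2 by (simp, subst (asm) nn_integral_0_iff_AE) auto
  then have "Lp_mass M 2 (U 0) = Lp_mass M 2 u0"
    unfolding Lp_mass_def by (intro nn_integral_cong_AE) auto
  moreover have "Lp_mass M 2 (U 0) = ennreal (y 0)"
    using U_L2[of 0] by (subst Lp_mass_eq_integral) (auto simp: y_def)
  ultimately show ?thesis
    unfolding Lp_mass_M[symmetric] by (metis enn2real_ennreal y_nonneg)
qed

end

theorem theorem5p1:
  fixes \<Omega> :: "'a::euclidean_space set" and s p S :: real
    and u0 :: "'a \<Rightarrow> real" and u :: "'a \<Rightarrow> real \<Rightarrow> real"
  assumes "open \<Omega>" "connected \<Omega>" "bounded \<Omega>" "\<Omega> \<noteq> {}"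
    and "0 < s" "s < 1" "1 < p" "p < real DIM('a)"
    and "2 * real DIM('a) / (real DIM('a) + 2 * s) \<le> p" "p < 2"
    and "S > 0"
    and sobolev: "\<forall>v :: 'a \<Rightarrow> real. test_fun UNIV v \<longrightarrow>
       ennreal (S * enn2real (lpn (p * DIM('a) / (DIM('a) - p * s)) v)
                  powr (p / (p * DIM('a) / (DIM('a) - p * s)))) \<le> gag s p v"
    and "u0 \<in> borel_measurable lborel"
    and "(\<integral>\<^sup>+ x\<in>\<Omega>. ennreal ((u0 x)\<^sup>2) \<partial>lborel) < \<infinity>"
    and "AE x in lborel. x \<in> \<Omega> \<longrightarrow> 0 \<le> u0 x"
    and "\<forall>T>0. energy_solution s p \<Omega> u0 T u"
    and "AE z in lborel \<Otimes>\<^sub>M lborel. 0 < snd z \<longrightarrow> 0 \<le> u (fst z) (snd z)"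
  shows "\<exists>Tstar. 0 \<le> Tstar \<and>
     Tstar \<le> 2 / ((2 - p) * S)
       * (enn2real (\<integral>\<^sup>+ x\<in>\<Omega>. ennreal ((u0 x)\<^sup>2) \<partial>lborel) powr (1 / 2)) powr (2 - p)
       * measure lborel \<Omega> powr (p / 2 - p / (p * DIM('a) / (DIM('a) - p * s))) \<and>
     (\<forall>t\<ge>Tstar. AE x in lborel. x \<in> \<Omega> \<longrightarrow> u x t = 0)"
proof -
  define N where "N = real DIM('a)"
  define q where "q = p * DIM('a) / (DIM('a) - p * s)"
  have "p * s < p * 1"
    using \<open>1 < p\<close> \<open>s < 1\<close> by (intro mult_strict_left_mono) auto
  then have N: "0 < N - p * s" "0 < N + 2 * s"
    using \<open>p < real DIM('a)\<close> \<open>0 < s\<close> by (auto simp: N_def)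
  have "2 * N \<le> p * (N + 2 * s)"
    using assms(9) N(2) by (simp add: N_def pos_divide_le_eq)
  \<comment> \<open>The bound on \<open>p\<close> rearranged into the statement that the Sobolev
    exponent is at least 2.\<close>
  then have "2 * (N - p * s) \<le> p * N"
    by (simp add: algebra_simps)
  then have q: "2 \<le> q"
    using N(1) by (simp add: q_def N_def pos_le_divide_eq)
  interpret frac_flow \<Omega> s p S q u0 u
    using assms q by unfold_locales (auto simp: q_def)
  \<comment> \<open>A nonempty open set is not negligible. Positivity of the volume makes the speed
    of decay positive.\<close>
  have m: "0 < measure lborel \<Omega>"
  proof -
    have "\<Omega> \<notin> null_sets lborel"
      using open_not_negligible[OF \<open>open \<Omega>\<close> \<open>\<Omega> \<noteq> {}\<close>] null_sets_completionI[of \<Omega> lborel]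
      by (auto simp: negligible_iff_null_sets)
    then have "emeasure lborel \<Omega> \<noteq> 0"
      by (auto simp: null_sets_def)
    then show ?thesis
      using emeasure_bounded_finite[OF \<open>bounded \<Omega>\<close>]
      by (simp add: measure_def enn2real_positive_iff zero_less_iff_neq_zero less_top)
  qed
  define A where "A = enn2real (\<integral>\<^sup>+ x\<in>\<Omega>. ennreal ((u0 x)\<^sup>2) \<partial>lborel)"
  have A: "y 0 = A"
    unfolding A_def using assms(13) by (intro y_initial) simp
  define Tstar where "Tstar = 2 / ((2 - p) * S) * (A powr (1 / 2)) powr (2 - p) * measure lborel \<Omega> powr (p / 2 - p / q)"
  \<comment> \<open>The theorem speaks of the norm, \<open>y\<close> is its square: the powers 1/2
    and 2 - p combine to 1 - p/2.\<close>
  have Tstar: "Tstar = 2 / ((2 - p) * S) * y 0 powr (1 - p / 2) * measure lborel \<Omega> powr (p / 2 - p / q)"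
    by (simp add: Tstar_def A powr_powr diff_divide_distrib)
  have "0 \<le> Tstar"
    using \<open>p < 2\<close> \<open>0 < S\<close> by (simp add: Tstar_def)
  moreover have "AE x in lborel. x \<in> \<Omega> \<longrightarrow> u x t = 0" if "Tstar \<le> t" for t
    using that \<open>0 \<le> Tstar\<close> \<open>p < 2\<close> m unfolding Tstar
    by (intro y_zero_imp extinction) auto
  ultimately show ?thesis
    unfolding A_def[symmetric] q_def[symmetric] by (intro exI[of _ Tstar]) (auto simp: Tstar_def)
qed

end
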